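(* Let $F=\alpha^2/\beta$ be a Kropina metric on an $n$-dimensional manifold $M$ with volume form $dV=e^{-(n+1)f}dV_{BH}$, where $f$ is a smooth function on $M$. Suppose $F$ is a weakly weighted Einstein metric with weight constants $a,c$ with respect to $dV$, i.e. there are a scalar function $\sigma=\sigma(x)$ and a 1-form $\theta=\theta_i(x)y^i$ on $M$ such that $$\mathrm{Ric}_{a,c}=(n-1)\left(\frac{3\theta}{F}+\sigma\right)F^2 .$$ Assume that $\nu:=3(n-1)-4a(n+1)-c(n+1)^2\neq 0$. Then $F$ is of isotropic $\mathbf S$-curvature with respect to the Busemann-Hausdorff volume form, i.e. there is a scalar function $k=k(x)$ on $M$ with $\mathbf S_{BH}=(n+1)kF$.
   Context: A Kropina metric is $F=\alpha^2/\beta$, where $\alpha=\sqrt{a_{ij}(x)y^iy^j}$ is a Riemannian metric and $\beta=b_i(x)y^i$ is a 1-form on $M$; it is a conic Finsler metric defined on $A=\{(x,y)\in TM:\beta>0\}$. For a Finsler metric $F$ put $g_{ij}=\frac12[F^2]_{y^iy^j}$, $(g^{ij})=(g_{ij})^{-1}$. Geodesic coefficients: $G^i=\frac14 g^{il}\{[F^2]_{x^ky^l}y^k-[F^2]_{x^l}\}$. Riemann curvature: $R^i_{\ k}=2\frac{\partial G^i}{\partial x^k}-\frac{\partial^2G^i}{\partial x^m\partial y^k}y^m+2G^m\frac{\partial^2G^i}{\partial y^m\partial y^k}-\frac{\partial G^i}{\partial y^m}\frac{\partial G^m}{\partial y^k}$; Ricci curvature: $\mathrm{Ric}(y)=R^m_{\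 m}$. For a volume form $dV=\sigma_{V}(x)dx^1\cdots dx^n$, the distortion is $\tau(x,y)=\ln\big(\sqrt{\det(g_{ij}(x,y))}/\sigma_{V}(x)\big)$. The S-curvature is $\mathbf S(x,y)=\frac{d}{dt}[\tau(c(t),\dot c(t))]|_{t=0}$ and $\dot{\mathbf S}(x,y)=\frac{d}{dt}[\mathbf S(c(t),\dot c(t))]|_{t=0}$, where $c(t)$ is the geodesic of $F$ with $c(0)=x$, $\dot c(0)=y$. The generalized weighted Ricci curvature with weight constants $a,c$ is $\mathrm{Ric}_{a,c}=\mathrm{Ric}+a\dot{\mathbf S}-c\,\mathbf S^2$, with $\mathbf S,\dot{\mathbf S}$ taken with respect to $dV$. The Busemann-Hausdorff volume form is $dV_{BH}=\sigma_{BH}(x)dx^1\cdots dx^n$ with $\sigma_{BH}(x)=\mathrm{Vol}(\mathbf B^n(1))/\mathrm{Vol}\{(y^i)\in\mathbf R^n: F(x,y)<1\}$ (for a conic metric, $y$ ranges over the conic domain); $\mathbf S_{BH}$ denotes the S-curvature with respect to $dV_{BH}$. *)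

theory Defs
  imports "HOL-Analysis.Analysis"
begin

section \<open>Smooth functions on open subsets of Euclidean space\<close>

definition partial :: "'n::finite \<Rightarrow> (real ^ 'n \<Rightarrow> real) \<Rightarrow> real ^ 'n \<Rightarrow> real" where
  "partial i h x = deriv (\<lambda>t. h (x + t *\<^sub>R axis i 1)) 0"

primrec Ck_on :: "nat \<Rightarrow> (real ^ 'n::finite) set \<Rightarrow> (real ^ 'n \<Rightarrow> real) \<Rightarrow> bool" where
  "Ck_on 0 U h \<longleftrightarrow> continuous_on U h"
| "Ck_on (Suc k) U h \<longleftrightarrow> h differentiable_on U \<and> (\<forall>i. Ck_on k U (partial i h))"

text \<open>Only used for open sets \<open>U\<close>.\<close>

definition smooth_on :: "(real ^ 'n::finite) set \<Rightarrow> (real ^ 'n \<Rightarrow> real) \<Rightarrow> bool" where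
  "smooth_on U h \<longleftrightarrow> (\<forall>k. Ck_on k U h)"


section \<open>Smooth manifolds and tensor fields in local coordinates\<close>

text \<open>A chart is a pair of its domain and its coordinate map. The manifold described by an atlas is
  the union of the chart domains; the atlas need not be maximal.\<close>

type_synonym ('m, 'n) chart = "'m set \<times> ('m \<Rightarrow> real ^ 'n)"

definition chart_image :: "('m, 'n::finite) chart \<Rightarrow> (real ^ 'n) set" where
  "chart_image p = snd p ` fst p"

definition chart_point :: "('m, 'n::finite) chart \<Rightarrow> real ^ 'n \<Rightarrow> 'm" where
  "chart_point p = inv_into (fst p) (snd p)"

definition overlap :: "('m, 'n::finite) chart \<Rightarrow> ('m, 'n) chart \<Rightarrow> (real ^ 'n) set" where
  "overlap p q = snd p ` (fst p \<inter> fst q)"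

definition transition :: "('m, 'n::finite) chart \<Rightarrow> ('m, 'n) chart \<Rightarrow> real ^ 'n \<Rightarrow> real ^ 'n" where
  "transition p q x = snd q (chart_point p x)"

definition smooth_atlas ::
  "('m::{t2_space, second_countable_topology}, 'n::finite) chart set \<Rightarrow> bool" where
  "smooth_atlas A \<longleftrightarrow>
     (\<forall>p\<in>A. open (fst p) \<and> open (chart_image p) \<and>
        homeomorphism (fst p) (chart_image p) (snd p) (chart_point p)) \<and>
     (\<forall>p\<in>A. \<forall>q\<in>A. \<forall>i. smooth_on (overlap p q) (\<lambda>x. transition p q x $ i))"

definition smooth_function :: "('m, 'n::finite) chart set \<Rightarrow> ('m \<Rightarrow> real) \<Rightarrow> bool" where
  "smooth_function A h \<longleftrightarrow> (\<forall>p\<in>A. smooth_on (chart_image p) (\<lambda>x. h (chart_point p x)))"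

text \<open>A covariant tensor field is given by its components in every chart, subject to the
  transformation law under the differential of the coordinate changes.\<close>

definition one_form ::
  "('m, 'n::finite) chart set \<Rightarrow> (('m, 'n) chart \<Rightarrow> real ^ 'n \<Rightarrow> real ^ 'n) \<Rightarrow> bool" where
  "one_form A b \<longleftrightarrow>
     (\<forall>p\<in>A. \<forall>i. smooth_on (chart_image p) (\<lambda>x. b p x $ i)) \<and>
     (\<forall>p\<in>A. \<forall>q\<in>A. \<forall>x\<in>overlap p q. \<forall>v.
        b p x \<bullet> v =
        b q (transition p q x) \<bullet> frechet_derivative (transition p q) (at x) v)"

definition riemannian_metric ::
  "('m, 'n::finite) chart set \<Rightarrow> (('m, 'n) chart \<Rightarrow> real ^ 'n \<Rightarrow> real ^ 'n ^ 'n) \<Rightarrow> bool" where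
  "riemannian_metric A g \<longleftrightarrow>
     (\<forall>p\<in>A. \<forall>i j. smooth_on (chart_image p) (\<lambda>x. g p x $ i $ j)) \<and>
     (\<forall>p\<in>A. \<forall>x\<in>chart_image p.
        transpose (g p x) = g p x \<and> (\<forall>v. v \<noteq> 0 \<longrightarrow> v \<bullet> (g p x *v v) > 0)) \<and>
     (\<forall>p\<in>A. \<forall>q\<in>A. \<forall>x\<in>overlap p q. \<forall>u v.
        u \<bullet> (g p x *v v) =
        frechet_derivative (transition p q) (at x) u \<bullet>
          (g q (transition p q x) *v frechet_derivative (transition p q) (at x) v))"


section \<open>Conic Finsler metrics in local coordinates\<close>

text \<open>In the coordinates of one chart a conic Finsler metric is a function \<open>F x y\<close> together with
  its conic domain \<open>D\<close>, an open set of pairs \<open>(x, y)\<close>; the values of \<open>F\<close> off \<open>D\<close> are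
  irrelevant.\<close>

definition pd_x :: "'n::finite \<Rightarrow> (real ^ 'n \<Rightarrow> real ^ 'n \<Rightarrow> real) \<Rightarrow> real ^ 'n \<Rightarrow> real ^ 'n \<Rightarrow> real" where
  "pd_x k H x y = partial k (\<lambda>z. H z y) x"

definition pd_y :: "'n::finite \<Rightarrow> (real ^ 'n \<Rightarrow> real ^ 'n \<Rightarrow> real) \<Rightarrow> real ^ 'n \<Rightarrow> real ^ 'n \<Rightarrow> real" where
  "pd_y k H x y = partial k (H x) y"

definition fundamental_tensor ::
  "(real ^ 'n \<Rightarrow> real ^ 'n \<Rightarrow> real) \<Rightarrow> real ^ 'n \<Rightarrow> real ^ 'n \<Rightarrow> real ^ 'n ^ 'n::finite" where
  "fundamental_tensor F x y = (\<chi> i j. 1/2 * pd_y j (pd_y i (\<lambda>x y. (F x y)\<^sup>2)) x y)"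

definition spray_coeff ::
  "(real ^ 'n \<Rightarrow> real ^ 'n \<Rightarrow> real) \<Rightarrow> 'n::finite \<Rightarrow> real ^ 'n \<Rightarrow> real ^ 'n \<Rightarrow> real" where
  "spray_coeff F i x y =
     1/4 * (\<Sum>l\<in>UNIV. matrix_inv (fundamental_tensor F x y) $ i $ l *
       ((\<Sum>k\<in>UNIV. pd_y l (pd_x k (\<lambda>x y. (F x y)\<^sup>2)) x y * y $ k)
        - pd_x l (\<lambda>x y. (F x y)\<^sup>2) x y))"

definition riemann_curvature ::
  "(real ^ 'n \<Rightarrow> real ^ 'n \<Rightarrow> real) \<Rightarrow> 'n::finite \<Rightarrow> 'n \<Rightarrow> real ^ 'n \<Rightarrow> real ^ 'n \<Rightarrow> real" where
  "riemann_curvature F i k x y =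
     2 * pd_x k (spray_coeff F i) x y
     - (\<Sum>m\<in>UNIV. pd_y k (pd_x m (spray_coeff F i)) x y * y $ m)
     + 2 * (\<Sum>m\<in>UNIV. spray_coeff F m x y * pd_y k (pd_y m (spray_coeff F i)) x y)
     - (\<Sum>m\<in>UNIV. pd_y m (spray_coeff F i) x y * pd_y k (spray_coeff F m) x y)"

definition ricci_curvature ::
  "(real ^ 'n::finite \<Rightarrow> real ^ 'n \<Rightarrow> real) \<Rightarrow> real ^ 'n \<Rightarrow> real ^ 'n \<Rightarrow> real" where
  "ricci_curvature F x y = (\<Sum>m\<in>UNIV. riemann_curvature F m m x y)"

definition velocity :: "(real \<Rightarrow> real ^ 'n::finite) \<Rightarrow> real \<Rightarrow> real ^ 'n" where
  "velocity c t = vector_derivative c (at t)"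

definition geodesic_on ::
  "((real ^ 'n) \<times> (real ^ 'n)) set \<Rightarrow> (real ^ 'n \<Rightarrow> real ^ 'n \<Rightarrow> real) \<Rightarrow> real set \<Rightarrow>
   (real \<Rightarrow> real ^ 'n::finite) \<Rightarrow> bool" where
  "geodesic_on D F I c \<longleftrightarrow>
     (\<forall>t\<in>I. (c t, velocity c t) \<in> D \<and>
        (c has_vector_derivative velocity c t) (at t) \<and>
        (velocity c has_vector_derivative
           (\<chi> i. - 2 * spray_coeff F i (c t) (velocity c t))) (at t))"

text \<open>The geodesic with initial data \<open>(x, y)\<close>, near time \<open>0\<close>. Two such curves agree near \<open>0\<close>,
  so the choice does not affect derivatives at \<open>0\<close>.\<close>

definition geodesic_from ::
  "((real ^ 'n) \<times> (real ^ 'n)) set \<Rightarrow> (real ^ 'n \<Rightarrow> real ^ 'n \<Rightarrow> real) \<Rightarrow>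
   real ^ 'n \<Rightarrow> real ^ 'n \<Rightarrow> real \<Rightarrow> real ^ 'n::finite" where
  "geodesic_from D F x y =
     (SOME c. c 0 = x \<and> velocity c 0 = y \<and> (\<exists>\<epsilon>>0. geodesic_on D F {-\<epsilon><..<\<epsilon>} c))"

text \<open>\<open>\<rho>\<close> is the density of a volume form in the coordinates of the chart.\<close>

definition distortion ::
  "(real ^ 'n \<Rightarrow> real ^ 'n \<Rightarrow> real) \<Rightarrow> (real ^ 'n \<Rightarrow> real) \<Rightarrow> real ^ 'n \<Rightarrow> real ^ 'n::finite \<Rightarrow> real" where
  "distortion F \<rho> x y = ln (sqrt (det (fundamental_tensor F x y)) / \<rho> x)"

definition S_curvature ::
  "((real ^ 'n) \<times> (real ^ 'n)) set \<Rightarrow> (real ^ 'n \<Rightarrow> real ^ 'n \<Rightarrow> real) \<Rightarrow> (real ^ 'n \<Rightarrow> real) \<Rightarrow>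
   real ^ 'n \<Rightarrow> real ^ 'n::finite \<Rightarrow> real" where
  "S_curvature D F \<rho> x y =
     (let c = geodesic_from D F x y in deriv (\<lambda>t. distortion F \<rho> (c t) (velocity c t)) 0)"

definition S_dot ::
  "((real ^ 'n) \<times> (real ^ 'n)) set \<Rightarrow> (real ^ 'n \<Rightarrow> real ^ 'n \<Rightarrow> real) \<Rightarrow> (real ^ 'n \<Rightarrow> real) \<Rightarrow>
   real ^ 'n \<Rightarrow> real ^ 'n::finite \<Rightarrow> real" where
  "S_dot D F \<rho> x y =
     (let c = geodesic_from D F x y in deriv (\<lambda>t. S_curvature D F \<rho> (c t) (velocity c t)) 0)"

definition weighted_ricci ::
  "real \<Rightarrow> real \<Rightarrow> ((real ^ 'n) \<times> (real ^ 'n)) set \<Rightarrow> (real ^ 'n \<Rightarrow> real ^ 'n \<Rightarrow> real) \<Rightarrow>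
   (real ^ 'n \<Rightarrow> real) \<Rightarrow> real ^ 'n \<Rightarrow> real ^ 'n::finite \<Rightarrow> real" where
  "weighted_ricci a c D F \<rho> x y =
     ricci_curvature F x y + a * S_dot D F \<rho> x y - c * (S_curvature D F \<rho> x y)\<^sup>2"

definition bh_density ::
  "((real ^ 'n) \<times> (real ^ 'n)) set \<Rightarrow> (real ^ 'n \<Rightarrow> real ^ 'n \<Rightarrow> real) \<Rightarrow> real ^ 'n::finite \<Rightarrow> real" where
  "bh_density D F x =
     measure lborel (ball (0 :: real ^ 'n) 1) / measure lborel {y. (x, y) \<in> D \<and> F x y < 1}"


section \<open>Kropina metrics\<close>

definition alpha :: "real ^ 'n ^ 'n \<Rightarrow> real ^ 'n::finite \<Rightarrow> real" where
  "alpha g y = sqrt (\<Sum>i\<in>UNIV. \<Sum>j\<in>UNIV. g $ i $ j * y $ i * y $ j)"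

definition beta :: "real ^ 'n \<Rightarrow> real ^ 'n::finite \<Rightarrow> real" where
  "beta b y = (\<Sum>i\<in>UNIV. b $ i * y $ i)"

definition kropina ::
  "(('m, 'n) chart \<Rightarrow> real ^ 'n \<Rightarrow> real ^ 'n ^ 'n) \<Rightarrow> (('m, 'n) chart \<Rightarrow> real ^ 'n \<Rightarrow> real ^ 'n) \<Rightarrow>
   ('m, 'n) chart \<Rightarrow> real ^ 'n \<Rightarrow> real ^ 'n::finite \<Rightarrow> real" where
  "kropina g b p x y = (alpha (g p x) y)\<^sup>2 / beta (b p x) y"

definition kropina_domain ::
  "(('m, 'n) chart \<Rightarrow> real ^ 'n \<Rightarrow> real ^ 'n) \<Rightarrow> ('m, 'n) chart \<Rightarrow>
   ((real ^ 'n) \<times> (real ^ 'n::finite)) set" where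
  "kropina_domain b p = {(x, y). x \<in> chart_image p \<and> beta (b p x) y > 0}"


section \<open>Curvature conditions on a manifold\<close>

text \<open>Here \<open>D p\<close>, \<open>F p\<close> and \<open>\<rho> p\<close> are the conic domain, the metric and the density of the
  volume form in the coordinates of the chart \<open>p\<close>.\<close>

definition weakly_weighted_einstein ::
  "('m, 'n::finite) chart set \<Rightarrow> (('m, 'n) chart \<Rightarrow> ((real ^ 'n) \<times> (real ^ 'n)) set) \<Rightarrow>
   (('m, 'n) chart \<Rightarrow> real ^ 'n \<Rightarrow> real ^ 'n \<Rightarrow> real) \<Rightarrow>
   (('m, 'n) chart \<Rightarrow> real ^ 'n \<Rightarrow> real) \<Rightarrow> real \<Rightarrow> real \<Rightarrow> bool" where
  "weakly_weighted_einstein A D F \<rho> a c \<longleftrightarrow>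
     (\<exists>\<sigma> \<theta>. smooth_function A \<sigma> \<and> one_form A \<theta> \<and>
       (\<forall>p\<in>A. \<forall>(x, y)\<in>D p.
          weighted_ricci a c (D p) (F p) (\<rho> p) x y =
          (real CARD('n) - 1) *
            (3 * (\<Sum>i\<in>UNIV. \<theta> p x $ i * y $ i) / F p x y + \<sigma> (chart_point p x)) * (F p x y)\<^sup>2))"

definition isotropic_S_curvature ::
  "('m, 'n::finite) chart set \<Rightarrow> (('m, 'n) chart \<Rightarrow> ((real ^ 'n) \<times> (real ^ 'n)) set) \<Rightarrow>
   (('m, 'n) chart \<Rightarrow> real ^ 'n \<Rightarrow> real ^ 'n \<Rightarrow> real) \<Rightarrow>
   (('m, 'n) chart \<Rightarrow> real ^ 'n \<Rightarrow> real) \<Rightarrow> bool" where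
  "isotropic_S_curvature A D F \<rho> \<longleftrightarrow>
     (\<exists>k. smooth_function A k \<and>
       (\<forall>p\<in>A. \<forall>(x, y)\<in>D p.
          S_curvature (D p) (F p) (\<rho> p) x y =
          (real CARD('n) + 1) * k (chart_point p x) * F p x y))"

end

theory Submission
  imports Defs "HOL-Computational_Algebra.Polynomial"
begin

text \<open>In each chart the metric is put into navigation form. Where the 1-form \<open>\<beta>\<close> is not zero, rescaling
\<open>\<alpha>\<close> gives \<open>F = A / (2 B)\<close> with \<open>A = h(y, y)\<close> for a Riemannian metric \<open>h\<close>, and \<open>B = h(W, y)\<close> for a
vector field \<open>W\<close> of unit length. The unit balls of \<open>F\<close> are then translates of those of \<open>h\<close>, so the
Busemann-Hausdorff density is that of \<open>h\<close>, and the determinant of the fundamental tensor is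
\<open>(F / B)\<^sup>n\<^sup>+\<^sup>1 det h\<close>. Up to the factor \<open>(n + 1) / 2\<close>, the distortion is \<open>ln (F / B)\<close>.

The geodesic spray of \<open>F\<close> differs from a spray without poles along the null cone \<open>A = 0\<close> (in the
complexified fibres) by a multiple \<open>\<kappa> = 2 r B / A + z\<close> of the position vector, where \<open>r\<close> is the
quadratic form of the symmetrized covariant derivative of \<open>W\<close> and \<open>z\<close> is linear. Along
geodesics \<open>A\<close> and \<open>B\<close> both have the logarithmic derivative \<open>\<kappa>\<close>. Hence the S-curvature for
the Busemann-Hausdorff volume is \<open>- (n + 1) \<kappa> / 2\<close>, and the weight \<open>f\<close> adds \<open>(n + 1) df\<close>. The
projective change formula (\<open>spray_ricci_projective_change\<close>) gives the Ricci curvature in terms of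
\<open>\<kappa>\<close> and its derivative, and the weighted Ricci curvature has the form
\<open>\<nu> / 4 (r / F)\<^sup>2 + s1 / F + s0\<close> with \<open>s0\<close> and \<open>s1\<close> pole-free (\<open>weighted_ricci_pole\<close>).

The right-hand side \<open>3 (n - 1) \<theta> F + (n - 1) \<sigma> F\<^sup>2\<close> of the Einstein condition has no pole, so
\<open>A\<close> divides \<open>\<nu> r\<^sup>2\<close> and \<open>r\<close> vanishes on the null cone when \<open>\<nu>\<close> is not zero. So \<open>r\<close> is a multiple of
\<open>A\<close>. The multiple is \<open>r(W, W) = 0\<close>, because \<open>W\<close> has constant length: \<open>W\<close> is a Killing field. For the
same reason \<open>z(y) = - 2 r(W, y) = 0\<close>. Therefore \<open>\<kappa> = 0\<close> (\<open>weakly_einstein_imp_\<kappa>_zero\<close>), and the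
S-curvature for the Busemann-Hausdorff volume is not only isotropic but zero.\<close>

section \<open>Linear algebra and the volume of an ellipsoid\<close>

text \<open>A linear map scales volumes by its determinant. The index type need not carry an order: the proof is
by induction over elementary linear maps, and the determinant of a shear comes from a row operation.\<close>

lemma measure_linear_image_finite:
  fixes f :: "real^'n::finite \<Rightarrow> real^'n"
  assumes "linear f" "S \<in> lmeasurable"
  shows "f ` S \<in> lmeasurable \<and> measure lebesgue (f ` S) = \<bar>det (matrix f)\<bar> * measure lebesgue S"
proof -
  let ?P = "\<lambda>f. \<forall>S\<in>lmeasurable. f ` S \<in> lmeasurable \<and>
      measure lebesgue (f ` S) = \<bar>det (matrix f)\<bar> * measure lebesgue (S :: (real^'n) set)"
  have box: "?P f" if "linear f" "\<bar>det (matrix f)\<bar> = 1"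
      "\<And>a b. measure lebesgue (f ` cbox a b) = measure lebesgue (cbox a b)" for f :: "real^'n \<Rightarrow> real^'n"
  proof
    fix S :: "(real^'n) set" assume S: "S \<in> lmeasurable"
    show "f ` S \<in> lmeasurable \<and> measure lebesgue (f ` S) = \<bar>det (matrix f)\<bar> * measure lebesgue S"
      using measure_linear_sufficient[OF that(1) S, of 1] that(2,3) by simp
  qed
  have "?P f"
  proof (rule induct_linear_elementary[where P="?P", OF \<open>linear f\<close>])
    fix f g :: "real^'n \<Rightarrow> real^'n"
    assume *: "linear f" "linear g" "?P f" "?P g"
    show "?P (f \<circ> g)"
    proof
      fix S :: "(real^'n) set" assume S: "S \<in> lmeasurable"
      have "(f \<circ> g) ` S = f ` g ` S" by (rule image_comp[symmetric])
      thus "(f \<circ> g) ` S \<in> lmeasurable \<and>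
          measure lebesgue ((f \<circ> g) ` S) = \<bar>det (matrix (f \<circ> g))\<bar> * measure lebesgue S"
        using *(3,4) S by (simp only: matrix_compose[OF *(2,1)] det_mul abs_mult) simp
    qed
  next
    fix f :: "real^'n \<Rightarrow> real^'n" and i
    assume f: "linear f" "\<And>x. f x $ i = 0"
    have "\<not> surj f"
      using f(2) by (metis surjD vec_component one_neq_zero)
    hence ni: "\<not> inj f" using linear_injective_imp_surjective[OF f(1)] by auto
    hence "det (matrix f) = 0" using det_nz_iff_inj[OF f(1)] by blast
    moreover have "negligible (f ` S)" for S
      using negligible_linear_singular_image[OF f(1) ni] by blast
    ultimately show "?P f"
      by (auto simp: negligible_iff_measure negligible_imp_measurable)
  next
    fix c :: "'n \<Rightarrow> real"
    have "matrix (\<lambda>x::real^'n. \<chi> i. c i * x $ i) = (\<chi> i j. if i = j then c i else 0)"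
      by (auto simp: matrix_def axis_def vec_eq_iff)
    hence "det (matrix (\<lambda>x::real^'n. \<chi> i. c i * x $ i)) = prod c UNIV"
      by (simp add: det_diagonal)
    thus "?P (\<lambda>x. \<chi> i. c i * x $ i)"
      by (simp add: measurable_stretch measure_stretch)
  next
    fix m n :: 'n assume "m \<noteq> n"
    let ?t = "Transposition.transpose m n"
    let ?h = "\<lambda>x::real^'n. \<chi> i. x $ ?t i"
    have lin: "linear ?h" by (rule linearI) (simp_all add: vec_eq_iff)
    have "matrix ?h = (\<chi> i. mat 1 $ ?t i)"
      by (auto simp: matrix_def mat_def axis_def vec_eq_iff)
    hence "\<bar>det (matrix ?h)\<bar> = 1"
      by (simp add: det_permute_rows[OF permutes_swap_id] sign_swap_id abs_mult)
    moreover have "measure lebesgue (?h ` cbox a b) = measure lebesgue (cbox a b)" for a b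
    proof -
      define h where "h = ?h"
      have hh: "h (h x) = x" for x by (simp add: h_def vec_eq_iff)
      have "x \<in> h ` cbox a b \<longleftrightarrow> h x \<in> cbox a b" for x
      proof
        assume "x \<in> h ` cbox a b" thus "h x \<in> cbox a b" using hh by auto
      next
        assume "h x \<in> cbox a b"
        hence "h (h x) \<in> h ` cbox a b" by (rule imageI)
        thus "x \<in> h ` cbox a b" unfolding hh .
      qed
      moreover have "h x \<in> cbox a b \<longleftrightarrow> x \<in> cbox (h a) (h b)" for x
      proof -
        have "(\<forall>i. Q (?t i)) \<longleftrightarrow> (\<forall>i. Q i)" for Q :: "'n \<Rightarrow> bool" by (metis transpose_involutory)
        from this[of "\<lambda>i. a $ i \<le> h x $ i \<and> h x $ i \<le> b $ i"]
        show ?thesis by (simp add: mem_box_cart h_def)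
      qed
      ultimately have im: "h ` cbox a b = cbox (h a) (h b)" by blast
      have "(\<Prod>i\<in>UNIV. (h b - h a) $ i) = (\<Prod>i\<in>UNIV. (b - a) $ i)"
        unfolding h_def using prod.permute[OF permutes_swap_id, of m UNIV n "\<lambda>i. (b - a) $ i"] by (simp add: o_def)
      moreover have "cbox (h a) (h b) = {} \<longleftrightarrow> cbox a b = {}" using im by (metis image_is_empty)
      ultimately show ?thesis unfolding h_def[symmetric] im by (simp add: content_cbox_if_cart)
    qed
    ultimately show "?P ?h" by (intro box lin)
  next
    fix m n :: 'n assume mn: "m \<noteq> n"
    let ?h = "\<lambda>x::real^'n. \<chi> i. if i = m then x $ m + x $ n else x $ i"
    have lin: "linear ?h" by (rule linearI) (auto simp: vec_eq_iff algebra_simps)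
    have "matrix ?h = (\<chi> k. if k = m then row m (mat 1) + 1 *s row n (mat 1) else row k (mat 1))"
      by (auto simp: matrix_def mat_def row_def axis_def vec_eq_iff)
    hence "\<bar>det (matrix ?h)\<bar> = 1" using det_row_operation[OF mn, of "mat 1 :: real^'n^'n" 1] by simp
    moreover have "measure lebesgue (?h ` cbox a b) = measure lebesgue (cbox a b)" for a b
    proof (cases "cbox a b = {}")
      case False
      \<comment> \<open>translating the box makes its \<open>n\<close>-th coordinates nonnegative\<close>
      define u where "u = - (a $ n) *\<^sub>R axis n (1::real)"
      have "measure lebesgue (?h ` cbox a b) = measure lebesgue ((+) (?h u) ` ?h ` cbox a b)"
        by (simp add: measure_translation)
      also have "(+) (?h u) ` ?h ` cbox a b = ?h ` cbox (u + a) (u + b)"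
        unfolding cbox_translation image_image by (intro image_cong refl) (simp add: vec_eq_iff)
      also have "measure lebesgue \<dots> = measure lebesgue (cbox (u + a) (u + b))"
      proof (rule measure_shear_interval[OF mn])
        show "cbox (u + a) (u + b) \<noteq> {}" using False by (simp add: cbox_translation)
      qed (simp add: u_def)
      also have "\<dots> = measure lebesgue (cbox a b)"
        unfolding cbox_translation by (rule measure_translation)
      finally show ?thesis .
    qed simp
    ultimately show "?P ?h" by (intro box lin)
  qed
  thus ?thesis using assms(2) by (rule bspec)
qed

text \<open>The bilinear form of a matrix.\<close>

definition form :: "real^'n^'n \<Rightarrow> real^'n \<Rightarrow> real^'n \<Rightarrow> real" where
  "form h u v = u \<bullet> (h *v v)"

lemma det_id_minus_rank_one:
  fixes a b :: "real^'n::finite"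
  shows "det (\<chi> i j. (if i = j then 1 else 0) - a $ i * b $ j) = 1 - a \<bullet> b"
proof -
  define N :: "real^'n \<Rightarrow> real^'n \<Rightarrow> real^'n^'n" where "N a b = (\<chi> i j. (if i = j then 1 else 0) - a $ i * b $ j)" for a b
  have Nv: "N a b *v x = x - (b \<bullet> x) *\<^sub>R a" for a b x
    by (simp add: N_def vec_eq_iff matrix_vector_mult_def inner_vec_def left_diff_distrib sum_subtractf
       if_distrib[where f="\<lambda>z. z * _"] mult.assoc flip: sum_distrib_left cong: if_cong)
  \<comment> \<open>rotate \<open>a\<close> onto a coordinate axis, where the matrix differs from the unit matrix in one row\<close>
  obtain k :: 'n where True by blast
  have "norm (norm a *\<^sub>R axis k (1::real)) = norm a" by simp
  then obtain f :: "real^'n \<Rightarrow> real^'n" where f: "orthogonal_transformation f" "f (norm a *\<^sub>R axis k 1) = a"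
    by (rule orthogonal_transformation_exists)
  define Q where "Q = matrix f"
  have Q: "orthogonal_matrix Q" using f by (simp add: Q_def orthogonal_transformation_matrix)
  have Qf: "Q *v x = f x" for x
    using f by (simp add: Q_def orthogonal_transformation_linear)
  define c where "c = transpose Q *v b"
  have TQ: "transpose Q ** Q = mat 1" using Q by (simp add: orthogonal_matrix)
  have ta: "transpose Q *v a = norm a *\<^sub>R axis k 1"
    using f(2) TQ unfolding Qf[symmetric] by (metis matrix_vector_mul_assoc matrix_vector_mul_lid)
  have ta': "a v* Q = norm a *\<^sub>R axis k 1" using ta by simp
  have QT: "Q ** transpose Q = mat 1" using Q by (simp add: orthogonal_matrix_def)
  have eq: "transpose Q ** N a b ** Q = N (norm a *\<^sub>R axis k 1) c"
  proof (rule matrix_eq[THEN iffD2], rule)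
    fix x
    have "(transpose Q ** N a b ** Q) *v x = transpose Q *v (Q *v x - (b \<bullet> (Q *v x)) *\<^sub>R a)"
      by (simp add: matrix_vector_mul_assoc[symmetric] Nv)
    also have "\<dots> = x - (b \<bullet> (Q *v x)) *\<^sub>R (norm a *\<^sub>R axis k 1)"
      using TQ by (simp add: matrix_vector_mult_diff_distrib matrix_vector_mul_assoc matrix_vector_mult_scaleR ta')
    also have "b \<bullet> (Q *v x) = c \<bullet> x" by (simp add: c_def dot_lmul_matrix)
    finally show "(transpose Q ** N a b ** Q) *v x = N (norm a *\<^sub>R axis k 1) c *v x" by (simp add: Nv)
  qed
  have "det (N (norm a *\<^sub>R axis k 1) c) = det (transpose Q) * det (N a b) * det Q"
    unfolding eq[symmetric] by (simp add: det_mul)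
  also have "\<dots> = det (N a b)" using det_orthogonal_matrix[OF Q] by (auto simp: det_transpose)
  finally have 1: "det (N a b) = det (N (norm a *\<^sub>R axis k 1) c)" ..
  define x where "x = axis k 1 - norm a *\<^sub>R c"
  have srow: "(\<Sum>i\<in>UNIV. x $ i *s row i (mat 1)) = x"
    by (simp add: vec_eq_iff row_def mat_def if_distrib cong: if_cong)
  have "N (norm a *\<^sub>R axis k 1) c =
     (\<chi> i. if i = k then (\<Sum>i\<in>UNIV. x $ i *s row i (mat 1)) else row i (mat 1))"
    unfolding srow by (auto simp: N_def x_def vec_eq_iff row_def mat_def axis_def)
  hence "det (N (norm a *\<^sub>R axis k 1) c) = x $ k" by (simp only: cramer_lemma_transpose) simp
  also have "\<dots> = 1 - (transpose Q *v a) \<bullet> c"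
    by (simp add: x_def ta' inner_axis')
  also have "(transpose Q *v a) \<bullet> c = a \<bullet> b"
  proof -
    have Qa: "Q *v (x v* Q) = x" for x
      by (metis QT matrix_vector_mul_assoc matrix_vector_mul_lid transpose_matrix_vector)
    have "(a v* Q) \<bullet> (b v* Q) = a \<bullet> b" by (simp add: dot_lmul_matrix Qa)
    thus ?thesis by (simp add: c_def)
  qed
  finally show ?thesis using 1 by (simp add: N_def)
qed

lemma form_simps:
  "form h (u + v) w = form h u w + form h v w" "form h w (u + v) = form h w u + form h w v"
  "form h (u - v) w = form h u w - form h v w" "form h w (u - v) = form h w u - form h w v"
  "form h (c *\<^sub>R u) w = c * form h u w" "form h w (c *\<^sub>R u) = c * form h w u"
  "form h 0 w = 0" "form h w 0 = 0"
  by (simp_all add: form_def inner_left_distrib inner_right_distrib inner_diff_left inner_diff_right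
      matrix_vector_right_distrib matrix_vector_mult_diff_distrib matrix_vector_mult_scaleR)

lemma form_sum_right: "form h w (sum f I) = (\<Sum>i\<in>I. form h w (f i))"
  by (simp add: form_def linear_sum[OF matrix_vector_mul_linear] inner_sum_right)

lemma form_commute: "transpose h = h \<Longrightarrow> form h u v = form h v u"
  unfolding form_def by (metis dot_lmul_matrix inner_commute transpose_matrix_vector)

lemma matrix_eq_form: "(\<And>u v. form G u v = form H u v) \<Longrightarrow> G = H"
  unfolding form_def matrix_eq by (metis vector_eq_ldot)

lemma form_congruence: "form (transpose T ** h ** T) u v = form h (T *v u) (T *v v)"
proof -
  have "u v* transpose T = T *v u" by (metis transpose_matrix_vector transpose_transpose)
  thus ?thesis
    by (simp add: form_def matrix_vector_mul_assoc[symmetric] dot_lmul_matrix[symmetric] del: transpose_matrix_vector)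
qed

lemma det_congruence:
  fixes G h T :: "real^'n^'n::finite"
  assumes "\<And>u v. form G u v = c * form h (T *v u) (T *v v)"
  shows "det G = c ^ CARD('n) * (det T)\<^sup>2 * det h"
proof -
  have cc: "matrix ((*\<^sub>R) c) *v x = c *\<^sub>R x" for x :: "real^'n"
    by (simp add: matrix_works)
  have "G = matrix ((*\<^sub>R) c) ** (transpose T ** h ** T)"
    by (rule matrix_eq_form)
       (metis assms form_congruence form_def inner_scaleR_right matrix_vector_mul_assoc cc)
  thus ?thesis by (simp add: det_mul power2_eq_square)
qed

text \<open>Gram-Schmidt for the inner product given by a positive definite matrix.\<close>

lemma exists_orthonormal_family:
  fixes h :: "real^'n^'n::finite" and I :: "'n set"
  assumes sym: "transpose h = h" and pos: "\<And>v. v \<noteq> 0 \<Longrightarrow> form h v v > 0"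
  shows "\<exists>v. \<forall>i\<in>I. \<forall>j\<in>I. form h (v i) (v j) = (if i = j then 1 else 0)"
proof (induction I rule: finite_induct[OF finite])
  case (2 k I)
  then obtain v where v: "\<And>i j. i \<in> I \<Longrightarrow> j \<in> I \<Longrightarrow> form h (v i) (v j) = (if i = j then 1 else 0)" by blast
  have "card (v ` I) \<le> card I" using 2 by (simp add: card_image_le)
  also have "card I < CARD('n)" using 2(2) by (intro psubset_card_mono) auto
  finally have "dim (v ` I) < DIM(real^'n)" using dim_le_card'[of "v ` I"] 2(1) by simp
  hence "span (v ` I) \<noteq> UNIV" by (metis dim_span dim_UNIV less_irrefl)
  then obtain z where z: "z \<notin> span (v ` I)" by blast
  \<comment> \<open>the component of \<open>z\<close> orthogonal to the family constructed so far\<close>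
  define w where "w = z - (\<Sum>i\<in>I. form h (v i) z *\<^sub>R v i)"
  have "(\<Sum>i\<in>I. form h (v i) z *\<^sub>R v i) \<in> span (v ` I)"
    by (intro span_sum span_scale span_base) auto
  hence "w \<noteq> 0" using z by (auto simp: w_def)
  hence wp: "form h w w > 0" using pos by blast
  have vw: "form h (v i) w = 0" if "i \<in> I" for i
  proof -
    have "(\<Sum>j\<in>I. form h (v j) z * form h (v i) (v j)) = (\<Sum>j\<in>I. if i = j then form h (v j) z else 0)"
      by (intro sum.cong refl) (simp add: v that)
    thus ?thesis using that 2(1) by (simp add: w_def form_simps form_sum_right)
  qed
  define v' where "v' = v(k := (1 / sqrt (form h w w)) *\<^sub>R w)"
  have "form h (v' k) (v' k) = 1"
  proof -
    define r where "r = sqrt (form h w w)"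
    have r: "form h w w = r * r" "r \<noteq> 0" using wp by (simp_all add: r_def)
    have "v' k = (1 / r) *\<^sub>R w" by (simp add: v'_def r_def)
    thus ?thesis using r by (simp only: form_simps) simp
  qed
  moreover have "form h (v' i) (v' k) = 0" "form h (v' k) (v' i) = 0" "v' i = v i" if "i \<in> I" for i
    using that 2(2) vw[OF that] form_commute[OF sym, of w "v i"] by (auto simp: v'_def form_simps)
  ultimately have "\<forall>i\<in>insert k I. \<forall>j\<in>insert k I. form h (v' i) (v' j) = (if i = j then 1 else 0)"
    using v 2(2) by (metis insertE)
  thus ?case by blast
qed auto

lemma exists_orthonormal_frame:
  fixes h :: "real^'n^'n::finite"
  assumes sym: "transpose h = h" and pos: "\<And>v. v \<noteq> 0 \<Longrightarrow> form h v v > 0"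
  obtains N where "(det N)\<^sup>2 * det h = 1" "\<And>u v. form h (N *v u) (N *v v) = u \<bullet> v"
proof -
  obtain b :: "'n \<Rightarrow> real^'n" where b: "\<And>i j. form h (b i) (b j) = (if i = j then 1 else 0)"
    using exists_orthonormal_family[OF sym pos, of UNIV] by auto
  \<comment> \<open>the matrix whose columns are an orthonormal frame\<close>
  define N where "N = (\<chi> i j. b j $ i)"
  have Nu: "N *v u = (\<Sum>j\<in>UNIV. u $ j *\<^sub>R b j)" for u
    by (simp add: N_def vec_eq_iff matrix_vector_mult_def mult.commute)
  have f: "form h (N *v u) (N *v v) = u \<bullet> v" for u v
  proof -
    have "form h (N *v u) (N *v v) = (\<Sum>j\<in>UNIV. v $ j * form h (b j) (N *v u))"
      unfolding Nu[of v] form_sum_right form_simps form_commute[OF sym, of "N *v u"] ..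
    also have "\<dots> = (\<Sum>j\<in>UNIV. v $ j * (\<Sum>i\<in>UNIV. u $ i * (if j = i then 1 else 0)))"
      unfolding Nu[of u] form_sum_right form_simps b ..
    also have "\<dots> = u \<bullet> v"
      by (simp add: inner_vec_def if_distrib mult.commute cong: if_cong)
    finally show ?thesis .
  qed
  have "det (mat 1 :: real^'n^'n) = 1 ^ CARD('n) * (det N)\<^sup>2 * det h"
    by (rule det_congruence) (simp add: f, simp add: form_def)
  thus ?thesis using f that by simp
qed

lemma measure_ellipsoid:
  fixes h :: "real^'n^'n::finite"
  assumes sym: "transpose h = h" and pos: "\<And>v. v \<noteq> 0 \<Longrightarrow> form h v v > 0"
  shows "det h > 0"
    "measure lborel {y. form h (y - p) (y - p) < 1} = measure lborel (ball (0 :: real^'n) 1) / sqrt (det h)"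
proof -
  obtain N where N: "(det N)\<^sup>2 * det h = 1" "\<And>u v. form h (N *v u) (N *v v) = u \<bullet> v"
    using exists_orthonormal_frame[OF assms] by blast
  have dN: "det N \<noteq> 0" using N(1) by auto
  show dh: "det h > 0" using N(1) dN by (metis zero_less_mult_pos zero_less_one zero_less_power2)
  have "(\<bar>det N\<bar> * sqrt (det h))\<^sup>2 = 1" using N(1) dh by (simp add: power_mult_distrib)
  moreover have "\<bar>det N\<bar> * sqrt (det h) \<ge> 0" using dh by simp
  ultimately have "\<bar>det N\<bar> * sqrt (det h) = 1" unfolding power2_eq_1_iff by linarith
  hence dN2: "\<bar>det N\<bar> = 1 / sqrt (det h)" using dh by (simp add: eq_divide_eq)
  have "invertible N" using dN by (simp add: invertible_det_nz)
  then obtain N' where N': "N ** N' = mat 1" unfolding invertible_def by blast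
  have eq: "{y. form h (y - p) (y - p) < 1} = (+) p ` (*v) N ` ball 0 1"
  proof safe
    fix y assume y: "form h (y - p) (y - p) < 1"
    have *: "y - p = N *v (N' *v (y - p))" using N' by (simp add: matrix_vector_mul_assoc)
    hence "(N' *v (y - p)) \<bullet> (N' *v (y - p)) < 1" using y N(2) by metis
    hence "N' *v (y - p) \<in> ball 0 1" by (simp add: norm_eq_sqrt_inner)
    thus "y \<in> (+) p ` (*v) N ` ball 0 1"
      using * by (intro image_eqI[of _ _ "y - p"] image_eqI[of _ _ "N' *v (y - p)"]) auto
  next
    fix z :: "real^'n" assume "z \<in> ball 0 1"
    hence "z \<bullet> z < 1" by (simp add: norm_eq_sqrt_inner)
    thus "form h (p + N *v z - p) (p + N *v z - p) < 1" by (simp add: N(2))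
  qed
  have "open {y. form h (y - p) (y - p) < 1}"
    unfolding form_def by (intro open_Collect_less continuous_intros matrix_vector_mult_linear_continuous_on[THEN continuous_on_compose2])
      auto
  hence "measure lborel {y. form h (y - p) (y - p) < 1} = measure lebesgue {y. form h (y - p) (y - p) < 1}"
    by (simp add: measure_completion)
  also have "\<dots> = measure lebesgue ((*v) N ` ball 0 1)" unfolding eq by (rule measure_translation)
  also have "\<dots> = \<bar>det N\<bar> * measure lebesgue (ball (0::real^'n) 1)"
    using measure_linear_image_finite[of "(*v) N" "ball 0 1"] by simp
  finally show "measure lborel {y. form h (y - p) (y - p) < 1} = measure lborel (ball (0 :: real^'n) 1) / sqrt (det h)"
    by (simp add: dN2 measure_completion)
qed

section \<open>Local existence for ordinary differential equations\<close>

text \<open>The Picard--Lindeloef theorem for an autonomous equation, by the Banach fixed point theorem in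
the space of bounded continuous functions on the line.\<close>

lemma ode_local_existence:
  fixes V :: "'a::euclidean_space \<Rightarrow> 'a"
  assumes r: "r > 0" and L: "\<And>u v. u \<in> cball z r \<Longrightarrow> v \<in> cball z r \<Longrightarrow> dist (V u) (V v) \<le> L * dist u v"
  obtains \<epsilon> u where "\<epsilon> > 0" "u 0 = z"
    "\<And>t. t \<in> {-\<epsilon><..<\<epsilon>} \<Longrightarrow> u t \<in> cball z r \<and> (u has_vector_derivative V (u t)) (at t)"
proof -
  define K where "K = max L 1"
  have K: "K > 0" "\<And>u v. u \<in> cball z r \<Longrightarrow> v \<in> cball z r \<Longrightarrow> dist (V u) (V v) \<le> K * dist u v"
  proof -
    fix u v assume "u \<in> cball z r" "v \<in> cball z r"
    hence "dist (V u) (V v) \<le> L * dist u v" by (rule L)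
    also have "\<dots> \<le> K * dist u v" by (intro mult_right_mono) (auto simp: K_def)
    finally show "dist (V u) (V v) \<le> K * dist u v" .
  qed (simp add: K_def)
  \<comment> \<open>precomposing with the retraction onto the ball makes the vector field globally Lipschitz and bounded\<close>
  define W where "W x = V (closest_point (cball z r) x)" for x
  have ne: "cball z r \<noteq> {}" using r by auto
  have cp: "closest_point (cball z r) x \<in> cball z r" for x
    by (rule closest_point_in_set) (use ne in auto)
  have WL: "dist (W u) (W v) \<le> K * dist u v" for u v
  proof -
    have "dist (W u) (W v) \<le> K * dist (closest_point (cball z r) u) (closest_point (cball z r) v)"
      unfolding W_def by (intro K cp)
    also have "\<dots> \<le> K * dist u v"
      by (intro mult_left_mono closest_point_lipschitz) (use ne K in auto)
    finally show ?thesis .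
  qed
  have Wc: "continuous_on UNIV W"
    unfolding continuous_on_iff
  proof (intro ballI allI impI)
    fix x :: 'a and e :: real assume "e > 0"
    thus "\<exists>d>0. \<forall>x'\<in>UNIV. dist x' x < d \<longrightarrow> dist (W x') (W x) < e"
      using WL[of _ x] K(1) by (intro exI[of _ "e / K"]) (auto simp: field_simps intro: le_less_trans)
  qed
  define M where "M = norm (V z) + K * r"
  have WM: "norm (W x) \<le> M" for x
  proof -
    have "dist (W x) (V z) \<le> K * dist (closest_point (cball z r) x) z"
      unfolding W_def by (rule K) (use cp r in auto)
    also have "\<dots> \<le> K * r" using cp[of x] K(1) by (intro mult_left_mono) (auto simp: dist_commute)
    finally show ?thesis unfolding M_def dist_norm using norm_triangle_sub[of "W x" "V z"] by linarith
  qed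
  have M: "M > 0" unfolding M_def using K(1) r by (simp add: add_nonneg_pos)
  define \<epsilon> where "\<epsilon> = min (1 / (6 * K)) (r / (3 * M))"
  have e: "\<epsilon> > 0" "3 * \<epsilon> * K \<le> 1/2" "3 * \<epsilon> * M \<le> r"
    using K(1) M r by (auto simp: \<epsilon>_def min_def field_simps)
  \<comment> \<open>the integral of \<open>f\<close> from \<open>0\<close> to \<open>t\<close>, written so that it makes sense for \<open>t\<close> of either sign\<close>
  define J where "J f t = integral {-\<epsilon>..t} f - integral {-\<epsilon>..0} f" for f :: "real \<Rightarrow> 'a" and t
  have J_bound: "norm (J f t) \<le> 3 * \<epsilon> * B"
    if "continuous_on UNIV f" "\<And>s. norm (f s) \<le> B" "t \<in> {-\<epsilon>..\<epsilon>}" for f B t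
  proof -
    have 1: "norm (integral {-\<epsilon>..s} f) \<le> B * (s + \<epsilon>)" if "-\<epsilon> \<le> s" for s
      using integral_bound[of "-\<epsilon>" s f B] that continuous_on_subset[OF \<open>continuous_on UNIV f\<close>] \<open>\<And>s. norm (f s) \<le> B\<close>
      by auto
    have B: "B \<ge> 0" using that(2) norm_ge_zero order_trans by blast
    have "norm (J f t) \<le> B * (t + \<epsilon>) + B * (0 + \<epsilon>)"
      unfolding J_def using 1[of t] 1[of 0] that(3) e(1) by (intro order_trans[OF norm_triangle_ineq4] add_mono) auto
    also have "\<dots> = B * (t + 2 * \<epsilon>)" by (simp add: algebra_simps)
    also have "\<dots> \<le> B * (3 * \<epsilon>)" using B that(3) by (intro mult_left_mono) auto
    finally show ?thesis by (simp add: mult_ac)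
  qed
  have cu: "continuous_on UNIV (\<lambda>s. W (apply_bcontfun u s))" for u :: "real \<Rightarrow>\<^sub>C 'a"
    by (rule continuous_on_compose2[OF Wc]) auto
  have "\<exists>g :: real \<Rightarrow>\<^sub>C 'a. \<forall>t. apply_bcontfun g t = z + J (\<lambda>s. W (apply_bcontfun u s)) (clamp (-\<epsilon>) \<epsilon> t)" for u
  proof -
    have "continuous_on (cbox (-\<epsilon>) \<epsilon>) (\<lambda>t. z + J (\<lambda>s. W (apply_bcontfun u s)) t)"
      unfolding J_def cbox_interval
      by (intro continuous_intros indefinite_integral_continuous_1 integrable_continuous_interval
          continuous_on_subset[OF cu]) auto
    thus ?thesis by (rule continuous_on_cbox_bcontfunE) blast
  qed
  then obtain T :: "(real \<Rightarrow>\<^sub>C 'a) \<Rightarrow> (real \<Rightarrow>\<^sub>C 'a)" where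
    T: "\<And>u t. apply_bcontfun (T u) t = z + J (\<lambda>s. W (apply_bcontfun u s)) (clamp (-\<epsilon>) \<epsilon> t)"
    by metis
  have cl: "clamp (-\<epsilon>) \<epsilon> t \<in> {-\<epsilon>..\<epsilon>}" for t
    using clamp_in_interval[of "-\<epsilon>" \<epsilon> t] e(1) by simp
  have "dist (T u) (T v) \<le> 1/2 * dist u v" for u v
  proof (rule dist_bound)
    fix t
    let ?f = "\<lambda>u s. W (apply_bcontfun u s)"
    have int: "?f w integrable_on {-\<epsilon>..s}" for w s
      by (intro integrable_continuous_interval continuous_on_subset[OF cu]) auto
    have "dist (apply_bcontfun (T u) t) (apply_bcontfun (T v) t)
        = norm (J (\<lambda>s. ?f u s - ?f v s) (clamp (-\<epsilon>) \<epsilon> t))"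
      unfolding T dist_norm J_def by (simp add: integral_diff int algebra_simps)
    also have "\<dots> \<le> 3 * \<epsilon> * (K * dist u v)"
    proof (rule J_bound[OF _ _ cl])
      show "continuous_on UNIV (\<lambda>s. ?f u s - ?f v s)" by (intro continuous_intros cu)
      fix s
      have "norm (?f u s - ?f v s) \<le> K * dist (apply_bcontfun u s) (apply_bcontfun v s)"
        using WL[of "apply_bcontfun u s" "apply_bcontfun v s"] by (simp add: dist_norm)
      also have "\<dots> \<le> K * dist u v" by (intro mult_left_mono dist_bounded) (use K(1) in simp)
      finally show "norm (?f u s - ?f v s) \<le> K * dist u v" .
    qed
    also have "\<dots> = (3 * \<epsilon> * K) * dist u v" by simp
    also have "\<dots> \<le> 1/2 * dist u v" by (intro mult_right_mono e) auto
    finally show "dist (apply_bcontfun (T u) t) (apply_bcontfun (T v) t) \<le> 1/2 * dist u v" .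
  qed
  hence "\<exists>!u. T u = u" by (intro banach_fix_type[of "1/2"]) auto
  then obtain u where u: "T u = u" by blast
  let ?u = "apply_bcontfun u"
  have ueq: "?u t = z + J (\<lambda>s. W (?u s)) t" if "t \<in> {-\<epsilon>..\<epsilon>}" for t
    using T[of u t] u that by simp
  show thesis
  proof (rule that[OF e(1)])
    show "?u 0 = z" using ueq[of 0] e(1) by (simp add: J_def)
    fix t assume t: "t \<in> {-\<epsilon><..<\<epsilon>}"
    have "norm (J (\<lambda>s. W (?u s)) t) \<le> r"
      using J_bound[OF cu WM, of t u] t e(3) by force
    hence in_ball: "?u t \<in> cball z r" using ueq[of t] t by (simp add: dist_norm)
    have "((\<lambda>t. z + J (\<lambda>s. W (?u s)) t) has_vector_derivative 0 + (W (?u t) - 0)) (at t within {-\<epsilon>..\<epsilon>})"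
      unfolding J_def
      by (intro has_vector_derivative_add has_vector_derivative_diff has_vector_derivative_const
          integral_has_vector_derivative continuous_on_subset[OF cu]) (use t in auto)
    hence "((\<lambda>t. z + J (\<lambda>s. W (?u s)) t) has_vector_derivative W (?u t)) (at t)"
      using t by (simp add: at_within_Icc_at)
    hence "(?u has_vector_derivative W (?u t)) (at t)"
      by (rule has_vector_derivative_transform_within_open[where S="{-\<epsilon><..<\<epsilon>}"]) (use t ueq in auto)
    moreover have "W (?u t) = V (?u t)" using in_ball by (simp add: W_def closest_point_self)
    ultimately show "?u t \<in> cball z r \<and> (?u has_vector_derivative V (?u t)) (at t)"
      using in_ball by simp
  qed
qed

section \<open>Directional derivatives and fibrewise rational functions\<close>

text \<open>Functions on the tangent bundle of a chart are curried functions of a point \<open>x\<close> and a fibre vector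
\<open>y\<close>. They are differentiated jointly in both: \<open>dd (u, v) X x y\<close> is the derivative of \<open>X\<close> at
\<open>(x, y)\<close> in the direction that moves \<open>x\<close> by \<open>u\<close> and \<open>y\<close> by \<open>v\<close>.\<close>

definition diff_at :: "(real^'n::finite \<Rightarrow> real^'n \<Rightarrow> 'b::real_normed_vector) \<Rightarrow> real^'n \<Rightarrow> real^'n \<Rightarrow> bool" where
  "diff_at X x y \<longleftrightarrow> (\<lambda>z. X (fst z) (snd z)) differentiable (at (x, y))"

definition dd :: "(real^'n) \<times> (real^'n) \<Rightarrow> (real^'n::finite \<Rightarrow> real^'n \<Rightarrow> 'b::real_normed_vector) \<Rightarrow> real^'n \<Rightarrow> real^'n \<Rightarrow> 'b" where
  "dd e X x y = frechet_derivative (\<lambda>z. X (fst z) (snd z)) (at (x, y)) e"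

lemma diff_atD: "diff_at X x y \<Longrightarrow> ((\<lambda>z. X (fst z) (snd z)) has_derivative (\<lambda>e. dd e X x y)) (at (x, y))"
  unfolding diff_at_def dd_def frechet_derivative_works .

lemma diff_atI:
  assumes "((\<lambda>z. X (fst z) (snd z)) has_derivative X') (at (x, y))"
  shows "diff_at X x y" "dd e X x y = X' e"
  using assms frechet_derivative_at[OF assms] by (auto simp: diff_at_def dd_def differentiable_def)

lemma dd_linear:
  assumes "diff_at X x y"
  shows "dd (e + e') X x y = dd e X x y + dd e' X x y" "dd (c *\<^sub>R e) X x y = c *\<^sub>R dd e X x y"
    "dd 0 X x y = 0" "dd (\<Sum>i\<in>I. f i) X x y = (\<Sum>i\<in>I. dd (f i) X x y)"
    "dd (e - e') X x y = dd e X x y - dd e' X x y" "dd (- e) X x y = - dd e X x y"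
proof -
  note l = has_derivative_linear[OF diff_atD[OF assms]]
  show "dd (e + e') X x y = dd e X x y + dd e' X x y" by (rule linear_add[OF l])
  show "dd (c *\<^sub>R e) X x y = c *\<^sub>R dd e X x y" by (rule linear_cmul[OF l])
  show "dd 0 X x y = 0" by (rule linear_0[OF l])
  show "dd (\<Sum>i\<in>I. f i) X x y = (\<Sum>i\<in>I. dd (f i) X x y)" by (rule linear_sum[OF l])
  show "dd (e - e') X x y = dd e X x y - dd e' X x y" by (rule linear_diff[OF l])
  show "dd (- e) X x y = - dd e X x y" by (rule linear_neg[OF l])
qed

lemma dd_along_curve:
  assumes X: "diff_at X (c t) (c' t)"
    and c: "(c has_vector_derivative u) (at t)" "(c' has_vector_derivative v) (at t)"
  shows "((\<lambda>s. X (c s) (c' s)) has_vector_derivative dd (u, v) X (c t) (c' t)) (at t)"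
proof -
  have "((\<lambda>s. (c s, c' s)) has_vector_derivative (u, v)) (at t)"
    using c by (rule has_vector_derivative_Pair)
  moreover have "((\<lambda>z. X (fst z) (snd z)) has_derivative (\<lambda>e. dd e X (c t) (c' t))) (at (c t, c' t) within range (\<lambda>s. (c s, c' s)))"
    using diff_atD[OF X] has_derivative_at_withinI by blast
  ultimately show ?thesis
    using vector_derivative_diff_chain_within[of "\<lambda>s. (c s, c' s)" "(u, v)" t UNIV
        "\<lambda>z. X (fst z) (snd z)" "\<lambda>e. dd e X (c t) (c' t)"] by (simp add: o_def)
qed

lemma pd_eq_dd:
  assumes "diff_at H x y"
  shows "pd_x k H x y = dd (axis k 1, 0) H x y" "pd_y k H x y = dd (0, axis k 1) H x y"
proof -
  have ax: "((\<lambda>t. a + t *\<^sub>R axis k 1) has_vector_derivative axis k 1) (at t)" for a :: "real^'a" and t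
    by (auto intro!: derivative_eq_intros)
  have 0: "((\<lambda>t. a) has_vector_derivative 0) (at t)" for a :: "real^'a" and t
    by simp
  have "((\<lambda>t. H (x + t *\<^sub>R axis k 1) y) has_vector_derivative dd (axis k 1, 0) H x y) (at 0)"
    using dd_along_curve[of H "\<lambda>t. x + t *\<^sub>R axis k 1" 0 "\<lambda>t. y", OF _ ax 0] assms by simp
  thus "pd_x k H x y = dd (axis k 1, 0) H x y"
    unfolding pd_x_def partial_def
    by (intro DERIV_imp_deriv) (simp add: has_real_derivative_iff_has_vector_derivative)
  have "((\<lambda>t. H x (y + t *\<^sub>R axis k 1)) has_vector_derivative dd (0, axis k 1) H x y) (at 0)"
    using dd_along_curve[of H "\<lambda>t. x" 0 "\<lambda>t. y + t *\<^sub>R axis k 1", OF _ 0 ax] assms by simp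
  thus "pd_y k H x y = dd (0, axis k 1) H x y"
    unfolding pd_y_def partial_def
    by (intro DERIV_imp_deriv) (simp add: has_real_derivative_iff_has_vector_derivative)
qed

lemma dd_const [simp]: "dd e (\<lambda>x y. c) x y = 0" "diff_at (\<lambda>x y. c) x y"
  by (rule diff_atI, rule derivative_intros)+

lemma dd_fibre [simp]: "dd e (\<lambda>x y. y) x y = snd e" "diff_at (\<lambda>x y. y) x y"
  by (rule diff_atI, rule has_derivative_snd, rule has_derivative_ident)+

lemma dd_add: "diff_at X x y \<Longrightarrow> diff_at Y x y \<Longrightarrow> dd e (\<lambda>x y. X x y + Y x y) x y = dd e X x y + dd e Y x y"
  and diff_at_add: "diff_at X x y \<Longrightarrow> diff_at Y x y \<Longrightarrow> diff_at (\<lambda>x y. X x y + Y x y) x y"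
  by (rule diff_atI, rule has_derivative_add, erule diff_atD, erule diff_atD)+

lemma dd_diff: "diff_at X x y \<Longrightarrow> diff_at Y x y \<Longrightarrow> dd e (\<lambda>x y. X x y - Y x y) x y = dd e X x y - dd e Y x y"
  and diff_at_diff: "diff_at X x y \<Longrightarrow> diff_at Y x y \<Longrightarrow> diff_at (\<lambda>x y. X x y - Y x y) x y"
  by (rule diff_atI, rule has_derivative_diff, erule diff_atD, erule diff_atD)+

lemma dd_minus: "diff_at X x y \<Longrightarrow> dd e (\<lambda>x y. - X x y) x y = - dd e X x y"
  and diff_at_minus: "diff_at X x y \<Longrightarrow> diff_at (\<lambda>x y. - X x y) x y"
  by (rule diff_atI, rule has_derivative_minus, erule diff_atD)+

lemma dd_sum: "(\<And>i. i \<in> I \<Longrightarrow> diff_at (X i) x y) \<Longrightarrow> dd e (\<lambda>x y. \<Sum>i\<in>I. X i x y) x y = (\<Sum>i\<in>I. dd e (X i) x y)"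
  and diff_at_sum: "(\<And>i. i \<in> I \<Longrightarrow> diff_at (X i) x y) \<Longrightarrow> diff_at (\<lambda>x y. \<Sum>i\<in>I. X i x y) x y"
  by (rule diff_atI, rule has_derivative_sum, rule diff_atD, simp)+

lemma dd_bilinear:
  assumes "bounded_bilinear f" "diff_at X x y" "diff_at Y x y"
  shows "dd e (\<lambda>x y. f (X x y) (Y x y)) x y = f (dd e X x y) (Y x y) + f (X x y) (dd e Y x y)"
    "diff_at (\<lambda>x y. f (X x y) (Y x y)) x y"
  using diff_atI[OF bounded_bilinear.FDERIV[OF assms(1) diff_atD[OF assms(2)] diff_atD[OF assms(3)]]]
  by (auto simp: add.commute)

lemmas dd_mult = dd_bilinear(1)[OF bounded_bilinear_mult]
  and diff_at_mult = dd_bilinear(2)[OF bounded_bilinear_mult]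

lemma dd_cmult:
  fixes H :: "real^'n::finite \<Rightarrow> real^'n \<Rightarrow> real"
  shows "diff_at H x y \<Longrightarrow> dd e (\<lambda>x y. c * H x y) x y = c * dd e H x y"
  by (simp add: dd_mult)

lemma bounded_bilinear_matrix_vector_mult: "bounded_bilinear ((*v) :: real^'n^'m \<Rightarrow> _)"
  unfolding bilinear_conv_bounded_bilinear[symmetric] bilinear_def
  by (auto intro!: linearI simp: matrix_vector_mult_add_rdistrib matrix_vector_right_distrib
      matrix_vector_mult_scaleR scaleR_matrix_vector_assoc)

lemma dd_inverse:
  fixes H :: "real^'n::finite \<Rightarrow> real^'n \<Rightarrow> real"
  assumes "diff_at H x y" "H x y \<noteq> 0"
  shows "dd e (\<lambda>x y. inverse (H x y)) x y = - (dd e H x y * (inverse (H x y))\<^sup>2)"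
    "diff_at (\<lambda>x y. inverse (H x y)) x y"
  using diff_atI[OF Deriv.has_derivative_inverse[OF _ diff_atD[OF assms(1)]]] assms(2)
  by (auto simp: power2_eq_square mult_ac)

lemma dd_component: "diff_at X x y \<Longrightarrow> dd e (\<lambda>x y. X x y $ i) x y = dd e X x y $ i"
  and diff_at_component: "diff_at X x y \<Longrightarrow> diff_at (\<lambda>x y. X x y $ i) x y"
  by (rule diff_atI, rule bounded_linear.has_derivative[OF bounded_linear_vec_nth], erule diff_atD)+

lemma diff_at_vec:
  fixes X :: "real^'n::finite \<Rightarrow> real^'n \<Rightarrow> 'b::euclidean_space^'m::finite"
  assumes "\<And>i. diff_at (\<lambda>x y. X x y $ i) x y"
  shows "diff_at X x y"
proof -
  have "((\<lambda>z. X (fst z) (snd z)) has_derivative (\<lambda>e. \<chi> i. dd e (\<lambda>x y. X x y $ i) x y)) (at (x, y))"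
    unfolding has_derivative_componentwise_within[where f="\<lambda>z. X (fst z) (snd z)"]
  proof
    fix b :: "'b^'m" assume "b \<in> Basis"
    then obtain i u where b: "b = axis i u" by (auto simp: Basis_vec_def)
    show "((\<lambda>z. X (fst z) (snd z) \<bullet> b) has_derivative (\<lambda>e. (\<chi> i. dd e (\<lambda>x y. X x y $ i) x y) \<bullet> b)) (at (x, y))"
      unfolding b inner_axis using diff_atD[OF assms[of i]]
      by (auto intro!: has_derivative_inner_left)
  qed
  thus ?thesis by (rule diff_atI)
qed

text \<open>The formulas below only hold on an open set \<open>D\<close>, the conic domain of the metric. These congruence
rules allow them to be differentiated.\<close>

lemma has_derivative_fibre_cong:
  assumes "open D" "(x, y) \<in> D" "\<And>x y. (x, y) \<in> D \<Longrightarrow> X x y = Y x y"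
  shows "((\<lambda>z. X (fst z) (snd z)) has_derivative X') (at (x, y)) \<longleftrightarrow>
    ((\<lambda>z. Y (fst z) (snd z)) has_derivative X') (at (x, y))"
proof -
  have eq: "X (fst z) (snd z) = Y (fst z) (snd z)" if "z \<in> D" for z
    using that assms(3) by (cases z) auto
  show ?thesis
    by (rule iffI; erule has_derivative_transform_within_open[OF _ assms(1,2)]) (simp_all add: eq)
qed

lemma diff_at_cong:
  assumes "open D" "(x, y) \<in> D" "\<And>x y. (x, y) \<in> D \<Longrightarrow> X x y = Y x y"
  shows "diff_at X x y \<longleftrightarrow> diff_at Y x y"
  using has_derivative_fibre_cong[of D x y X Y, OF assms] by (simp add: diff_at_def differentiable_def)

lemma dd_cong:
  assumes "open D" "(x, y) \<in> D" "\<And>x y. (x, y) \<in> D \<Longrightarrow> X x y = Y x y"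
  shows "dd e X x y = dd e Y x y"
  using has_derivative_fibre_cong[of D x y X Y, OF assms] by (simp add: dd_def frechet_derivative_def)

lemma partial_const: "partial i (\<lambda>x. c) x = 0"
  by (simp add: partial_def)

lemma smooth_on_const: "smooth_on U (\<lambda>x. c)"
proof -
  have "Ck_on k U (\<lambda>x. c)" for k c
    by (induction k arbitrary: c) (auto simp: partial_const[abs_def])
  thus ?thesis by (simp add: smooth_on_def)
qed

lemma smooth_on_partial: "smooth_on U h \<Longrightarrow> smooth_on U (partial i h)"
  unfolding smooth_on_def by (metis Ck_on.simps(2))

lemma smooth_on_differentiable: "smooth_on U h \<Longrightarrow> open U \<Longrightarrow> x \<in> U \<Longrightarrow> h differentiable (at x)"
  unfolding smooth_on_def by (metis Ck_on.simps(2) differentiable_on_def at_within_open)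

text \<open>The functions on \<open>D\<close> generated by the smooth functions of the base point and the fibre coordinates
under sums, products, and inverses of those functions without zeros that satisfy \<open>S\<close>. With \<open>S\<close>
always true this is a convenient algebra of smooth functions closed under differentiation. With a
smaller \<open>S\<close> it records which denominators may occur.\<close>

inductive fibre_rational ::
  "(real^'n::finite) set \<Rightarrow> ((real^'n) \<times> (real^'n)) set \<Rightarrow> ((real^'n \<Rightarrow> real^'n \<Rightarrow> real) \<Rightarrow> bool) \<Rightarrow>
   (real^'n \<Rightarrow> real^'n \<Rightarrow> real) \<Rightarrow> bool" for U D S where
  base: "smooth_on U c \<Longrightarrow> fibre_rational U D S (\<lambda>x y. c x)"
| coord: "fibre_rational U D S (\<lambda>x y. y $ i)"
| add: "fibre_rational U D S H \<Longrightarrow> fibre_rational U D S K \<Longrightarrow> fibre_rational U D S (\<lambda>x y. H x y + K x y)"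
| mult: "fibre_rational U D S H \<Longrightarrow> fibre_rational U D S K \<Longrightarrow> fibre_rational U D S (\<lambda>x y. H x y * K x y)"
| inverse: "fibre_rational U D S H \<Longrightarrow> S H \<Longrightarrow> (\<And>x y. (x, y) \<in> D \<Longrightarrow> H x y \<noteq> 0) \<Longrightarrow>
    fibre_rational U D S (\<lambda>x y. inverse (H x y))"
| cong: "fibre_rational U D S H \<Longrightarrow> (\<And>x y. (x, y) \<in> D \<Longrightarrow> K x y = H x y) \<Longrightarrow> fibre_rational U D S K"

lemma fibre_rational_mono:
  assumes "fibre_rational U D S H" "\<And>H. S H \<Longrightarrow> S' H"
  shows "fibre_rational U D S' H"
  using assms by induction (auto intro: fibre_rational.intros)

text \<open>The conic domain \<open>D\<close> of a metric in the coordinates of a chart with image \<open>U\<close>.\<close>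

locale fibre_domain =
  fixes U :: "(real^'n::finite) set" and D :: "((real^'n) \<times> (real^'n)) set"
  assumes open_U: "open U" and open_D: "open D" and base_in_U: "(x, y) \<in> D \<Longrightarrow> x \<in> U"
begin

abbreviation rat where "rat \<equiv> fibre_rational U D"

lemma rat_const [simp, intro]: "rat S (\<lambda>x y. c)"
  by (rule fibre_rational.base) (rule smooth_on_const)

lemma rat_minus [intro]: "rat S H \<Longrightarrow> rat S (\<lambda>x y. - H x y)"
  using fibre_rational.mult[OF rat_const[of S "-1"], of H] by simp

lemma rat_diff [intro]: "rat S H \<Longrightarrow> rat S K \<Longrightarrow> rat S (\<lambda>x y. H x y - K x y)"
  using fibre_rational.add[OF _ rat_minus] by force

lemma rat_sum [intro]: "(\<And>i. i \<in> I \<Longrightarrow> rat S (H i)) \<Longrightarrow> rat S (\<lambda>x y. \<Sum>i\<in>I. H i x y)"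
  by (induction I rule: infinite_finite_induct) (auto intro: fibre_rational.add)

lemma rat_prod [intro]: "(\<And>i. i \<in> I \<Longrightarrow> rat S (H i)) \<Longrightarrow> rat S (\<lambda>x y. \<Prod>i\<in>I. H i x y)"
  by (induction I rule: infinite_finite_induct) (auto intro: fibre_rational.mult)

lemma rat_power [intro]: "rat S H \<Longrightarrow> rat S (\<lambda>x y. H x y ^ k)"
  by (induction k) (auto intro: fibre_rational.mult)

lemma rat_diff_at:
  assumes "rat S H" "(x, y) \<in> D"
  shows "diff_at H x y"
  using assms
proof (induction)
  case (base c)
  hence "c differentiable (at x)" using smooth_on_differentiable open_U base_in_U by blast
  then obtain c' where "(c has_derivative c') (at x)" by (auto simp: differentiable_def)
  hence "((\<lambda>z. c (fst z)) has_derivative (\<lambda>z. c' (fst z))) (at (x, y))"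
    by (intro has_derivative_compose[OF has_derivative_fst[OF has_derivative_ident]]) simp
  thus ?case by (rule diff_atI)
next
  case (coord i)
  show ?case by (rule diff_at_component) simp
next
  case (cong H K)
  thus ?case using diff_at_cong[OF open_D, of x y K H] by auto
qed (auto intro: diff_at_add diff_at_mult dd_inverse)

lemma dd_base:
  assumes "smooth_on U c" "(x, y) \<in> D"
  shows "dd e (\<lambda>x y. c x) x y = (\<Sum>i\<in>UNIV. fst e $ i * partial i c x)"
proof -
  have d: "diff_at (\<lambda>x y. c x) x y" using rat_diff_at[OF fibre_rational.base] assms by blast
  have e: "e = (\<Sum>i\<in>UNIV. fst e $ i *\<^sub>R (axis i 1, 0)) + (0, snd e)"
    by (simp add: prod_eq_iff fst_sum snd_sum vec_eq_iff axis_def if_distrib cong: if_cong)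
  have c: "(c has_derivative frechet_derivative c (at x)) (at x)"
    using smooth_on_differentiable[OF assms(1) open_U base_in_U[OF assms(2)]] frechet_derivative_works by blast
  have "((\<lambda>z. c (fst z)) has_derivative (\<lambda>z. frechet_derivative c (at x) (fst z))) (at (x, y))"
    by (rule has_derivative_compose[OF has_derivative_fst[OF has_derivative_ident]]) (simp add: c)
  hence "dd (0, snd e) (\<lambda>x y. c x) x y = 0"
    using diff_atI(2)[of "\<lambda>x y. c x", OF \<open>((\<lambda>z. c (fst z)) has_derivative _) _\<close>, of "(0, snd e)"]
      linear_0[OF has_derivative_linear[OF c]] by simp
  moreover have "dd (axis i 1, 0) (\<lambda>x y. c x) x y = partial i c x" for i
    using pd_eq_dd(1)[OF d, of i] by (simp add: pd_x_def)
  moreover have "dd e (\<lambda>x y. c x) x y =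
      (\<Sum>i\<in>UNIV. fst e $ i *\<^sub>R dd (axis i 1, 0) (\<lambda>x y. c x) x y) + dd (0, snd e) (\<lambda>x y. c x) x y"
    by (subst (1) e) (simp only: dd_linear(1,2,4)[OF d])
  ultimately show ?thesis by simp
qed

lemma rat_dd:
  assumes "rat S H"
  shows "rat S (dd e H)"
  using assms
proof (induction)
  case (base c)
  have "rat S (\<lambda>x y. \<Sum>i\<in>UNIV. fst e $ i * partial i c x)"
    by (intro rat_sum fibre_rational.mult rat_const fibre_rational.base smooth_on_partial base)
  thus ?case by (rule fibre_rational.cong) (simp add: dd_base[OF base])
next
  case (coord i)
  show ?case by (simp add: dd_component)
next
  case (add H K)
  have "rat S (\<lambda>x y. dd e H x y + dd e K x y)" by (intro fibre_rational.add add)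
  moreover have "dd e (\<lambda>x y. H x y + K x y) x y = dd e H x y + dd e K x y" if "(x, y) \<in> D" for x y
    by (rule dd_add[OF rat_diff_at[OF add.hyps(1) that] rat_diff_at[OF add.hyps(2) that]])
  ultimately show ?case by (rule fibre_rational.cong)
next
  case (mult H K)
  have "rat S (\<lambda>x y. dd e H x y * K x y + H x y * dd e K x y)"
    by (intro fibre_rational.add fibre_rational.mult mult)
  moreover have "dd e (\<lambda>x y. H x y * K x y) x y = dd e H x y * K x y + H x y * dd e K x y" if "(x, y) \<in> D" for x y
    by (rule dd_mult[OF rat_diff_at[OF mult.hyps(1) that] rat_diff_at[OF mult.hyps(2) that]])
  ultimately show ?case by (rule fibre_rational.cong)
next
  case (inverse H)
  have "rat S (\<lambda>x y. - (dd e H x y * (inverse (H x y))\<^sup>2))"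
    by (intro rat_minus rat_power fibre_rational.mult fibre_rational.inverse inverse)
  moreover have "dd e (\<lambda>x y. inverse (H x y)) x y = - (dd e H x y * (inverse (H x y))\<^sup>2)" if "(x, y) \<in> D" for x y
    by (rule dd_inverse(1)[OF rat_diff_at[OF inverse.hyps(1) that] inverse.hyps(3)[OF that]])
  ultimately show ?case by (rule fibre_rational.cong)
next
  case (cong H K)
  show ?case by (rule fibre_rational.cong[OF cong.IH]) (rule dd_cong[OF open_D]; simp add: cong)
qed

text \<open>Second derivatives commute if one of the directions is vertical. The class is generated by functions
of \<open>x\<close> alone and of \<open>y\<close> alone, for which both sides vanish, so no theorem on mixed partial
derivatives is needed.\<close>

lemma dd_commute:
  assumes "rat S H" "(x, y) \<in> D"
  shows "dd e (dd (0, v) H) x y = dd (0, v) (dd e H) x y"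
  using assms
proof (induction arbitrary: x y)
  case (base c)
  have "dd e (dd (0, v) (\<lambda>x y. c x)) x y = dd e (\<lambda>x y. 0) x y"
    by (rule dd_cong[OF open_D base(2)]) (simp add: dd_base[OF base(1)])
  moreover have "dd (0, v) (dd e (\<lambda>x y. c x)) x y = dd (0, v) (\<lambda>x y. \<Sum>i\<in>UNIV. fst e $ i * partial i c x) x y"
    by (rule dd_cong[OF open_D base(2)]) (simp add: dd_base[OF base(1)])
  moreover have "\<dots> = (\<Sum>i\<in>UNIV. dd (0, v) (\<lambda>x y. fst e $ i * partial i c x) x y)"
    by (intro dd_sum rat_diff_at[OF fibre_rational.mult] fibre_rational.base rat_const smooth_on_partial base)
  moreover have "dd (0, v) (\<lambda>x y. fst e $ i * partial i c x) x y = 0" for i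
    by (subst dd_mult) (auto intro!: rat_diff_at[OF fibre_rational.base] base smooth_on_partial simp: dd_base[OF smooth_on_partial[OF base(1)] base(2)])
  ultimately show ?case by simp
next
  case (coord i)
  have "dd e (\<lambda>x y. y $ i) = (\<lambda>x y. snd e $ i)" for e :: "(real^'n) \<times> (real^'n)"
    by (intro ext) (simp add: dd_component)
  thus ?case by simp
next
  case (add H K)
  have eq: "dd e (\<lambda>x y. H x y + K x y) x y = dd e H x y + dd e K x y" if "(x, y) \<in> D" for e x y
    by (rule dd_add[OF rat_diff_at[OF add.hyps(1) that] rat_diff_at[OF add.hyps(2) that]])
  have "dd e (dd e' (\<lambda>x y. H x y + K x y)) x y = dd e (dd e' H) x y + dd e (dd e' K) x y" for e e'
  proof -
    have "dd e (dd e' (\<lambda>x y. H x y + K x y)) x y = dd e (\<lambda>x y. dd e' H x y + dd e' K x y) x y"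
      by (rule dd_cong[OF open_D add.prems]) (rule eq)
    also have "\<dots> = dd e (dd e' H) x y + dd e (dd e' K) x y"
      by (intro dd_add add.prems rat_diff_at[OF rat_dd[OF add.hyps(1)]] rat_diff_at[OF rat_dd[OF add.hyps(2)]])
    finally show ?thesis .
  qed
  thus ?case using add.IH add.prems by simp
next
  case (mult H K)
  have eq: "dd e (\<lambda>x y. H x y * K x y) x y = dd e H x y * K x y + H x y * dd e K x y" if "(x, y) \<in> D" for e x y
    by (rule dd_mult[OF rat_diff_at[OF mult.hyps(1) that] rat_diff_at[OF mult.hyps(2) that]])
  note r = mult.hyps(1) mult.hyps(2) rat_dd[OF mult.hyps(1)] rat_dd[OF mult.hyps(2)]
  have "dd e (dd e' (\<lambda>x y. H x y * K x y)) x y =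
      dd e (\<lambda>x y. dd e' H x y * K x y) x y + dd e (\<lambda>x y. H x y * dd e' K x y) x y" for e e'
  proof -
    have "dd e (dd e' (\<lambda>x y. H x y * K x y)) x y = dd e (\<lambda>x y. dd e' H x y * K x y + H x y * dd e' K x y) x y"
      by (rule dd_cong[OF open_D mult.prems]) (rule eq)
    also have "\<dots> = dd e (\<lambda>x y. dd e' H x y * K x y) x y + dd e (\<lambda>x y. H x y * dd e' K x y) x y"
      by (intro dd_add diff_at_mult r[THEN rat_diff_at] mult.prems)
    finally show ?thesis .
  qed
  moreover have "dd e (\<lambda>x y. dd e' H x y * K x y) x y = dd e (dd e' H) x y * K x y + dd e' H x y * dd e K x y"
    "dd e (\<lambda>x y. H x y * dd e' K x y) x y = dd e H x y * dd e' K x y + H x y * dd e (dd e' K) x y" for e e'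
    by (intro dd_mult r[THEN rat_diff_at] mult.prems)+
  ultimately show ?case using mult.IH mult.prems by (simp add: algebra_simps)
next
  case (inverse H)
  have eq: "dd e (\<lambda>x y. inverse (H x y)) x y = - (dd e H x y * (inverse (H x y))\<^sup>2)" if "(x, y) \<in> D" for e x y
    by (rule dd_inverse(1)[OF rat_diff_at[OF inverse.hyps(1) that] inverse.hyps(3)[OF that]])
  have nz: "H x y \<noteq> 0" using inverse by blast
  have "rat S (\<lambda>x y. inverse (H x y))" by (rule fibre_rational.inverse) (fact inverse.hyps)+
  note d = inverse.hyps(1)[THEN rat_diff_at, OF inverse.prems] this[THEN rat_diff_at, OF inverse.prems]
    rat_dd[OF inverse.hyps(1), THEN rat_diff_at, OF inverse.prems]
  let ?I = "\<lambda>x y. inverse (H x y)"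
  have 2: "dd e (dd e' ?I) x y = - (dd e (dd e' H) x y * (?I x y)\<^sup>2 + dd e' H x y * (2 * ?I x y * dd e ?I x y))" for e e'
  proof -
    have "dd e (dd e' ?I) x y = dd e (\<lambda>x y. - (dd e' H x y * (?I x y * ?I x y))) x y"
      by (rule dd_cong[OF open_D inverse.prems]) (simp add: eq power2_eq_square)
    also have "\<dots> = - dd e (\<lambda>x y. dd e' H x y * (?I x y * ?I x y)) x y"
      by (intro dd_minus diff_at_mult d)
    also have "dd e (\<lambda>x y. dd e' H x y * (?I x y * ?I x y)) x y = dd e (dd e' H) x y * (?I x y * ?I x y) + dd e' H x y * dd e (\<lambda>x y. ?I x y * ?I x y) x y"
      by (intro dd_mult diff_at_mult d)
    also have "dd e (\<lambda>x y. ?I x y * ?I x y) x y = dd e ?I x y * ?I x y + ?I x y * dd e ?I x y"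
      by (intro dd_mult d)
    finally show ?thesis by (simp add: algebra_simps power2_eq_square)
  qed
  show ?case
    unfolding 2[of e "(0, v)"] 2[of "(0, v)" e] eq[OF inverse.prems] inverse.IH[OF inverse.prems]
    by (simp add: algebra_simps)
next
  case (cong H K)
  have eq: "dd e K x y = dd e H x y" if "(x, y) \<in> D" for e x y
    by (rule dd_cong[OF open_D that]) (simp add: cong)
  show ?case
    using dd_cong[OF open_D cong.prems eq[where e="(0, v)"]] dd_cong[OF open_D cong.prems eq[where e=e]]
      cong.IH[OF cong.prems] by simp
qed

text \<open>On a line in a fibre along which all admitted denominators are constant, a fibrewise rational
function is a polynomial in the parameter of the line.\<close>

lemma rat_polynomial_on_line:
  assumes "rat S H" "\<And>t. (x, u + t *\<^sub>R v) \<in> D"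
    and "\<And>H. S H \<Longrightarrow> \<exists>c. \<forall>t. H x (u + t *\<^sub>R v) = c"
  shows "\<exists>p. \<forall>t. H x (u + t *\<^sub>R v) = poly p t"
  using assms(1)
proof induction
  case (base c)
  show ?case by (rule exI[of _ "[:c x:]"]) simp
next
  case (coord i)
  show ?case by (rule exI[of _ "[:u $ i, v $ i:]"]) simp
next
  case (add H K)
  then obtain p q where "\<forall>t. H x (u + t *\<^sub>R v) = poly p t" "\<forall>t. K x (u + t *\<^sub>R v) = poly q t" by blast
  thus ?case by (intro exI[of _ "p + q"]) simp
next
  case (mult H K)
  then obtain p q where "\<forall>t. H x (u + t *\<^sub>R v) = poly p t" "\<forall>t. K x (u + t *\<^sub>R v) = poly q t" by blast
  thus ?case by (intro exI[of _ "p * q"]) simp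
next
  case (inverse H)
  then obtain c where "\<forall>t. H x (u + t *\<^sub>R v) = c" using assms(3) by blast
  thus ?case by (intro exI[of _ "[:inverse c:]"]) simp
next
  case (cong H K)
  thus ?case using assms(2) by simp
qed

end

section \<open>Ricci curvature under a projective change of the spray\<close>

lemma dd_split:
  assumes "diff_at H x y"
  shows "dd (u, v) H x y = (\<Sum>k\<in>UNIV. u $ k *\<^sub>R dd (axis k 1, 0) H x y) + (\<Sum>k\<in>UNIV. v $ k *\<^sub>R dd (0, axis k 1) H x y)"
proof -
  have e: "(u, v) = (\<Sum>i\<in>UNIV. u $ i *\<^sub>R (axis i 1, 0)) + (\<Sum>i\<in>UNIV. v $ i *\<^sub>R (0, axis i 1))"
    by (simp add: prod_eq_iff fst_sum snd_sum vec_eq_iff axis_def if_distrib cong: if_cong)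
  show ?thesis
    by (subst e) (simp only: dd_linear(1,2,4)[OF assms])
qed

text \<open>The vertical divergence of the coefficients \<open>G\<close> of a spray, and the Ricci curvature of the spray in
contracted form: the trace of the Riemann curvature, with the derivatives of the trace of the
connection collected into one derivative along the spray.\<close>

definition divergence :: "('n::finite \<Rightarrow> real^'n \<Rightarrow> real^'n \<Rightarrow> real) \<Rightarrow> real^'n \<Rightarrow> real^'n \<Rightarrow> real" where
  "divergence G x y = (\<Sum>m\<in>UNIV. dd (0, axis m 1) (G m) x y)"

definition spray_ricci :: "('n::finite \<Rightarrow> real^'n \<Rightarrow> real^'n \<Rightarrow> real) \<Rightarrow> real^'n \<Rightarrow> real^'n \<Rightarrow> real" where
  "spray_ricci G x y = 2 * (\<Sum>m\<in>UNIV. dd (axis m 1, 0) (G m) x y)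
     - dd (y, - 2 *\<^sub>R (\<chi> j. G j x y)) (divergence G) x y
     - (\<Sum>m\<in>UNIV. \<Sum>j\<in>UNIV. dd (0, axis j 1) (G m) x y * dd (0, axis m 1) (G j) x y)"

context fibre_domain begin

lemma rat_dd_moving:
  assumes "rat S H" "\<And>k. rat S (\<lambda>x y. u x y $ k)" "\<And>k. rat S (\<lambda>x y. v x y $ k)"
  shows "rat S (\<lambda>x y. dd (u x y, v x y) H x y)"
proof -
  have "rat S (\<lambda>x y. (\<Sum>k\<in>UNIV. u x y $ k * dd (axis k 1, 0) H x y) + (\<Sum>k\<in>UNIV. v x y $ k * dd (0, axis k 1) H x y))"
    by (intro fibre_rational.add rat_sum fibre_rational.mult assms rat_dd)
  thus ?thesis
    by (rule fibre_rational.cong) (rule dd_split[OF rat_diff_at[OF assms(1)], unfolded real_scaleR_def])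
qed

lemma rat_divergence: "(\<And>i. rat S (G i)) \<Longrightarrow> rat S (divergence G)"
  unfolding divergence_def[abs_def] by (intro rat_sum rat_dd)

lemma rat_spray_ricci:
  assumes "\<And>i. rat S (G i)"
  shows "rat S (spray_ricci G)"
proof -
  have "rat S (\<lambda>x y. dd (y, - 2 *\<^sub>R (\<chi> j. G j x y)) (divergence G) x y)"
    by (rule rat_dd_moving)
      (auto intro!: rat_divergence assms fibre_rational.coord fibre_rational.mult rat_minus rat_const)
  thus ?thesis
    unfolding spray_ricci_def[abs_def] by (intro rat_diff fibre_rational.mult rat_const rat_sum rat_dd assms)
qed

lemma ricci_curvature_eq:
  assumes G: "\<And>i. rat S (G i)" and F: "\<And>i x y. (x, y) \<in> D \<Longrightarrow> spray_coeff F i x y = G i x y"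
    and xy: "(x, y) \<in> D"
  shows "ricci_curvature F x y = spray_ricci G x y"
proof -
  let ?X = "\<lambda>k. dd (axis k (1::real), 0)" and ?Y = "\<lambda>k. dd (0, axis k (1::real))"
  have d: "diff_at (spray_coeff F i) x y" if "(x, y) \<in> D" for i x y
    using diff_at_cong[OF open_D that, of "spray_coeff F i" "G i"] F rat_diff_at[OF G that] by blast
  have 1: "dd e (spray_coeff F i) x y = dd e (G i) x y" if "(x, y) \<in> D" for e i x y
    by (rule dd_cong[OF open_D that F])
  have px: "pd_x k (spray_coeff F i) x y = ?X k (G i) x y"
    and py: "pd_y k (spray_coeff F i) x y = ?Y k (G i) x y" if "(x, y) \<in> D" for k i x y
    using pd_eq_dd[OF d[OF that], of k] 1[OF that] by auto
  have second: "pd_y k K x y = ?Y k (dd e (G i)) x y"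
    if K: "\<And>x y. (x, y) \<in> D \<Longrightarrow> K x y = dd e (G i) x y" for k K e i
  proof -
    have "diff_at K x y"
      using diff_at_cong[OF open_D xy, of K "dd e (G i)"] K rat_diff_at[OF rat_dd[OF G] xy] by blast
    from pd_eq_dd(2)[OF this] show ?thesis using dd_cong[OF open_D xy K] by simp
  qed
  have pyx: "pd_y k (pd_x m (spray_coeff F i)) x y = ?X m (?Y k (G i)) x y" for k m i
    using second[of "pd_x m (spray_coeff F i)" "(axis m 1, 0)" i k, OF px] dd_commute[OF G xy, of "(axis m 1, 0)" "axis k 1" i]
    by simp
  have pyy: "pd_y k (pd_y m (spray_coeff F i)) x y = ?Y m (?Y k (G i)) x y" for k m i
    using second[of "pd_y m (spray_coeff F i)" "(0, axis m 1)" i k, OF py] dd_commute[OF G xy, of "(0, axis m 1)" "axis k 1" i]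
    by simp
  have dN: "dd e (divergence G) x y = (\<Sum>m\<in>UNIV. dd e (?Y m (G m)) x y)" for e
    unfolding divergence_def[abs_def] by (intro dd_sum rat_diff_at[OF rat_dd[OF G] xy])
  have "dd (y, - 2 *\<^sub>R (\<chi> j. G j x y)) (divergence G) x y =
      (\<Sum>j\<in>UNIV. y $ j * (\<Sum>m\<in>UNIV. ?X j (?Y m (G m)) x y)) +
      (\<Sum>j\<in>UNIV. - 2 * G j x y * (\<Sum>m\<in>UNIV. ?Y j (?Y m (G m)) x y))"
    by (subst dd_split[OF rat_diff_at[OF rat_divergence[OF G] xy]])
      (simp only: dN real_scaleR_def vector_scaleR_component vec_lambda_beta)
  also have "(\<Sum>j\<in>UNIV. y $ j * (\<Sum>m\<in>UNIV. ?X j (?Y m (G m)) x y)) =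
      (\<Sum>m\<in>UNIV. \<Sum>j\<in>UNIV. ?X j (?Y m (G m)) x y * y $ j)"
    by (subst sum.swap) (simp add: sum_distrib_left mult.commute)
  also have "(\<Sum>j\<in>UNIV. - 2 * G j x y * (\<Sum>m\<in>UNIV. ?Y j (?Y m (G m)) x y)) =
      - (\<Sum>m\<in>UNIV. 2 * (\<Sum>j\<in>UNIV. G j x y * ?Y j (?Y m (G m)) x y))"
    by (subst (2) sum_distrib_left, subst sum.swap) (simp add: sum_distrib_left sum_negf mult_ac)
  finally have e: "dd (y, - 2 *\<^sub>R (\<chi> j. G j x y)) (divergence G) x y =
    (\<Sum>m\<in>UNIV. \<Sum>j\<in>UNIV. ?X j (?Y m (G m)) x y * y $ j) - (\<Sum>m\<in>UNIV. 2 * (\<Sum>j\<in>UNIV. G j x y * ?Y j (?Y m (G m)) x y))"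
    by simp
  show ?thesis
    unfolding ricci_curvature_def riemann_curvature_def spray_ricci_def e pyx pyy px[OF xy] py[OF xy] F[OF xy]
    by (simp add: sum.distrib sum_subtractf sum_distrib_left)
qed

text \<open>A vertical derivative of a function homogeneous of degree \<open>k\<close> is homogeneous of degree \<open>k - 1\<close>.\<close>

lemma dd_euler_derivative:
  assumes H: "rat S H" and euler: "\<And>x y. (x, y) \<in> D \<Longrightarrow> dd (0, y) H x y = k * H x y" and xy: "(x, y) \<in> D"
  shows "dd (0, y) (dd (0, v) H) x y = (k - 1) * dd (0, v) H x y"
proof -
  let ?Y = "\<lambda>k. dd (0, axis k (1::real))"
  have E: "dd (0, y) K x y = (\<Sum>j\<in>UNIV. y $ j * ?Y j K x y)" if "rat S K" "(x, y) \<in> D" for K x y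
    using dd_split[OF rat_diff_at[OF that], of 0 y] by simp
  have "dd (0, v) (\<lambda>x y. \<Sum>j\<in>UNIV. y $ j * ?Y j H x y) x y = dd (0, v) (\<lambda>x y. k * H x y) x y"
  proof (rule dd_cong[OF open_D xy])
    fix x y assume "(x, y) \<in> D"
    thus "(\<Sum>j\<in>UNIV. y $ j * ?Y j H x y) = k * H x y" using E[OF H, of x y] euler[of x y] by simp
  qed
  also have "\<dots> = k * dd (0, v) H x y"
    using dd_mult[OF _ rat_diff_at[OF H xy], of "\<lambda>x y. k"] by simp
  also have "dd (0, v) (\<lambda>x y. \<Sum>j\<in>UNIV. y $ j * ?Y j H x y) x y = (\<Sum>j\<in>UNIV. dd (0, v) (\<lambda>x y. y $ j * ?Y j H x y) x y)"
    by (intro dd_sum rat_diff_at[where S=S, OF _ xy] fibre_rational.mult fibre_rational.coord rat_dd H)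
  also have "\<dots> = (\<Sum>j\<in>UNIV. v $ j * ?Y j H x y + y $ j * ?Y j (dd (0, v) H) x y)"
  proof (intro sum.cong refl)
    fix j
    have "dd (0, v) (\<lambda>x y. y $ j * ?Y j H x y) x y = dd (0, v) (\<lambda>x y. y $ j) x y * ?Y j H x y + y $ j * dd (0, v) (?Y j H) x y"
      by (rule dd_mult) (intro rat_diff_at[where S=S, OF _ xy] fibre_rational.coord rat_dd H)+
    thus "dd (0, v) (\<lambda>x y. y $ j * ?Y j H x y) x y = v $ j * ?Y j H x y + y $ j * ?Y j (dd (0, v) H) x y"
      using dd_commute[OF H xy, of "(0, v)" "axis j 1"] by (simp only: dd_component dd_fibre snd_conv)
  qed
  also have "\<dots> = dd (0, v) H x y + dd (0, y) (dd (0, v) H) x y"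
    using dd_split[OF rat_diff_at[OF H xy], of 0 v] E[OF rat_dd[OF H] xy] by (simp add: sum.distrib)
  finally show ?thesis by (simp add: algebra_simps)
qed

text \<open>Adding to a spray a multiple \<open>P\<close> of the position vector field changes its Ricci curvature by
\<open>(n - 1) (P\<^sup>2 - P')\<close>, with \<open>P'\<close> the derivative of \<open>P\<close> along the old spray. In terms of the
derivative along the new spray, which is the one that occurs in the S-curvature, this is the
statement below.\<close>

lemma spray_ricci_projective_change:
  fixes Q :: "'n \<Rightarrow> real^'n \<Rightarrow> real^'n \<Rightarrow> real"
  assumes Q: "\<And>i. rat S (Q i)" and P: "rat S P"
    and EQ: "\<And>i x y. (x, y) \<in> D \<Longrightarrow> dd (0, y) (Q i) x y = 2 * Q i x y"
    and EP: "\<And>x y. (x, y) \<in> D \<Longrightarrow> dd (0, y) P x y = P x y"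
    and G: "G = (\<lambda>i x y. Q i x y + P x y * y $ i)"
    and xy: "(x, y) \<in> D"
  shows "spray_ricci G x y = spray_ricci Q x y
    - (real CARD('n) - 1) * ((P x y)\<^sup>2 + dd (y, - 2 *\<^sub>R (\<chi> j. G j x y)) P x y)"
proof -
  let ?n = "real CARD('n)"
  let ?X = "\<lambda>k. dd (axis k (1::real), 0)" and ?Y = "\<lambda>k. dd (0, axis k (1::real))"
  note dQ = rat_diff_at[OF Q] and dP = rat_diff_at[OF P]
  have dG: "dd e (G i) x y = dd e (Q i) x y + dd e P x y * y $ i + P x y * snd e $ i" if "(x, y) \<in> D" for e i x y
    unfolding G using that
    by (simp add: dd_add dd_mult dd_component diff_at_mult diff_at_component dQ dP)
  have YP: "(\<Sum>j\<in>UNIV. ?Y j P x y * y $ j) = P x y" if "(x, y) \<in> D" for x y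
    using dd_split[OF dP[OF that], of 0 y] EP[OF that] by (simp add: mult.commute)
  have YP': "(\<Sum>j\<in>UNIV. y $ j * ?Y j P x y) = P x y" if "(x, y) \<in> D" for x y
    using YP[OF that] by (simp add: mult.commute)
  have YQ: "(\<Sum>j\<in>UNIV. ?Y j (Q m) x y * y $ j) = 2 * Q m x y" for m
    using dd_split[OF dQ[OF xy], of 0 y m] EQ[OF xy] by (simp add: mult.commute)
  have div: "divergence G x y = divergence Q x y + (?n + 1) * P x y" if "(x, y) \<in> D" for x y
    by (simp add: divergence_def dG[OF that] sum.distrib YP[OF that] YP'[OF that] algebra_simps)
  have dN: "dd e (divergence G) x y = dd e (divergence Q) x y + (?n + 1) * dd e P x y" for e
  proof -
    have "dd e (divergence G) x y = dd e (\<lambda>x y. divergence Q x y + (?n + 1) * P x y) x y"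
      by (rule dd_cong[OF open_D xy]) (rule div)
    thus ?thesis using rat_diff_at[OF rat_divergence[OF Q] xy] dP[OF xy] by (simp add: dd_add dd_mult diff_at_mult)
  qed
  have EN: "dd (0, y) (divergence Q) x y = divergence Q x y"
  proof -
    have "dd (0, y) (divergence Q) x y = (\<Sum>m\<in>UNIV. dd (0, y) (?Y m (Q m)) x y)"
      unfolding divergence_def[abs_def] by (intro dd_sum rat_diff_at[OF rat_dd[OF Q] xy])
    also have "\<dots> = divergence Q x y"
      unfolding divergence_def by (intro sum.cong refl) (simp add: dd_euler_derivative[OF Q EQ xy])
    finally show ?thesis .
  qed
  let ?q = "(y, - 2 *\<^sub>R (\<chi> j. Q j x y))"
  have eG: "(y, - 2 *\<^sub>R (\<chi> j. G j x y)) = ?q + (- 2 * P x y) *\<^sub>R (0, y)"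
    by (simp add: G vec_eq_iff algebra_simps)
  have DP: "dd (y, - 2 *\<^sub>R (\<chi> j. G j x y)) P x y = dd ?q P x y - 2 * (P x y)\<^sup>2"
    unfolding eG dd_linear(1,2)[OF dP[OF xy]] EP[OF xy] by (simp add: power2_eq_square)
  have DN: "dd (y, - 2 *\<^sub>R (\<chi> j. G j x y)) (divergence G) x y =
      dd ?q (divergence Q) x y - 2 * P x y * divergence Q x y + (?n + 1) * (dd ?q P x y - 2 * (P x y)\<^sup>2)"
    unfolding dN DP unfolding eG dd_linear(1,2)[OF rat_diff_at[OF rat_divergence[OF Q] xy]] EN by simp
  have tX: "(\<Sum>m\<in>UNIV. ?X m (G m) x y) = (\<Sum>m\<in>UNIV. ?X m (Q m) x y) + (\<Sum>m\<in>UNIV. y $ m * ?X m P x y)"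
    by (simp add: dG[OF xy] sum.distrib mult.commute)
  have qP: "dd ?q P x y = (\<Sum>m\<in>UNIV. y $ m * ?X m P x y) - 2 * (\<Sum>m\<in>UNIV. Q m x y * ?Y m P x y)"
    using dd_split[OF dP[OF xy], of y "- 2 *\<^sub>R (\<chi> j. Q j x y)"] by (simp add: sum_distrib_left sum_negf mult_ac)
  have "(\<Sum>m\<in>UNIV. \<Sum>j\<in>UNIV. ?Y j (G m) x y * ?Y m (G j) x y) =
      (\<Sum>m\<in>UNIV. \<Sum>j\<in>UNIV. ?Y j (Q m) x y * ?Y m (Q j) x y)
      + (\<Sum>m\<in>UNIV. (\<Sum>j\<in>UNIV. ?Y j (Q m) x y * y $ j) * ?Y m P x y)
      + (\<Sum>m\<in>UNIV. \<Sum>j\<in>UNIV. (?Y m (Q j) x y * y $ m) * ?Y j P x y)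
      + (\<Sum>m\<in>UNIV. ?Y m P x y * y $ m) * (\<Sum>j\<in>UNIV. ?Y j P x y * y $ j)
      + 2 * P x y * divergence Q x y + 2 * P x y * (\<Sum>m\<in>UNIV. ?Y m P x y * y $ m) + ?n * (P x y)\<^sup>2"
  proof -
    have "?Y j (G m) x y * ?Y m (G j) x y =
       ?Y j (Q m) x y * ?Y m (Q j) x y + (?Y j (Q m) x y * y $ j) * ?Y m P x y
       + (?Y m (Q j) x y * y $ m) * ?Y j P x y + (?Y m P x y * y $ m) * (?Y j P x y * y $ j)
       + (if j = m then 2 * P x y * ?Y m (Q m) x y + 2 * P x y * (?Y m P x y * y $ m) + (P x y)\<^sup>2 else 0)" for j m
      by (simp add: dG[OF xy] axis_def power2_eq_square algebra_simps)
    hence "(\<Sum>m\<in>UNIV. \<Sum>j\<in>UNIV. ?Y j (G m) x y * ?Y m (G j) x y) =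
      (\<Sum>m\<in>UNIV. \<Sum>j\<in>UNIV. ?Y j (Q m) x y * ?Y m (Q j) x y + (?Y j (Q m) x y * y $ j) * ?Y m P x y
       + (?Y m (Q j) x y * y $ m) * ?Y j P x y + (?Y m P x y * y $ m) * (?Y j P x y * y $ j)
       + (if j = m then 2 * P x y * ?Y m (Q m) x y + 2 * P x y * (?Y m P x y * y $ m) + (P x y)\<^sup>2 else 0))"
      by simp
    also have "\<dots> = (\<Sum>m\<in>UNIV. \<Sum>j\<in>UNIV. ?Y j (Q m) x y * ?Y m (Q j) x y)
       + (\<Sum>m\<in>UNIV. \<Sum>j\<in>UNIV. (?Y j (Q m) x y * y $ j) * ?Y m P x y)
       + (\<Sum>m\<in>UNIV. \<Sum>j\<in>UNIV. (?Y m (Q j) x y * y $ m) * ?Y j P x y)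
       + (\<Sum>m\<in>UNIV. \<Sum>j\<in>UNIV. (?Y m P x y * y $ m) * (?Y j P x y * y $ j))
       + (\<Sum>m\<in>UNIV. 2 * P x y * ?Y m (Q m) x y + 2 * P x y * (?Y m P x y * y $ m) + (P x y)\<^sup>2)"
      by (simp only: sum.distrib) (simp add: sum.distrib)
    finally show ?thesis
      by (simp add: sum.distrib divergence_def sum_distrib_right[symmetric] sum_product[symmetric])
         (simp add: sum_distrib_left sum_distrib_right mult_ac)
  qed
  also have "(\<Sum>m\<in>UNIV. \<Sum>j\<in>UNIV. (?Y m (Q j) x y * y $ m) * ?Y j P x y) =
      (\<Sum>j\<in>UNIV. (\<Sum>m\<in>UNIV. ?Y m (Q j) x y * y $ m) * ?Y j P x y)"
    by (subst sum.swap) (simp add: sum_distrib_right)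
  finally have tt: "(\<Sum>m\<in>UNIV. \<Sum>j\<in>UNIV. ?Y j (G m) x y * ?Y m (G j) x y) =
      (\<Sum>m\<in>UNIV. \<Sum>j\<in>UNIV. ?Y j (Q m) x y * ?Y m (Q j) x y)
      + 4 * (\<Sum>m\<in>UNIV. Q m x y * ?Y m P x y) + 2 * P x y * divergence Q x y + (?n + 3) * (P x y)\<^sup>2"
    unfolding YQ YP[OF xy] by (simp add: sum_distrib_left mult_ac power2_eq_square algebra_simps)
  show ?thesis
    unfolding spray_ricci_def tt DN DP tX qP by (simp add: algebra_simps power2_eq_square)
qed

end

section \<open>Kropina metrics in navigation form\<close>

lemma diff_at_base:
  assumes "diff_at (\<lambda>x y. f x) x y"
  shows "(f has_derivative frechet_derivative f (at x)) (at x)"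
    "dd e (\<lambda>x y. f x) x y = frechet_derivative f (at x) (fst e)"
proof -
  have "((\<lambda>x. (x, y)) has_derivative (\<lambda>e. (e, 0))) (at x)"
    by (auto intro!: derivative_eq_intros)
  hence "(f has_derivative (\<lambda>e. dd (e, 0) (\<lambda>x y. f x) x y)) (at x)"
    using has_derivative_compose[of "\<lambda>x. (x, y)" "\<lambda>e. (e, 0)" x UNIV "\<lambda>z. f (fst z)"] diff_atD[OF assms] by simp
  thus f: "(f has_derivative frechet_derivative f (at x)) (at x)"
    using frechet_derivative_works differentiable_def by blast
  have "((\<lambda>z. f (fst z)) has_derivative (\<lambda>z. frechet_derivative f (at x) (fst z))) (at (x, y))"
    by (rule has_derivative_compose[OF has_derivative_fst[OF has_derivative_ident]]) (simp add: f)
  thus "dd e (\<lambda>x y. f x) x y = frechet_derivative f (at x) (fst e)"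
    by (rule diff_atI(2)[of "\<lambda>x y. f x"])
qed

lemma vec_sum_axis: "(\<Sum>l\<in>UNIV. (v :: real^'n::finite) $ l *\<^sub>R axis l 1) = v"
  by (simp add: vec_eq_iff axis_def if_distrib cong: if_cong)

text \<open>Contraction of the covector that consists of the values of a linear functional on the coordinate axes.\<close>

lemma inner_lambda_linear:
  assumes "linear L"
  shows "(v :: real^'n::finite) \<bullet> (\<chi> l. L (axis l 1)) = L v"
proof -
  have "L v = L (\<Sum>l\<in>UNIV. v $ l *\<^sub>R axis l 1)" by (simp only: vec_sum_axis)
  also have "\<dots> = (\<Sum>l\<in>UNIV. v $ l * L (axis l 1))"
    by (simp add: linear_sum[OF assms] linear_cmul[OF assms])
  finally show ?thesis by (simp add: inner_vec_def)
qed

text \<open>The denominators admitted for functions without poles along the null cone of the Riemannian metric: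
functions of the base point, and the 1-form \<open>w\<close> in the denominator of the Kropina metric.\<close>

definition pole_free :: "(real^'n::finite \<Rightarrow> real^'n) \<Rightarrow> (real^'n \<Rightarrow> real^'n \<Rightarrow> real) \<Rightarrow> bool" where
  "pole_free w H \<longleftrightarrow> (\<exists>\<phi>. H = (\<lambda>x y. \<phi> x)) \<or> H = (\<lambda>x y. w x \<bullet> y)"

text \<open>In navigation form a Kropina metric is \<open>F = h(y, y) / (2 w(y))\<close>, where \<open>h\<close> is a Riemannian metric
with inverse \<open>hi\<close> and the vector field \<open>W\<close> dual to \<open>w\<close> has unit length for \<open>h\<close>. The base \<open>V\<close>
is the set of points over which the conic domain \<open>D\<close> is not empty.\<close>

locale navigation = fibre_domain U D
  for U :: "(real^'n::finite) set" and D +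
  fixes V :: "(real^'n) set" and h hi :: "real^'n \<Rightarrow> real^'n^'n" and w W :: "real^'n \<Rightarrow> real^'n"
  assumes D_iff: "(x, y) \<in> D \<longleftrightarrow> x \<in> V \<and> w x \<bullet> y > 0"
    and h_sym: "x \<in> V \<Longrightarrow> transpose (h x) = h x"
    and h_pos: "x \<in> V \<Longrightarrow> v \<noteq> 0 \<Longrightarrow> form (h x) v v > 0"
    and h_hi: "x \<in> V \<Longrightarrow> h x ** hi x = mat 1"
    and h_W: "x \<in> V \<Longrightarrow> h x *v W x = w x"
    and w_W: "x \<in> V \<Longrightarrow> w x \<bullet> W x = 1"
    and rat_h: "rat (pole_free w) (\<lambda>x y. h x $ i $ j)"
    and rat_hi: "rat (pole_free w) (\<lambda>x y. hi x $ i $ j)"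
    and rat_w: "rat (pole_free w) (\<lambda>x y. w x $ i)"
    and rat_W: "rat (pole_free w) (\<lambda>x y. W x $ i)"
begin

text \<open>\<open>pf\<close>: functions that are pole-free along the null cone of \<open>h\<close>. \<open>smth\<close>: fibrewise rational functions
with arbitrary denominators.\<close>

abbreviation pf where "pf \<equiv> rat (pole_free w)"
abbreviation smth where "smth \<equiv> rat (\<lambda>_. True)"

lemma pf_smth: "pf H \<Longrightarrow> smth H"
  by (rule fibre_rational_mono) auto

lemma diff_at_pf: "pf H \<Longrightarrow> (x, y) \<in> D \<Longrightarrow> diff_at H x y"
  by (rule rat_diff_at)

lemma diff_at_base_fields:
  assumes "(x, y) \<in> D"
  shows "diff_at (\<lambda>x y. h x) x y" "diff_at (\<lambda>x y. hi x) x y" "diff_at (\<lambda>x y. w x) x y" "diff_at (\<lambda>x y. W x) x y"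
  by (intro diff_at_vec rat_diff_at[OF rat_h assms] rat_diff_at[OF rat_hi assms]
      rat_diff_at[OF rat_w assms] rat_diff_at[OF rat_W assms])+

text \<open>Derivatives of the fields on the base at \<open>x\<close> in the direction \<open>e\<close>.\<close>

abbreviation "Dh x e \<equiv> frechet_derivative h (at x) e"
abbreviation "Dw x e \<equiv> frechet_derivative w (at x) e"
abbreviation "DW x e \<equiv> frechet_derivative W (at x) e"

lemma W_in_D: "x \<in> V \<Longrightarrow> (x, W x) \<in> D"
  by (simp add: D_iff w_W)

lemma base_derivatives:
  assumes "x \<in> V"
  shows "(h has_derivative frechet_derivative h (at x)) (at x)" "(w has_derivative frechet_derivative w (at x)) (at x)"
    "(W has_derivative frechet_derivative W (at x)) (at x)"
  using diff_at_base(1) diff_at_base_fields[OF W_in_D[OF assms]] by blast+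

lemmas linear_D = base_derivatives[THEN has_derivative_linear]

lemma dd_base_fields:
  assumes "(x, y) \<in> D"
  shows "dd e (\<lambda>x y. h x) x y = Dh x (fst e)" "dd e (\<lambda>x y. w x) x y = Dw x (fst e)" "dd e (\<lambda>x y. W x) x y = DW x (fst e)"
  using diff_at_base(2) diff_at_base_fields[OF assms] by blast+

lemma rat_pf_mv:
  assumes "\<And>i j. pf (\<lambda>x y. M x y $ i $ j)" "\<And>j. pf (\<lambda>x y. X x y $ j)"
  shows "pf (\<lambda>x y. (M x y *v X x y) $ i)"
  unfolding matrix_vector_mult_def vec_lambda_beta
  by (intro rat_sum fibre_rational.mult assms)

lemma rat_pf_inner:
  assumes "\<And>j. pf (\<lambda>x y. X x y $ j)" "\<And>j. pf (\<lambda>x y. Y x y $ j)"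
  shows "pf (\<lambda>x y. X x y \<bullet> Y x y)"
  unfolding inner_vec_def inner_real_def by (intro rat_sum fibre_rational.mult assms)

lemma rat_Dh:
  assumes "\<And>k. pf (\<lambda>x y. u x y $ k)"
  shows "pf (\<lambda>x y. Dh x (u x y) $ i $ j)"
proof -
  have "pf (\<lambda>x y. dd (u x y, 0) (\<lambda>x y. h x $ i $ j) x y)"
    by (intro rat_dd_moving rat_h assms) simp
  thus ?thesis
  proof (rule fibre_rational.cong)
    fix x y assume xy: "(x, y) \<in> D"
    note d = diff_at_base_fields(1)[OF xy]
    show "Dh x (u x y) $ i $ j = dd (u x y, 0) (\<lambda>x y. h x $ i $ j) x y"
      using dd_component[OF diff_at_component[OF d]] dd_component[OF d] dd_base_fields(1)[OF xy] by simp
  qed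
qed

lemma rat_Dw:
  assumes "\<And>k. pf (\<lambda>x y. u x y $ k)"
  shows "pf (\<lambda>x y. Dw x (u x y) $ i)"
proof -
  have "pf (\<lambda>x y. dd (u x y, 0) (\<lambda>x y. w x $ i) x y)"
    by (intro rat_dd_moving rat_w assms) simp
  thus ?thesis
  proof (rule fibre_rational.cong)
    fix x y assume xy: "(x, y) \<in> D"
    show "Dw x (u x y) $ i = dd (u x y, 0) (\<lambda>x y. w x $ i) x y"
      using dd_component[OF diff_at_base_fields(3)[OF xy]] dd_base_fields(2)[OF xy] by simp
  qed
qed

lemma rat_axis: "pf (\<lambda>x y. axis k c $ i)" by simp
lemma rat_y: "pf (\<lambda>x y. y $ i)" by (rule fibre_rational.coord)

text \<open>The data of the geodesic spray. \<open>Z\<close> is the contraction of the exterior derivative of \<open>w\<close> with \<open>y\<close>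
and \<open>z\<close> its value on \<open>W\<close>. The vector \<open>hG\<close> is twice the vector of spray coefficients of \<open>h\<close>,
and \<open>r\<close> is the derivative of \<open>B\<close> along the geodesics of \<open>h\<close>: the quadratic form of the
symmetrized covariant derivative of \<open>w\<close>. The vector \<open>G\<close> is twice the vector of spray coefficients
of the Kropina metric. It is projectively equivalent to the pole-free \<open>G0\<close>, and the factor \<open>\<kappa>\<close>,
whose pole comes from \<open>r / F = 2 r B / A\<close>, turns out to be the logarithmic derivative of \<open>B\<close> along
the geodesics of the Kropina metric.\<close>

definition A where "A x y = form (h x) y y"
definition B where "B x y = w x \<bullet> y"
definition F where "F x y = A x y / (2 * B x y)"
definition grad_h where "grad_h x y = (\<chi> l. y \<bullet> (Dh x (axis l 1) *v y))"
definition Z where "Z x y = Dw x y - (\<chi> l. Dw x (axis l 1) \<bullet> y)"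
definition hG where "hG x y = hi x *v (Dh x y *v y - (1/2) *\<^sub>R grad_h x y)"
definition r where "r x y = Dw x y \<bullet> y - W x \<bullet> (Dh x y *v y) + (1/2) * (y \<bullet> (Dh x (W x) *v y))"
definition z where "z x y = W x \<bullet> Z x y"
definition G0 where "G0 x y = hG x y - F x y *\<^sub>R (hi x *v Z x y) + (r x y + F x y * z x y) *\<^sub>R W x"
definition \<kappa> where "\<kappa> x y = r x y / F x y + z x y"
definition G where "G x y = G0 x y - \<kappa> x y *\<^sub>R y"

lemma pos:
  assumes "(x, y) \<in> D"
  shows "A x y > 0" "B x y > 0" "F x y > 0" "x \<in> V"
proof -
  show V: "x \<in> V" and b: "B x y > 0" using assms by (auto simp: D_iff B_def)
  hence "y \<noteq> 0" by (auto simp: B_def)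
  thus "A x y > 0" using h_pos[OF V] by (simp add: A_def)
  thus "F x y > 0" using b by (simp add: F_def)
qed

lemma A_eq: "(x, y) \<in> D \<Longrightarrow> A x y = 2 * F x y * B x y"
  using pos[of x y] by (simp add: F_def)

lemma pf_A: "pf A" unfolding A_def[abs_def] form_def
  by (intro rat_pf_inner rat_pf_mv rat_y rat_h)
lemma pf_B: "pf B" unfolding B_def[abs_def]
  by (intro rat_pf_inner rat_y rat_w)
lemma pf_invB: "pf (\<lambda>x y. inverse (B x y))"
  by (rule fibre_rational.inverse[OF pf_B]) (use pos in \<open>force simp: pole_free_def B_def[abs_def]\<close>)+
lemma pf_F: "pf F"
proof -
  have "pf (\<lambda>x y. 1/2 * A x y * inverse (B x y))"
    by (intro fibre_rational.mult pf_A pf_invB rat_const)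
  thus ?thesis by (rule fibre_rational.cong) (simp add: F_def field_simps)
qed
lemma pf_grad: "pf (\<lambda>x y. grad_h x y $ i)"
  unfolding grad_h_def vec_lambda_beta by (intro rat_pf_inner rat_pf_mv rat_y rat_Dh rat_axis)
lemma pf_Z: "pf (\<lambda>x y. Z x y $ i)"
  unfolding Z_def vec_lambda_beta vector_minus_component by (intro rat_diff rat_pf_inner rat_y rat_Dw rat_axis)
lemma pf_hG: "pf (\<lambda>x y. hG x y $ i)"
  unfolding hG_def by (intro rat_pf_mv rat_hi)
    (simp only: vector_minus_component vector_scaleR_component real_scaleR_def,
     intro rat_diff fibre_rational.mult rat_const rat_pf_mv rat_Dh rat_y pf_grad)
lemma pf_r: "pf r"
  unfolding r_def[abs_def]
  by (intro fibre_rational.add rat_diff fibre_rational.mult rat_const rat_pf_inner rat_pf_mv rat_Dh rat_Dw rat_y rat_W)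
lemma pf_z: "pf z"
  unfolding z_def[abs_def] by (intro rat_pf_inner rat_W pf_Z)
lemma pf_G0: "pf (\<lambda>x y. G0 x y $ i)"
  unfolding G0_def vector_minus_component vector_add_component vector_scaleR_component real_scaleR_def
  by (intro fibre_rational.add rat_diff fibre_rational.mult pf_hG pf_F rat_pf_mv rat_hi pf_Z pf_r pf_z rat_W)

lemma smth_inverse: "smth H \<Longrightarrow> (\<And>x y. (x, y) \<in> D \<Longrightarrow> H x y \<noteq> 0) \<Longrightarrow> smth (\<lambda>x y. inverse (H x y))"
  by (rule fibre_rational.inverse) auto

lemma smth_\<kappa>: "smth \<kappa>"
proof -
  have "smth (\<lambda>x y. r x y * inverse (F x y) + z x y)"
    by (intro fibre_rational.add fibre_rational.mult smth_inverse pf_smth pf_r pf_F pf_z) (use pos in force)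
  thus ?thesis by (rule fibre_rational.cong) (simp add: \<kappa>_def field_simps)
qed

lemma smth_G: "smth (\<lambda>x y. G x y $ i)"
  unfolding G_def vector_minus_component vector_scaleR_component real_scaleR_def
  by (intro rat_diff fibre_rational.mult smth_\<kappa> pf_smth[OF pf_G0] fibre_rational.coord)

lemma Dh_sym: assumes "x \<in> V" shows "u \<bullet> (Dh x e *v v) = v \<bullet> (Dh x e *v u)"
proof -
  note D = W_in_D[OF assms]
  note d = diff_at_base_fields(1)[OF D]
  have c: "dd (e, 0) (\<lambda>x y. h x $ i $ j) x (W x) = Dh x e $ i $ j" for i j
    using dd_component[OF diff_at_component[OF d]] dd_component[OF d] dd_base_fields(1)[OF D] by simp
  have "Dh x e $ i $ j = Dh x e $ j $ i" for i j
  proof -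
    have "dd (e, 0) (\<lambda>x y. h x $ i $ j) x (W x) = dd (e, 0) (\<lambda>x y. h x $ j $ i) x (W x)"
    proof (rule dd_cong[OF open_D D])
      fix x y assume "(x, y) \<in> D"
      hence "transpose (h x) = h x" using h_sym pos(4) by blast
      hence "transpose (h x) $ i $ j = h x $ i $ j" by simp
      thus "h x $ i $ j = h x $ j $ i" by (simp only: transpose_def vec_lambda_beta)
    qed
    thus ?thesis unfolding c .
  qed
  hence "transpose (Dh x e) = Dh x e" by (simp add: transpose_def vec_eq_iff)
  thus ?thesis using form_commute unfolding form_def by blast
qed

lemma h_form: "x \<in> V \<Longrightarrow> u \<bullet> (h x *v v) = v \<bullet> (h x *v u)"
  using form_commute[OF h_sym] unfolding form_def by blast

lemma h_hi_v: "x \<in> V \<Longrightarrow> h x *v (hi x *v v) = v"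
  by (simp add: matrix_vector_mul_assoc h_hi)

lemma w_inner: "x \<in> V \<Longrightarrow> w x \<bullet> v = v \<bullet> (h x *v W x)"
  by (simp add: h_W inner_commute)

lemma dd_A:
  assumes "(x, y) \<in> D"
  shows "dd (u, v) A x y = y \<bullet> (Dh x u *v y) + 2 * (v \<bullet> (h x *v y))"
proof -
  note d = diff_at_base_fields(1)[OF assms] dd_bilinear(2)[OF bounded_bilinear_matrix_vector_mult]
    dd_bilinear(2)[OF bounded_bilinear_inner]
  have "dd (u, v) A x y = v \<bullet> (h x *v y) + y \<bullet> (Dh x u *v y + h x *v v)"
    unfolding A_def[abs_def] form_def
    by (simp add: dd_bilinear(1)[OF bounded_bilinear_inner] dd_bilinear(1)[OF bounded_bilinear_matrix_vector_mult]
        d dd_base_fields[OF assms])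
  thus ?thesis using h_form[OF pos(4)[OF assms], of y v] by (simp add: inner_simps)
qed

lemma dd_B:
  assumes "(x, y) \<in> D"
  shows "dd (u, v) B x y = Dw x u \<bullet> y + w x \<bullet> v"
  unfolding B_def[abs_def]
  by (simp add: dd_bilinear(1)[OF bounded_bilinear_inner] diff_at_base_fields[OF assms] dd_base_fields[OF assms])

lemma dd_F:
  assumes "(x, y) \<in> D"
  shows "dd e F x y = (dd e A x y - 2 * F x y * dd e B x y) / (2 * B x y)"
proof -
  note d = diff_at_pf[OF pf_F assms] diff_at_pf[OF pf_B assms]
  have "dd e A x y = dd e (\<lambda>x y. 2 * (F x y * B x y)) x y"
    by (rule dd_cong[OF open_D assms]) (simp add: A_eq)
  also have "\<dots> = 2 * (dd e F x y * B x y + F x y * dd e B x y)"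
    by (simp add: dd_mult d diff_at_mult)
  finally show ?thesis using pos(2)[OF assms] by (simp add: field_simps)
qed

lemma W_Dw: "x \<in> V \<Longrightarrow> v \<bullet> (\<chi> l. Dw x (axis l 1) \<bullet> y) = Dw x v \<bullet> y"
  by (rule inner_lambda_linear) (intro linear_compose[OF linear_D(2), unfolded o_def] bounded_linear.linear bounded_linear_inner_left; assumption)

lemma inner_grad_h: "x \<in> V \<Longrightarrow> v \<bullet> grad_h x y = y \<bullet> (Dh x v *v y)"
  unfolding grad_h_def
proof (rule inner_lambda_linear)
  assume "x \<in> V"
  note l = linear_D(1)[OF this]
  show "linear (\<lambda>e. y \<bullet> (Dh x e *v y))"
    by (rule linearI) (simp_all add: linear_add[OF l] linear_cmul[OF l] matrix_vector_mult_add_rdistrib inner_simps scaleR_matrix_vector_assoc[symmetric])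
qed

lemma inner_Z: assumes "x \<in> V" shows "y \<bullet> Z x y = 0" "z x y = Dw x y \<bullet> W x - Dw x (W x) \<bullet> y"
  using W_Dw[OF assms] by (simp_all add: Z_def z_def inner_simps inner_commute)

lemma r_F_z: "(x, y) \<in> D \<Longrightarrow> r x y + F x y * z x y = \<kappa> x y * F x y"
  using pos[of x y] by (simp add: \<kappa>_def field_simps)

lemma h_G:
  assumes "(x, y) \<in> D"
  shows "h x *v G x y = Dh x y *v y - (1/2) *\<^sub>R grad_h x y - F x y *\<^sub>R Z x y + (\<kappa> x y * F x y) *\<^sub>R w x - \<kappa> x y *\<^sub>R (h x *v y)"
  unfolding G_def G0_def hG_def r_F_z[OF assms]
  using pos(4)[OF assms]
  by (simp add: matrix_vector_right_distrib matrix_vector_mult_diff_distrib matrix_vector_mult_scaleR h_hi_v h_W)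

text \<open>The derivative along the geodesic spray of the Kropina metric.\<close>

abbreviation DG where "DG H x y \<equiv> dd (y, - G x y) H x y"

lemma DG_A: assumes "(x, y) \<in> D" shows "DG A x y = \<kappa> x y * A x y"
proof -
  note V = pos(4)[OF assms]
  have "G x y \<bullet> (h x *v y) = y \<bullet> (h x *v G x y)" by (rule h_form[OF V])
  also have "\<dots> = (1/2) * (y \<bullet> (Dh x y *v y)) + \<kappa> x y * F x y * B x y - \<kappa> x y * A x y"
    unfolding h_G[OF assms]
    by (simp add: inner_simps inner_grad_h[OF V] inner_Z[OF V] B_def A_def form_def inner_commute)
  finally show ?thesis
    unfolding dd_A[OF assms] by (simp add: A_eq[OF assms] algebra_simps)
qed

lemma DG_B: assumes "(x, y) \<in> D" shows "DG B x y = \<kappa> x y * B x y"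
proof -
  note V = pos(4)[OF assms]
  have "w x \<bullet> G x y = W x \<bullet> (h x *v G x y)"
    by (simp add: w_inner[OF V] h_form[OF V])
  also have "\<dots> = W x \<bullet> (Dh x y *v y) - (1/2) * (y \<bullet> (Dh x (W x) *v y)) - F x y * z x y + \<kappa> x y * F x y - \<kappa> x y * B x y"
    unfolding h_G[OF assms]
    using w_W[OF V] h_form[OF V, of "W x" y] h_W[OF V]
    by (simp add: inner_simps inner_grad_h[OF V] z_def B_def inner_commute)
  finally show ?thesis
    unfolding dd_B[OF assms] r_F_z[OF assms, symmetric] by (simp add: r_def algebra_simps)
qed

lemma DG_F: assumes "(x, y) \<in> D" shows "DG F x y = 0"
  unfolding dd_F[OF assms] DG_A[OF assms] DG_B[OF assms] by (simp add: A_eq[OF assms])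

end

section \<open>The fundamental tensor and the geodesic spray\<close>

context navigation begin

text \<open>\<open>ell\<close> is the vertical differential of \<open>F\<close>, and \<open>L\<close> that of \<open>F\<^sup>2 / 2\<close>, the Legendre transform.\<close>

definition ell where "ell x y = (1 / B x y) *\<^sub>R (h x *v y - F x y *\<^sub>R w x)"
definition L where "L x y = F x y *\<^sub>R ell x y"

lemma diff_at_h_y: "(x, y) \<in> D \<Longrightarrow> diff_at (\<lambda>x y. h x *v y) x y"
  by (intro dd_bilinear(2)[OF bounded_bilinear_matrix_vector_mult] diff_at_base_fields) simp_all

lemma dd_h_y: "(x, y) \<in> D \<Longrightarrow> dd (u, v) (\<lambda>x y. h x *v y) x y = Dh x u *v y + h x *v v"
  by (subst dd_bilinear(1)[OF bounded_bilinear_matrix_vector_mult]) (simp_all add: diff_at_base_fields dd_base_fields)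

lemmas dd_scaleR = dd_bilinear(1)[OF bounded_bilinear_scaleR]
  and diff_at_scaleR = dd_bilinear(2)[OF bounded_bilinear_scaleR]

lemma L_eq: "L x y = (F x y * inverse (B x y)) *\<^sub>R (h x *v y - F x y *\<^sub>R w x)"
  by (simp add: L_def ell_def divide_inverse)

lemma dd_L:
  assumes "(x, y) \<in> D"
  shows "dd (u, v) L x y = (dd (u, v) F x y / B x y - F x y * dd (u, v) B x y / (B x y)\<^sup>2) *\<^sub>R (h x *v y - F x y *\<^sub>R w x)
      + (F x y / B x y) *\<^sub>R (Dh x u *v y + h x *v v - dd (u, v) F x y *\<^sub>R w x - F x y *\<^sub>R Dw x u)"
    and diff_at_L: "diff_at L x y"
proof -
  note nz = pos(2)[OF assms]
  note d = diff_at_pf[OF pf_F assms] diff_at_pf[OF pf_B assms] diff_at_base_fields(3)[OF assms] diff_at_h_y[OF assms]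
  have dF: "diff_at (\<lambda>x y. F x y * inverse (B x y)) x y"
    by (intro diff_at_mult d dd_inverse) (use nz in simp)
  have dV: "diff_at (\<lambda>x y. h x *v y - F x y *\<^sub>R w x) x y"
    by (intro diff_at_diff diff_at_scaleR d)
  have e1: "dd (u, v) (\<lambda>x y. F x y * inverse (B x y)) x y = dd (u, v) F x y / B x y - F x y * dd (u, v) B x y / (B x y)\<^sup>2"
    using nz by (subst dd_mult) (simp_all add: d dd_inverse divide_inverse power_inverse)
  have e2: "dd (u, v) (\<lambda>x y. h x *v y - F x y *\<^sub>R w x) x y
      = Dh x u *v y + h x *v v - (dd (u, v) F x y *\<^sub>R w x + F x y *\<^sub>R Dw x u)"
    by (subst dd_diff) (simp_all add: d diff_at_scaleR dd_scaleR dd_h_y[OF assms] dd_base_fields[OF assms])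
  show "diff_at L x y"
    unfolding L_eq[abs_def] by (intro diff_at_scaleR dF dV)
  show "dd (u, v) L x y = (dd (u, v) F x y / B x y - F x y * dd (u, v) B x y / (B x y)\<^sup>2) *\<^sub>R (h x *v y - F x y *\<^sub>R w x)
      + (F x y / B x y) *\<^sub>R (Dh x u *v y + h x *v v - dd (u, v) F x y *\<^sub>R w x - F x y *\<^sub>R Dw x u)"
    unfolding L_eq[abs_def] dd_scaleR[OF dF dV] e1 e2
    by (simp add: diff_diff_eq divide_inverse add.commute)
qed

lemma dd_F_vertical:
  assumes "(x, y) \<in> D" shows "dd (0, v) F x y = ell x y \<bullet> v"
  unfolding dd_F[OF assms] dd_A[OF assms] dd_B[OF assms] ell_def
  using pos(2)[OF assms] linear_0[OF linear_D(1)[OF pos(4)[OF assms]]] linear_0[OF linear_D(2)[OF pos(4)[OF assms]]]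
  by (simp add: inner_simps field_simps inner_commute)

lemma dd_L_vertical:
  assumes "(x, y) \<in> D"
  shows "dd (0, v) L x y = (ell x y \<bullet> v) *\<^sub>R ell x y
    + (F x y / B x y) *\<^sub>R (h x *v v - (ell x y \<bullet> v) *\<^sub>R w x - (w x \<bullet> v) *\<^sub>R ell x y)"
proof -
  note nz = pos(2)[OF assms]
  have "h x *v y - F x y *\<^sub>R w x = B x y *\<^sub>R ell x y" using nz by (simp add: ell_def)
  thus ?thesis
    unfolding dd_L[OF assms] dd_F_vertical[OF assms] dd_B[OF assms]
    using nz linear_0[OF linear_D(1)[OF pos(4)[OF assms]]] linear_0[OF linear_D(2)[OF pos(4)[OF assms]]]
    by (simp add: algebra_simps power2_eq_square)
qed

lemma dd_F_square:
  assumes "(x, y) \<in> D"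
  shows "dd e (\<lambda>x y. (F x y)\<^sup>2) x y = 2 * F x y * dd e F x y" "diff_at (\<lambda>x y. (F x y)\<^sup>2) x y"
  unfolding power2_eq_square
  by (simp_all add: dd_mult diff_at_mult diff_at_pf[OF pf_F assms])

text \<open>The Euler-Lagrange equations of \<open>F\<^sup>2 / 2\<close>: they characterize \<open>G\<close> as the geodesic spray.\<close>

lemma DG_L:
  assumes "(x, y) \<in> D"
  shows "dd (y, - G x y) L x y $ l = (1/2) * dd (axis l 1, 0) (\<lambda>x y. (F x y)\<^sup>2) x y"
proof -
  note nz = pos(2)[OF assms] and V = pos(4)[OF assms]
  have zw: "Z x y - Dw x y = - (\<chi> l. Dw x (axis l 1) \<bullet> y)" by (simp add: Z_def)
  have "dd (y, - G x y) L x y = (F x y / B x y) *\<^sub>R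
     (Dh x y *v y - h x *v G x y - F x y *\<^sub>R Dw x y - \<kappa> x y *\<^sub>R (h x *v y - F x y *\<^sub>R w x))"
    unfolding dd_L[OF assms] DG_F[OF assms] DG_B[OF assms]
    using nz by (simp add: algebra_simps power2_eq_square linear_neg[OF matrix_vector_mul_linear])
  also have "Dh x y *v y - h x *v G x y - F x y *\<^sub>R Dw x y - \<kappa> x y *\<^sub>R (h x *v y - F x y *\<^sub>R w x)
      = (1/2) *\<^sub>R grad_h x y + F x y *\<^sub>R (Z x y - Dw x y)"
    unfolding h_G[OF assms] by (simp add: algebra_simps)
  finally have "dd (y, - G x y) L x y $ l = (F x y / B x y) * ((1/2) * (y \<bullet> (Dh x (axis l 1) *v y)) - F x y * (Dw x (axis l 1) \<bullet> y))"
    unfolding zw by (simp add: grad_h_def)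
  thus ?thesis
    unfolding dd_F_square[OF assms] dd_F[OF assms] dd_A[OF assms] dd_B[OF assms]
    using nz by (simp add: field_simps)
qed

text \<open>With \<open>m = B / F\<close> the fundamental tensor is \<open>1 / m\<close> times the pullback of \<open>h\<close> under a rank-one
perturbation \<open>T\<close> of the identity, whose determinant is \<open>1 / sqrt m\<close>.\<close>

lemma metric_tensor_form:
  assumes "(x, y) \<in> D" and M: "\<And>v. M *v v = dd (0, v) L x y"
  shows "det M = (F x y / B x y) ^ (CARD('n) + 1) * det (h x)"
proof -
  note p = pos[OF assms(1)] and hf = h_form[OF pos(4)[OF assms(1)]]
  define m where "m = B x y / F x y"
  have m: "m > 0" "F x y / B x y = 1 / m" using p by (simp_all add: m_def)
  \<comment> \<open>solves \<open>(1 - s / m)\<^sup>2 = m\<close>, so that \<open>h(q, q) - 2 s\<close>, the coefficient of \<open>ell\<close> squared, is \<open>m\<close>\<close>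
  define s where "s = m * (1 - sqrt m)"
  define e where "e = (1 / B x y) *\<^sub>R (y - F x y *\<^sub>R W x)"
  have he: "h x *v e = ell x y"
    using p(4) by (simp add: e_def ell_def matrix_vector_mult_scaleR matrix_vector_mult_diff_distrib h_W)
  define q where "q = W x + s *\<^sub>R e"
  have hq: "h x *v q = w x + s *\<^sub>R ell x y"
    using p(4) by (simp add: q_def matrix_vector_right_distrib matrix_vector_mult_scaleR h_W he)
  have le: "ell x y \<bullet> e = 1 / m\<^sup>2"
  proof -
    have "(h x *v y - F x y *\<^sub>R w x) \<bullet> (y - F x y *\<^sub>R W x) = A x y - 2 * F x y * B x y + (F x y)\<^sup>2"
      using hf[of "W x" y] w_W[OF p(4)]
      by (simp add: A_def B_def form_def inner_simps h_W[OF p(4)] inner_commute power2_eq_square)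
    also have "\<dots> = (F x y)\<^sup>2" by (simp add: A_eq[OF assms(1)])
    finally show ?thesis using p by (simp add: ell_def e_def m_def power2_eq_square)
  qed
  have we: "w x \<bullet> e = 1 - 1 / m"
    using p w_W[OF p(4)] by (simp add: e_def m_def inner_simps B_def[symmetric] field_simps)
  have lW: "ell x y \<bullet> W x = 1 - 1 / m"
    using hf[of "W x" e] h_W[OF p(4)] he we by (simp add: inner_commute)
  define T where "T = (\<chi> i j. (if i = j then 1 else 0) - q $ i * ell x y $ j)"
  have Tv: "T *v v = v - (ell x y \<bullet> v) *\<^sub>R q" for v
    by (simp add: T_def vec_eq_iff matrix_vector_mult_def inner_vec_def left_diff_distrib sum_subtractf
       if_distrib[where f="\<lambda>z. z * _"] mult.assoc flip: sum_distrib_left cong: if_cong)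
  have sm: "s / m = 1 - sqrt m" using m by (simp add: s_def)
  have ql: "q \<bullet> ell x y = 1 - 1 / sqrt m"
  proof -
    have "q \<bullet> ell x y = 1 - 1 / m + (s / m) / m"
      using lW le m by (simp add: q_def inner_simps inner_commute power2_eq_square)
    also have "\<dots> = 1 - sqrt m / m" unfolding sm by (simp add: diff_divide_distrib)
    also have "sqrt m / m = 1 / sqrt m" using m by (simp add: field_simps)
    finally show ?thesis .
  qed
  have qq: "q \<bullet> (h x *v q) - 2 * s = m"
  proof -
    have "q \<bullet> (h x *v q) = w x \<bullet> W x + s * (w x \<bullet> e) + s * (ell x y \<bullet> W x) + s\<^sup>2 * (ell x y \<bullet> e)"
      unfolding hq by (simp add: q_def inner_simps inner_commute power2_eq_square algebra_simps)
    hence "q \<bullet> (h x *v q) - 2 * s = 1 - 2 * (s / m) + (s / m)\<^sup>2"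
      unfolding we lW le w_W[OF p(4)] by (simp add: power_divide algebra_simps)
    also have "\<dots> = m" unfolding sm using m by (simp add: power2_eq_square algebra_simps)
    finally show ?thesis .
  qed
  have "form M u v = (1 / m) * form (h x) (T *v u) (T *v v)" for u v
  proof -
    have "form (h x) (T *v u) (T *v v) = u \<bullet> (h x *v v) - (ell x y \<bullet> v) * (u \<bullet> (h x *v q))
        - (ell x y \<bullet> u) * (v \<bullet> (h x *v q)) + (ell x y \<bullet> u) * (ell x y \<bullet> v) * (q \<bullet> (h x *v q))"
      unfolding Tv form_def using hf[of q v]
      by (simp add: matrix_vector_mult_diff_distrib matrix_vector_mult_scaleR inner_simps algebra_simps)
    also have "q \<bullet> (h x *v q) = m + 2 * s" using qq by simp
    also have "u \<bullet> (h x *v v) - (ell x y \<bullet> v) * (u \<bullet> (h x *v q)) - (ell x y \<bullet> u) * (v \<bullet> (h x *v q))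
        + (ell x y \<bullet> u) * (ell x y \<bullet> v) * (m + 2 * s) = m * (u \<bullet> (M *v v))"
      unfolding M dd_L_vertical[OF assms(1)] hq m(2) using m(1)
      by (simp add: inner_simps inner_commute algebra_simps)
    finally show ?thesis using m by (simp add: form_def)
  qed
  hence "det M = (1 / m) ^ CARD('n) * (det T)\<^sup>2 * det (h x)" by (rule det_congruence)
  also have "det T = 1 / sqrt m"
    unfolding T_def det_id_minus_rank_one ql by simp
  finally show ?thesis using m by (simp add: power_divide m(2))
qed

end

text \<open>The metric of the chart is only known to agree with \<open>F\<close> on its conic domain.\<close>

locale kropina_navigation = navigation U D V h hi w W
  for U :: "(real^'n::finite) set" and D V h hi w W +
  fixes Fm :: "real^'n \<Rightarrow> real^'n \<Rightarrow> real"
  assumes Fm: "(x, y) \<in> D \<Longrightarrow> Fm x y = F x y"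
begin

lemma pd_Fm_square:
  assumes "(x, y) \<in> D"
  shows "pd_y i (\<lambda>x y. (Fm x y)\<^sup>2) x y = 2 * L x y $ i"
    "pd_x i (\<lambda>x y. (Fm x y)\<^sup>2) x y = dd (axis i 1, 0) (\<lambda>x y. (F x y)\<^sup>2) x y"
proof -
  have "diff_at (\<lambda>x y. (Fm x y)\<^sup>2) x y"
    using diff_at_cong[OF open_D assms, of "\<lambda>x y. (Fm x y)\<^sup>2" "\<lambda>x y. (F x y)\<^sup>2"] Fm dd_F_square(2)[OF assms] by simp
  moreover have "dd e (\<lambda>x y. (Fm x y)\<^sup>2) x y = dd e (\<lambda>x y. (F x y)\<^sup>2) x y" for e
    by (rule dd_cong[OF open_D assms]) (simp add: Fm)
  ultimately show "pd_y i (\<lambda>x y. (Fm x y)\<^sup>2) x y = 2 * L x y $ i"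
    "pd_x i (\<lambda>x y. (Fm x y)\<^sup>2) x y = dd (axis i 1, 0) (\<lambda>x y. (F x y)\<^sup>2) x y"
    using pd_eq_dd[of "\<lambda>x y. (Fm x y)\<^sup>2" x y i] dd_F_square(1)[OF assms] dd_F_vertical[OF assms, of "axis i 1"]
    by (simp_all add: L_def inner_axis)
qed

lemma rat_L: "pf (\<lambda>x y. L x y $ i)"
  unfolding L_eq vector_scaleR_component vector_minus_component real_scaleR_def
  by (intro fibre_rational.mult pf_F pf_invB rat_diff rat_pf_mv rat_h rat_y rat_w)

lemma fundamental_tensor_mult:
  assumes "(x, y) \<in> D"
  shows "fundamental_tensor Fm x y *v v = dd (0, v) L x y"
proof -
  have dL: "diff_at (\<lambda>x y. 2 * L x y $ i) x y" "diff_at (\<lambda>x y. L x y $ i) x y" for i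
    using diff_at_pf[OF rat_L assms] by (simp_all add: diff_at_mult)
  have e: "fundamental_tensor Fm x y $ i $ j = dd (0, axis j 1) L x y $ i" for i j
  proof -
    have d: "diff_at (pd_y i (\<lambda>x y. (Fm x y)\<^sup>2)) x y"
      using diff_at_cong[OF open_D assms, of "pd_y i (\<lambda>x y. (Fm x y)\<^sup>2)" "\<lambda>x y. 2 * L x y $ i"] pd_Fm_square(1) dL by simp
    have "pd_y j (pd_y i (\<lambda>x y. (Fm x y)\<^sup>2)) x y = dd (0, axis j 1) (\<lambda>x y. 2 * L x y $ i) x y"
      unfolding pd_eq_dd(2)[OF d] by (rule dd_cong[OF open_D assms]) (rule pd_Fm_square(1))
    also have "\<dots> = 2 * dd (0, axis j 1) L x y $ i"
      by (simp add: dd_mult dL dd_component[OF diff_at_L[OF assms]])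
    finally show ?thesis by (simp add: fundamental_tensor_def)
  qed
  have "dd (0, v) L x y = (\<Sum>k\<in>UNIV. v $ k *\<^sub>R dd (0, axis k 1) L x y)"
    by (subst dd_split[OF diff_at_L[OF assms]]) simp
  thus ?thesis by (simp add: vec_eq_iff matrix_vector_mult_def e mult.commute)
qed

lemma det_fundamental_tensor:
  assumes "(x, y) \<in> D"
  shows "det (fundamental_tensor Fm x y) = (F x y / B x y) ^ (CARD('n) + 1) * det (h x)"
  by (rule metric_tensor_form[OF assms fundamental_tensor_mult[OF assms]])

lemma spray_coeff_eq:
  assumes "(x, y) \<in> D"
  shows "spray_coeff Fm i x y = (1/2) * G x y $ i"
proof -
  let ?g = "fundamental_tensor Fm x y"
  have "det ?g \<noteq> 0"
    unfolding det_fundamental_tensor[OF assms]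
    using pos[OF assms] measure_ellipsoid(1)[of "h x"] h_sym h_pos by force
  hence "invertible ?g" by (simp add: invertible_det_nz)
  hence "matrix_inv ?g ** ?g = mat 1"
    unfolding invertible_def matrix_inv_def by (rule someI2_ex) simp
  hence inv: "matrix_inv ?g *v (?g *v v) = v" for v by (simp add: matrix_vector_mul_assoc)
  have c: "(\<Sum>k\<in>UNIV. pd_y l (pd_x k (\<lambda>x y. (Fm x y)\<^sup>2)) x y * y $ k) - pd_x l (\<lambda>x y. (Fm x y)\<^sup>2) x y
      = 2 * (?g *v G x y) $ l" for l
  proof -
    let ?F2 = "\<lambda>x y. (F x y)\<^sup>2"
    have pF2: "pf ?F2" by (intro rat_power pf_F)
    have 1: "pd_y l (pd_x k (\<lambda>x y. (Fm x y)\<^sup>2)) x y = 2 * dd (axis k 1, 0) L x y $ l" for k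
    proof -
      have d: "diff_at (pd_x k (\<lambda>x y. (Fm x y)\<^sup>2)) x y"
        using diff_at_cong[OF open_D assms, of "pd_x k (\<lambda>x y. (Fm x y)\<^sup>2)" "dd (axis k 1, 0) ?F2"] pd_Fm_square(2)
          diff_at_pf[OF rat_dd[OF pF2] assms] by simp
      have "pd_y l (pd_x k (\<lambda>x y. (Fm x y)\<^sup>2)) x y = dd (0, axis l 1) (dd (axis k 1, 0) ?F2) x y"
        unfolding pd_eq_dd(2)[OF d] by (rule dd_cong[OF open_D assms]) (rule pd_Fm_square(2))
      also have "\<dots> = dd (axis k 1, 0) (dd (0, axis l 1) ?F2) x y"
        by (rule dd_commute[OF pF2 assms, symmetric])
      also have "\<dots> = dd (axis k 1, 0) (\<lambda>x y. 2 * L x y $ l) x y"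
      proof (rule dd_cong[OF open_D assms])
        fix x y assume "(x, y) \<in> D"
        thus "dd (0, axis l 1) ?F2 x y = 2 * L x y $ l"
          by (simp add: dd_F_square dd_F_vertical L_def inner_axis)
      qed
      also have "\<dots> = 2 * dd (axis k 1, 0) L x y $ l"
        by (simp add: dd_mult diff_at_component diff_at_L[OF assms] dd_component)
      finally show ?thesis .
    qed
    have "(\<Sum>k\<in>UNIV. dd (axis k 1, 0) L x y $ l * y $ k) = dd (y, 0) L x y $ l"
      by (subst (2) dd_split[OF diff_at_L[OF assms]]) (simp add: mult.commute)
    also have "(y, 0) = (y, - G x y) + (0, G x y)" by simp
    also have "dd \<dots> L x y $ l = (1/2) * dd (axis l 1, 0) ?F2 x y + (?g *v G x y) $ l"
      unfolding dd_linear(1)[OF diff_at_L[OF assms]]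
      by (simp add: DG_L[OF assms] fundamental_tensor_mult[OF assms])
    finally show ?thesis
      unfolding 1 pd_Fm_square(2)[OF assms]
      by (simp add: sum_distrib_left mult.assoc flip: sum_distrib_left)
  qed
  have "spray_coeff Fm i x y = 1/4 * (matrix_inv ?g *v (2 *\<^sub>R (?g *v G x y))) $ i"
    unfolding spray_coeff_def c by (simp add: matrix_vector_mult_def)
  thus ?thesis by (simp add: matrix_vector_mult_scaleR inv)
qed

end

section \<open>Geodesics and S-curvature\<close>

context fibre_domain begin

lemma rat_continuous_on:
  assumes "rat S H"
  shows "continuous_on D (\<lambda>z. H (fst z) (snd z))"
proof (intro differentiable_imp_continuous_on differentiable_at_imp_differentiable_on)
  fix z assume "z \<in> D"
  thus "(\<lambda>z. H (fst z) (snd z)) differentiable (at z)"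
    using rat_diff_at[OF assms, of "fst z" "snd z"] by (simp add: diff_at_def)
qed

lemma rat_lipschitz_on_ball:
  assumes H: "rat S H" and sub: "cball z0 \<delta> \<subseteq> D"
  obtains L where "\<And>u v. u \<in> cball z0 \<delta> \<Longrightarrow> v \<in> cball z0 \<delta> \<Longrightarrow>
    \<bar>H (fst u) (snd u) - H (fst v) (snd v)\<bar> \<le> L * norm (u - v)"
proof -
  let ?X = "\<lambda>k. dd (axis k (1::real), 0) H" and ?Y = "\<lambda>k. dd (0, axis k (1::real)) H"
  define K where "K = (\<lambda>z. \<Sum>k\<in>UNIV. \<bar>?X k (fst z) (snd z)\<bar> + \<bar>?Y k (fst z) (snd z)\<bar>)"
  have "continuous_on (cball z0 \<delta>) K"
    unfolding K_def by (intro continuous_intros continuous_on_subset[OF rat_continuous_on[OF rat_dd[OF H]] sub])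
  hence "bounded (K ` cball z0 \<delta>)" by (intro compact_imp_bounded compact_continuous_image) auto
  then obtain M where M: "\<And>z. z \<in> cball z0 \<delta> \<Longrightarrow> K z \<le> M"
    unfolding bounded_iff by (metis abs_le_D1 imageI real_norm_def)
  have on: "onorm (\<lambda>e. dd e H (fst z) (snd z)) \<le> M" if z: "z \<in> cball z0 \<delta>" for z
  proof (rule onorm_le)
    fix e :: "(real^'n) \<times> (real^'n)"
    obtain u v where e: "e = (u, v)" by (cases e)
    have d: "diff_at H (fst z) (snd z)" using rat_diff_at[OF H, of "fst z" "snd z"] z sub by auto
    have n: "norm u \<le> norm e" "norm v \<le> norm e" by (simp_all add: e norm_Pair)
    have "\<bar>dd e H (fst z) (snd z)\<bar> \<le> (\<Sum>k\<in>UNIV. \<bar>u $ k * ?X k (fst z) (snd z)\<bar>) + (\<Sum>k\<in>UNIV. \<bar>v $ k * ?Y k (fst z) (snd z)\<bar>)"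
      unfolding e
      by (subst dd_split[OF d], unfold real_scaleR_def) (intro order_trans[OF abs_triangle_ineq] add_mono sum_abs)
    also have "\<dots> \<le> (\<Sum>k\<in>UNIV. norm e * \<bar>?X k (fst z) (snd z)\<bar>) + (\<Sum>k\<in>UNIV. norm e * \<bar>?Y k (fst z) (snd z)\<bar>)"
      unfolding abs_mult
      by (intro add_mono sum_mono mult_right_mono order_trans[OF component_le_norm_cart] n abs_ge_zero)
    also have "\<dots> = norm e * K z" by (simp add: K_def sum.distrib sum_distrib_left distrib_left)
    also have "\<dots> \<le> norm e * M" by (intro mult_left_mono M z) simp
    finally show "norm (dd e H (fst z) (snd z)) \<le> M * norm e" by (simp add: mult.commute)
  qed
  show thesis
  proof (rule that)
    fix u v assume "u \<in> cball z0 \<delta>" "v \<in> cball z0 \<delta>"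
    hence "norm (H (fst u) (snd u) - H (fst v) (snd v)) \<le> M * norm (u - v)"
    proof (intro differentiable_bound[of "cball z0 \<delta>" "\<lambda>z. H (fst z) (snd z)" "\<lambda>z e. dd e H (fst z) (snd z)"] on)
      fix z assume "z \<in> cball z0 \<delta>"
      hence "(fst z, snd z) \<in> D" using sub by auto
      from has_derivative_at_withinI[OF diff_atD[OF rat_diff_at[OF H this]]]
      show "((\<lambda>z. H (fst z) (snd z)) has_derivative (\<lambda>e. dd e H (fst z) (snd z))) (at z within cball z0 \<delta>)"
        by simp
    qed auto
    thus "\<bar>H (fst u) (snd u) - H (fst v) (snd v)\<bar> \<le> M * norm (u - v)" by simp
  qed
qed

end

context kropina_navigation begin

text \<open>Without this, the geodesic chosen in the definition of the S-curvature would be arbitrary.\<close>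

lemma geodesic_exists:
  assumes xy: "(x, y) \<in> D"
  shows "\<exists>c. c 0 = x \<and> velocity c 0 = y \<and> (\<exists>\<epsilon>>0. geodesic_on D Fm {-\<epsilon><..<\<epsilon>} c)"
proof -
  obtain \<delta> where \<delta>: "\<delta> > 0" "cball (x, y) \<delta> \<subseteq> D"
    using open_contains_cball[THEN iffD1, OF open_D] xy by blast
  define X where "X z = (snd z, - G (fst z) (snd z))" for z
  have "\<exists>L. \<forall>i. \<forall>u\<in>cball (x, y) \<delta>. \<forall>v\<in>cball (x, y) \<delta>.
      \<bar>G (fst u) (snd u) $ i - G (fst v) (snd v) $ i\<bar> \<le> L i * norm (u - v)"
    by (rule choice) (metis rat_lipschitz_on_ball[OF smth_G \<delta>(2)])
  then obtain L where L: "\<And>i u v. u \<in> cball (x, y) \<delta> \<Longrightarrow> v \<in> cball (x, y) \<delta> \<Longrightarrow>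
      \<bar>G (fst u) (snd u) $ i - G (fst v) (snd v) $ i\<bar> \<le> L i * norm (u - v)" by blast
  have "dist (X u) (X v) \<le> (1 + sum L UNIV) * dist u v" if "u \<in> cball (x, y) \<delta>" "v \<in> cball (x, y) \<delta>" for u v
  proof -
    have "dist (X u) (X v) \<le> norm (snd u - snd v) + norm (G (fst u) (snd u) - G (fst v) (snd v))"
      unfolding dist_norm X_def using norm_Pair_le[of "snd u - snd v" "- G (fst u) (snd u) + G (fst v) (snd v)"]
      by (simp add: norm_minus_commute)
    also have "norm (snd u - snd v) \<le> norm (u - v)" using norm_snd_le[of "snd u - snd v" "fst u - fst v"] by (simp add: minus_prod_def)
    also have "norm (G (fst u) (snd u) - G (fst v) (snd v)) \<le> (\<Sum>i\<in>UNIV. L i * norm (u - v))"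
      by (rule order_trans[OF norm_le_l1_cart]) (intro sum_mono, simp add: L that del: mem_cball)
    finally show ?thesis by (simp add: dist_norm algebra_simps sum_distrib_right)
  qed
  from ode_local_existence[OF \<delta>(1) this] obtain \<epsilon> u where u: "\<epsilon> > 0" "u 0 = (x, y)"
    "\<And>t. t \<in> {-\<epsilon><..<\<epsilon>} \<Longrightarrow> u t \<in> cball (x, y) \<delta> \<and> (u has_vector_derivative X (u t)) (at t)" by metis
  define c where "c = (\<lambda>t. fst (u t))"
  have du: "(u has_derivative (\<lambda>s. s *\<^sub>R X (u t))) (at t)" if "t \<in> {-\<epsilon><..<\<epsilon>}" for t
    using u(3)[OF that] by (simp add: has_vector_derivative_def)
  have c: "(c has_vector_derivative snd (u t)) (at t)"
    and c': "((\<lambda>t. snd (u t)) has_vector_derivative - G (c t) (snd (u t))) (at t)" if "t \<in> {-\<epsilon><..<\<epsilon>}" for t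
    unfolding has_vector_derivative_def c_def
    using has_derivative_fst[OF du[OF that]] has_derivative_snd[OF du[OF that]] by (simp_all add: X_def)
  have v: "velocity c t = snd (u t)" if "t \<in> {-\<epsilon><..<\<epsilon>}" for t
    unfolding velocity_def by (rule vector_derivative_at[OF c[OF that]])
  have D: "(c t, velocity c t) \<in> D" if "t \<in> {-\<epsilon><..<\<epsilon>}" for t
  proof -
    have "(c t, velocity c t) = u t" by (subst v[OF that]) (simp add: c_def)
    thus ?thesis using u(3)[OF that] \<delta>(2) by auto
  qed
  have "geodesic_on D Fm {-\<epsilon><..<\<epsilon>} c"
    unfolding geodesic_on_def
  proof (intro ballI conjI)
    fix t assume t: "t \<in> {-\<epsilon><..<\<epsilon>}"
    show "(c t, velocity c t) \<in> D" by (rule D[OF t])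
    show "(c has_vector_derivative velocity c t) (at t)" using c[OF t] v[OF t] by simp
    have "(\<chi> i. - 2 * spray_coeff Fm i (c t) (velocity c t)) = - G (c t) (snd (u t))"
      unfolding v[OF t] using spray_coeff_eq[OF D[OF t], unfolded v[OF t]] by (simp add: vec_eq_iff mult.commute)
    moreover have "(velocity c has_vector_derivative - G (c t) (snd (u t))) (at t)"
      by (rule has_vector_derivative_transform_within_open[OF c'[OF t], of "{-\<epsilon><..<\<epsilon>}"]) (use t v in auto)
    ultimately show "(velocity c has_vector_derivative (\<chi> i. - 2 * spray_coeff Fm i (c t) (velocity c t))) (at t)"
      by simp
  qed
  moreover have "c 0 = x" "velocity c 0 = y" using u(1,2) v[of 0] by (auto simp: c_def)
  ultimately show ?thesis using u(1) by blast
qed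

text \<open>By the chain rule the derivative at time \<open>0\<close> only depends on the initial data, so uniqueness of
geodesics is not needed.\<close>

lemma deriv_along_geodesic:
  assumes xy: "(x, y) \<in> D" and H: "diff_at H x y" and K: "\<And>x y. (x, y) \<in> D \<Longrightarrow> K x y = H x y"
  shows "(let c = geodesic_from D Fm x y in deriv (\<lambda>t. K (c t) (velocity c t)) 0) = DG H x y"
proof -
  define c where "c = geodesic_from D Fm x y"
  have "c 0 = x \<and> velocity c 0 = y \<and> (\<exists>\<epsilon>>0. geodesic_on D Fm {-\<epsilon><..<\<epsilon>} c)"
    unfolding c_def geodesic_from_def by (rule someI_ex[OF geodesic_exists[OF xy]])
  then obtain \<epsilon> where c: "c 0 = x" "velocity c 0 = y" "\<epsilon> > 0" "geodesic_on D Fm {-\<epsilon><..<\<epsilon>} c" by blast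
  have 0: "0 \<in> {-\<epsilon><..<\<epsilon>}" using c(3) by simp
  have "(\<chi> i. - 2 * spray_coeff Fm i x y) = - G x y"
    by (simp add: spray_coeff_eq[OF xy] vec_eq_iff)
  hence "(c has_vector_derivative y) (at 0)" "(velocity c has_vector_derivative - G x y) (at 0)"
    using c(4) 0 c(1,2) unfolding geodesic_on_def by (metis, metis)
  hence "((\<lambda>t. H (c t) (velocity c t)) has_vector_derivative dd (y, - G x y) H x y) (at 0)"
    using dd_along_curve[of H c 0 "velocity c" y "- G x y"] H c(1,2) by simp
  hence "((\<lambda>t. K (c t) (velocity c t)) has_vector_derivative dd (y, - G x y) H x y) (at 0)"
    by (rule has_vector_derivative_transform_within_open[of _ _ _ "{-\<epsilon><..<\<epsilon>}"])
      (use 0 K c(4) in \<open>auto simp: geodesic_on_def\<close>)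
  hence "deriv (\<lambda>t. K (c t) (velocity c t)) 0 = dd (y, - G x y) H x y"
    by (intro DERIV_imp_deriv) (simp add: has_real_derivative_iff_has_vector_derivative)
  thus ?thesis by (simp add: c_def Let_def)
qed

end

text \<open>The square root of \<open>det h\<close> is the Busemann-Hausdorff density, so the density \<open>\<rho>\<close> is the one of the
weighted volume form; \<open>N\<close> stands for \<open>n + 1\<close>.\<close>

locale weighted_kropina = kropina_navigation U D V h hi w W Fm
  for U :: "(real^'n::finite) set" and D V h hi w W Fm +
  fixes f \<rho> :: "real^'n \<Rightarrow> real" and N :: real
  assumes f_smooth: "smooth_on U f"
    and N: "N = real CARD('n) + 1"
    and \<rho>: "x \<in> V \<Longrightarrow> \<rho> x = exp (- N * f x) * sqrt (det (h x))"
begin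

text \<open>The differential of the weight, and the S-curvature of the weighted volume form.\<close>

definition f0 where "f0 x y = dd (y, 0) (\<lambda>x y. f x) x y"
definition S where "S x y = N * (f0 x y - \<kappa> x y / 2)"

lemma pf_f: "pf (\<lambda>x y. f x)" by (rule fibre_rational.base[OF f_smooth])

lemma pf_f0: "pf f0"
  unfolding f0_def[abs_def] by (intro rat_dd_moving pf_f rat_y) simp

lemma smth_S: "smth S"
proof -
  have "smth (\<lambda>x y. N * (f0 x y - \<kappa> x y * (1 / 2)))"
    by (intro fibre_rational.mult rat_const rat_diff smth_\<kappa> pf_smth[OF pf_f0])
  thus ?thesis by (simp add: S_def[abs_def])
qed

lemma distortion_eq:
  assumes "(x, y) \<in> D"
  shows "distortion Fm \<rho> x y = N / 2 * ln (F x y * inverse (B x y)) + N * f x"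
proof -
  note p = pos[OF assms]
  have dh: "det (h x) > 0" using measure_ellipsoid(1)[OF h_sym h_pos] p(4) by blast
  define m where "m = F x y * inverse (B x y)"
  have m: "m > 0" "F x y / B x y = m" using p by (simp_all add: m_def divide_inverse)
  have "sqrt (det (fundamental_tensor Fm x y)) / \<rho> x = sqrt (m ^ (CARD('n) + 1)) * exp (N * f x)"
    unfolding det_fundamental_tensor[OF assms] \<rho>[OF p(4)] m(2) using dh
    by (simp add: real_sqrt_mult exp_minus field_simps exp_add[symmetric])
  also have "ln \<dots> = ln (sqrt (m ^ (CARD('n) + 1))) + N * f x"
    using m by (simp add: ln_mult)
  also have "ln (sqrt (m ^ (CARD('n) + 1))) = N / 2 * ln m"
    using m by (simp add: ln_sqrt ln_realpow N del: power_Suc)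
  finally show ?thesis unfolding distortion_def m_def .
qed

lemma S_curvature_eq:
  assumes "(x, y) \<in> D"
  shows "S_curvature D Fm \<rho> x y = S x y"
proof -
  note p = pos[OF assms]
  let ?m = "\<lambda>x y. F x y * inverse (B x y)"
  note d = diff_at_pf[OF pf_F assms] diff_at_pf[OF pf_B assms] diff_at_pf[OF pf_f assms]
  have m: "?m x y > 0" using p by simp
  have dm: "diff_at ?m x y" "DG ?m x y = - \<kappa> x y * ?m x y"
    using p by (auto simp: dd_mult diff_at_mult d dd_inverse DG_F[OF assms] DG_B[OF assms] power2_eq_square)
  have l: "diff_at (\<lambda>x y. ln (?m x y)) x y" "dd e (\<lambda>x y. ln (?m x y)) x y = dd e ?m x y * inverse (?m x y)" for e
    using diff_atI[of "\<lambda>x y. ln (?m x y)", OF has_derivative_ln[OF _ diff_atD[OF dm(1)]]] m by (auto simp: divide_inverse)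
  have df: "DG (\<lambda>x y. f x) x y = f0 x y"
    unfolding f0_def diff_at_base(2)[OF d(3)] by simp
  have "S_curvature D Fm \<rho> x y = DG (\<lambda>x y. N / 2 * ln (?m x y) + N * f x) x y"
    unfolding S_curvature_def
    by (rule deriv_along_geodesic[OF assms _ distortion_eq]) (intro diff_at_add diff_at_mult d l dd_const; assumption)
  also have "\<dots> = N / 2 * (DG ?m x y * inverse (?m x y)) + N * f0 x y"
  proof -
    have "DG (\<lambda>x y. N / 2 * ln (?m x y) + N * f x) x y = DG (\<lambda>x y. N / 2 * ln (?m x y)) x y + DG (\<lambda>x y. N * f x) x y"
      by (intro dd_add diff_at_mult dd_const d l(1))
    thus ?thesis unfolding dd_cmult[OF l(1)] dd_cmult[OF d(3)] df l(2) .
  qed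
  also have "\<dots> = S x y"
    unfolding dm(2) using m p by (simp add: S_def field_simps)
  finally show ?thesis .
qed

lemma S_dot_eq:
  assumes "(x, y) \<in> D"
  shows "S_dot D Fm \<rho> x y = DG S x y"
  unfolding S_dot_def
  by (rule deriv_along_geodesic[OF assms rat_diff_at[OF smth_S assms] S_curvature_eq])

end

section \<open>The pole along the null cone\<close>

lemma dd_euler_of_homogeneous:
  fixes H :: "real^'n::finite \<Rightarrow> real^'n \<Rightarrow> real"
  assumes d: "diff_at H x y" and hom: "\<And>s. s > 0 \<Longrightarrow> H x (s *\<^sub>R y) = s ^ k * H x y"
  shows "dd (0, y) H x y = real k * H x y"
proof -
  have "((\<lambda>t. H x (t *\<^sub>R y)) has_vector_derivative dd (0, y) H x y) (at 1)"
  proof -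
    have "((\<lambda>t. t *\<^sub>R y) has_vector_derivative y) (at 1)" by (auto intro!: derivative_eq_intros)
    thus ?thesis using dd_along_curve[of H "\<lambda>t. x" 1 "\<lambda>t. t *\<^sub>R y" 0 y] d by simp
  qed
  hence "((\<lambda>t. t ^ k * H x y) has_vector_derivative dd (0, y) H x y) (at 1)"
    by (rule has_vector_derivative_transform_within_open[where S="{0<..}"]) (auto simp: hom)
  moreover have "((\<lambda>t. t ^ k * H x y) has_vector_derivative real k * H x y) (at 1)"
    unfolding has_real_derivative_iff_has_vector_derivative[symmetric]
    by (auto intro!: derivative_eq_intros)
  ultimately show ?thesis by (rule vector_derivative_unique_at)
qed

context navigation begin

lemma homogeneity:
  assumes "x \<in> V" "s > 0"
  shows "F x (s *\<^sub>R y) = s * F x y" "Z x (s *\<^sub>R y) = s *\<^sub>R Z x y" "r x (s *\<^sub>R y) = s\<^sup>2 * r x y"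
    "z x (s *\<^sub>R y) = s * z x y" "G0 x (s *\<^sub>R y) = s\<^sup>2 *\<^sub>R G0 x y" "\<kappa> x (s *\<^sub>R y) = s * \<kappa> x y"
proof -
  note lh = linear_cmul[OF linear_D(1)[OF assms(1)]] and lw = linear_cmul[OF linear_D(2)[OF assms(1)]]
  note ms = matrix_vector_mult_scaleR scaleR_matrix_vector_assoc[symmetric]
  show F: "F x (s *\<^sub>R y) = s * F x y"
    using assms(2) by (simp add: F_def A_def B_def form_simps)
  show Z: "Z x (s *\<^sub>R y) = s *\<^sub>R Z x y"
    by (simp add: Z_def lw vec_eq_iff algebra_simps)
  show r: "r x (s *\<^sub>R y) = s\<^sup>2 * r x y"
    by (simp add: r_def lh lw ms power2_eq_square algebra_simps)
  show z: "z x (s *\<^sub>R y) = s * z x y"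
    by (simp add: z_def Z)
  have "grad_h x (s *\<^sub>R y) = s\<^sup>2 *\<^sub>R grad_h x y"
    by (simp add: grad_h_def vec_eq_iff ms power2_eq_square)
  hence "hG x (s *\<^sub>R y) = s\<^sup>2 *\<^sub>R hG x y"
    by (simp add: hG_def lh ms matrix_vector_mult_diff_distrib power2_eq_square algebra_simps)
  thus "G0 x (s *\<^sub>R y) = s\<^sup>2 *\<^sub>R G0 x y"
    by (simp add: G0_def F Z r z ms power2_eq_square algebra_simps)
  show "\<kappa> x (s *\<^sub>R y) = s * \<kappa> x y"
    using assms(2) by (simp add: \<kappa>_def F r z power2_eq_square field_simps)
qed

text \<open>The symmetric bilinear form of the quadratic form \<open>r\<close>.\<close>

definition r_polar where
  "r_polar x u v = (Dw x u \<bullet> v + Dw x v \<bullet> u - W x \<bullet> (Dh x u *v v + Dh x v *v u) + u \<bullet> (Dh x (W x) *v v)) / 2"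

lemma r_eq_polar: "r x y = r_polar x y y"
  unfolding r_def r_polar_def inner_add_right by (simp add: field_simps)

lemma r_polar_bilinear:
  assumes "x \<in> V"
  shows "r_polar x (u + u') v = r_polar x u v + r_polar x u' v" "r_polar x u (v + v') = r_polar x u v + r_polar x u v'"
    "r_polar x (s *\<^sub>R u) v = s * r_polar x u v" "r_polar x u (s *\<^sub>R v) = s * r_polar x u v" "r_polar x u v = r_polar x v u"
proof -
  note l = linear_add[OF linear_D(1)[OF assms]] linear_add[OF linear_D(2)[OF assms]]
    linear_cmul[OF linear_D(1)[OF assms]] linear_cmul[OF linear_D(2)[OF assms]]
    matrix_vector_mult_scaleR scaleR_matrix_vector_assoc[symmetric] matrix_vector_mult_add_rdistrib matrix_vector_right_distrib
  show "r_polar x (u + u') v = r_polar x u v + r_polar x u' v" "r_polar x u (v + v') = r_polar x u v + r_polar x u v'"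
    "r_polar x (s *\<^sub>R u) v = s * r_polar x u v" "r_polar x u (s *\<^sub>R v) = s * r_polar x u v"
    by (simp_all add: r_polar_def l inner_simps field_simps)
  show "r_polar x u v = r_polar x v u"
    using Dh_sym[OF assms, of u "W x" v] by (simp add: r_polar_def inner_simps)
qed

text \<open>Because \<open>W\<close> has constant length, only the antisymmetric part of the derivative of \<open>w\<close> remains
in \<open>r(W, v)\<close>.\<close>

lemma r_polar_W:
  assumes x: "x \<in> V"
  shows "r_polar x (W x) v = - z x v / 2"
proof -
  note D = W_in_D[OF x]
  note d = diff_at_base_fields[OF D]
  have wW: "Dw x e \<bullet> W x + w x \<bullet> DW x e = 0" for e
  proof -
    have "dd (e, 0) (\<lambda>x y. w x \<bullet> W x) x (W x) = dd (e, 0) (\<lambda>x y. 1::real) x (W x)"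
      by (rule dd_cong[OF open_D D]) (use w_W pos(4) in blast)
    thus ?thesis
      by (simp add: dd_bilinear(1)[OF bounded_bilinear_inner] d dd_base_fields[OF D])
  qed
  have hW: "Dh x e *v W x + h x *v DW x e = Dw x e" for e
  proof -
    have "dd (e, 0) (\<lambda>x y. h x *v W x) x (W x) = dd (e, 0) (\<lambda>x y. w x) x (W x)"
      by (rule dd_cong[OF open_D D]) (use h_W pos(4) in blast)
    thus ?thesis
      by (simp add: dd_bilinear(1)[OF bounded_bilinear_matrix_vector_mult] d dd_base_fields[OF D])
  qed
  have "W x \<bullet> (Dh x e *v W x) = 2 * (Dw x e \<bullet> W x)" for e
  proof -
    have "W x \<bullet> Dw x e = W x \<bullet> (Dh x e *v W x) + W x \<bullet> (h x *v DW x e)"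
      unfolding hW[symmetric] by (simp add: inner_simps)
    moreover have "W x \<bullet> (h x *v DW x e) = w x \<bullet> DW x e"
      using w_inner[OF x, of "DW x e"] h_form[OF x] by simp
    ultimately show ?thesis using wW[of e] by (simp add: inner_commute)
  qed
  thus ?thesis
    using Dh_sym[OF x] inner_Z(2)[OF x, of v]
    by (simp add: r_polar_def inner_simps)
qed

lemma r_polar_W_W: "x \<in> V \<Longrightarrow> r_polar x (W x) (W x) = 0"
  using r_polar_W[of x "W x"] inner_Z(2)[of x "W x"] by simp

end

text \<open>The polynomial \<open>2 e t + c t\<^sup>2\<close> vanishes at the complex roots of \<open>1 + m t\<^sup>2\<close> only if it is zero. The proof
compares coefficients.\<close>

lemma square_divisible_by_definite_quadratic:
  fixes p :: "real poly"
  assumes m: "m > 0" and eq: "\<And>t. \<nu> * (2 * e * t + c * t\<^sup>2)\<^sup>2 = (1 + m * t\<^sup>2) * poly p t" and \<nu>: "\<nu> \<noteq> 0"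
  shows "e = 0 \<and> c = 0"
proof -
  let ?q = "[:0, 0, \<nu> * 4 * e\<^sup>2, \<nu> * 4 * e * c, \<nu> * c\<^sup>2:]" and ?m = "[:1, 0, m:]"
  have qp: "?q = ?m * p"
    by (rule poly_ext) (use eq in \<open>simp add: algebra_simps power2_eq_square\<close>)
  have "degree p \<le> 2"
  proof (cases "p = 0")
    case False
    have "degree ?m + degree p = degree ?q"
      unfolding qp by (rule degree_mult_eq[symmetric]) (use False in auto)
    moreover have "degree ?q \<le> 4" by (intro degree_le) (auto simp: coeff_pCons split: nat.split)
    moreover have "degree ?m = 2" using m by simp
    ultimately show ?thesis by simp
  qed simp
  hence p: "p = [:coeff p 0, coeff p 1, coeff p 2:]"
    by (intro poly_eqI) (auto simp: coeff_pCons coeff_eq_0 numeral_2_eq_2 split: nat.split)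
  have "?q = [:coeff p 0, coeff p 1, coeff p 2 + m * coeff p 0, m * coeff p 1, m * coeff p 2:]"
    unfolding qp by (subst p) simp
  hence q: "coeff p 0 = 0" "coeff p 1 = 0" "\<nu> * 4 * e\<^sup>2 = coeff p 2 + m * coeff p 0"
    "\<nu> * 4 * e * c = m * coeff p 1" "\<nu> * c\<^sup>2 = m * coeff p 2"
    by (simp_all only: pCons_eq_iff)
  hence ec: "e = 0 \<or> c = 0" using \<nu> by simp
  have "\<nu> * c\<^sup>2 = m * (\<nu> * 4 * e\<^sup>2)" using q by simp
  hence "c\<^sup>2 = 4 * m * e\<^sup>2" using \<nu> by simp
  thus ?thesis using ec m by auto
qed

context weighted_kropina begin

text \<open>The derivative along the geodesic spray of a homogeneous function differs from the derivative
  along the pole-free spray \<open>G0\<close> by a multiple of \<open>\<kappa>\<close>.\<close>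

lemma DG_homogeneous:
  assumes "(x, y) \<in> D" "diff_at H x y" "\<And>s. s > 0 \<Longrightarrow> H x (s *\<^sub>R y) = s ^ k * H x y"
  shows "DG H x y = dd (y, - G0 x y) H x y + k * \<kappa> x y * H x y"
proof -
  have e: "(y, - G x y) = (y, - G0 x y) + \<kappa> x y *\<^sub>R (0, y)" by (simp add: G_def)
  show ?thesis
    unfolding e dd_linear(1,2)[OF assms(2)] using dd_euler_of_homogeneous[OF assms(2,3)] by simp
qed

lemma f0_homogeneous: "(x, y) \<in> D \<Longrightarrow> s > 0 \<Longrightarrow> f0 x (s *\<^sub>R y) = s * f0 x y"
proof -
  assume a: "(x, y) \<in> D" "s > 0"
  hence a': "(x, s *\<^sub>R y) \<in> D" by (simp add: D_iff)
  note d = diff_at_pf[OF pf_f a(1)]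
  have "linear (\<lambda>e. frechet_derivative f (at x) e)" by (rule has_derivative_linear[OF diff_at_base(1)[OF d]])
  thus ?thesis
    unfolding f0_def diff_at_base(2)[OF d] diff_at_base(2)[OF diff_at_pf[OF pf_f a']] by (simp add: linear_cmul)
qed

text \<open>The derivative along the pole-free spray.\<close>

abbreviation D0 where "D0 H x y \<equiv> dd (y, - G0 x y) H x y"

lemma pf_D0: "pf H \<Longrightarrow> pf (\<lambda>x y. D0 H x y)"
  by (rule rat_dd_moving) (auto intro!: rat_y rat_minus pf_G0)

lemma DG_\<kappa>:
  assumes xy: "(x, y) \<in> D"
  shows "DG \<kappa> x y = (D0 r x y + 2 * \<kappa> x y * r x y) / F x y + D0 z x y + \<kappa> x y * z x y"
proof -
  note p = pos[OF xy]
  note d = diff_at_pf[OF pf_F xy] diff_at_pf[OF pf_r xy] diff_at_pf[OF pf_z xy]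
  have k: "\<kappa> = (\<lambda>x y. r x y * inverse (F x y) + z x y)" by (intro ext) (simp add: \<kappa>_def divide_inverse)
  have "DG \<kappa> x y = DG (\<lambda>x y. r x y * inverse (F x y)) x y + DG z x y"
    unfolding k by (intro dd_add diff_at_mult d dd_inverse) (use p in simp)
  also have "DG (\<lambda>x y. r x y * inverse (F x y)) x y = DG r x y * inverse (F x y) + r x y * DG (\<lambda>x y. inverse (F x y)) x y"
    by (intro dd_mult d dd_inverse) (use p in simp)
  also have "DG (\<lambda>x y. inverse (F x y)) x y = 0"
    using p by (simp add: dd_inverse d DG_F[OF xy])
  also have "DG r x y = D0 r x y + 2 * \<kappa> x y * r x y"
    using DG_homogeneous[OF xy d(2), where k=2] homogeneity(3)[OF p(4)] by simp
  also have "DG z x y = D0 z x y + \<kappa> x y * z x y"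
    using DG_homogeneous[OF xy d(3), where k=1] homogeneity(4)[OF p(4)] by simp
  finally show ?thesis by (simp add: divide_inverse)
qed

text \<open>The Ricci curvature of the pole-free spray.\<close>

definition Ric0 where "Ric0 = spray_ricci (\<lambda>i x y. G0 x y $ i / 2)"

lemma pf_Ric0: "pf Ric0"
  unfolding Ric0_def by (rule rat_spray_ricci) (use fibre_rational.mult[OF pf_G0 rat_const[of _ "1/2"]] in simp)

lemma ricci_eq:
  assumes xy: "(x, y) \<in> D"
  shows "ricci_curvature Fm x y = Ric0 x y - (N - 2) * ((\<kappa> x y)\<^sup>2 / 4 - DG \<kappa> x y / 2)"
proof -
  let ?G = "\<lambda>i x y. G0 x y $ i / 2 + (- \<kappa> x y / 2) * y $ i"
  have sG: "smth (\<lambda>x y. G0 x y $ i / 2)" for i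
    using fibre_rational.mult[OF pf_smth[OF pf_G0] rat_const[of _ "1/2"]] by simp
  have sk: "smth (\<lambda>x y. - \<kappa> x y / 2)"
    using fibre_rational.mult[OF smth_\<kappa> rat_const[of _ "-1/2"]] by simp
  note dk = rat_diff_at[OF smth_\<kappa>]
  have "ricci_curvature Fm x y = spray_ricci ?G x y"
  proof (rule ricci_curvature_eq[OF _ _ xy])
    show "smth (?G i)" for i
      by (intro fibre_rational.add fibre_rational.mult sG sk fibre_rational.coord)
    show "spray_coeff Fm i x y = ?G i x y" if "(x, y) \<in> D" for i x y
      by (simp add: spray_coeff_eq[OF that] G_def diff_divide_distrib)
  qed
  also have "\<dots> = spray_ricci (\<lambda>i x y. G0 x y $ i / 2) x y - (real CARD('n) - 1) *
      ((- \<kappa> x y / 2)\<^sup>2 + dd (y, - 2 *\<^sub>R (\<chi> j. ?G j x y)) (\<lambda>x y. - \<kappa> x y / 2) x y)"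
  proof (rule spray_ricci_projective_change[OF sG sk _ _ refl xy])
    fix i x y assume xy: "(x, y) \<in> D"
    show "dd (0, y) (\<lambda>x y. G0 x y $ i / 2) x y = 2 * (G0 x y $ i / 2)"
      using dd_euler_of_homogeneous[OF rat_diff_at[OF sG xy], where k=2] homogeneity(5)[OF pos(4)[OF xy]] by simp
    show "dd (0, y) (\<lambda>x y. - \<kappa> x y / 2) x y = - \<kappa> x y / 2"
      using dd_euler_of_homogeneous[OF rat_diff_at[OF sk xy], where k=1] homogeneity(6)[OF pos(4)[OF xy]] by simp
  qed
  also have "- 2 *\<^sub>R (\<chi> j. ?G j x y) = - G x y"
    by (simp add: G_def vec_eq_iff algebra_simps)
  also have "DG (\<lambda>x y. - \<kappa> x y / 2) x y = - DG \<kappa> x y / 2"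
    using dd_cmult[OF dk[OF xy], of _ "-1/2"] by simp
  finally show ?thesis by (simp add: Ric0_def N power_divide)
qed

lemma DG_S:
  assumes xy: "(x, y) \<in> D"
  shows "DG S x y = N * (D0 f0 x y + \<kappa> x y * f0 x y - DG \<kappa> x y / 2)"
proof -
  note p = pos[OF xy]
  note d = diff_at_pf[OF pf_f0 xy] rat_diff_at[OF smth_\<kappa> xy]
  have "S = (\<lambda>x y. N * f0 x y + (- N / 2) * \<kappa> x y)" by (intro ext) (simp add: S_def algebra_simps)
  hence "DG S x y = N * DG f0 x y + (- N / 2) * DG \<kappa> x y"
    using d by (simp only: dd_add diff_at_mult dd_const dd_cmult)
  also have "DG f0 x y = D0 f0 x y + \<kappa> x y * f0 x y"
    using DG_homogeneous[OF xy d(1), where k=1] f0_homogeneous[OF xy] by simp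
  finally show ?thesis by (simp add: algebra_simps)
qed

text \<open>Since \<open>1 / F = 2 B / A\<close>, this is the decomposition of the weighted Ricci curvature by the order of its
pole along \<open>A = 0\<close>. Up to the factor \<open>1 / 4\<close>, the pole of order two has the coefficient \<open>\<nu>\<close>: \<open>3 (n - 1)\<close> comes from
the Ricci curvature, the other terms come from the S-curvature and its derivative.\<close>

lemma weighted_ricci_pole:
  fixes a c :: real
  defines "\<nu> \<equiv> 3 * (N - 2) - 4 * a * N - c * N\<^sup>2"
  obtains s0 s1 where "pf s0" "pf s1"
    "\<And>x y. (x, y) \<in> D \<Longrightarrow> weighted_ricci a c D Fm \<rho> x y = \<nu> / 4 * (r x y / F x y)\<^sup>2 + s1 x y / F x y + s0 x y"
proof -
  define s1 where "s1 = (\<lambda>x y. (N - 2) * (r x y * z x y + D0 r x y / 2)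
      + a * N * (r x y * f0 x y - D0 r x y / 2 - 3 / 2 * r x y * z x y) + c * N\<^sup>2 * (f0 x y - z x y / 2) * r x y)"
  define s0 where "s0 = (\<lambda>x y. Ric0 x y - (N - 2) * (z x y)\<^sup>2 / 4 + (N - 2) / 2 * (D0 z x y + (z x y)\<^sup>2)
      + a * N * (D0 f0 x y + z x y * f0 x y - (D0 z x y + (z x y)\<^sup>2) / 2) - c * N\<^sup>2 * (f0 x y - z x y / 2)\<^sup>2)"
  have "pf s1" "pf s0"
    unfolding s1_def s0_def divide_inverse
    by (intro fibre_rational.add rat_diff fibre_rational.mult rat_power rat_const pf_D0 pf_r pf_z pf_f0 pf_Ric0)+
  moreover have "weighted_ricci a c D Fm \<rho> x y = \<nu> / 4 * (r x y / F x y)\<^sup>2 + s1 x y / F x y + s0 x y"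
    if xy: "(x, y) \<in> D" for x y
  proof -
    define q where "q = 1 / F x y"
    have \<kappa>: "\<kappa> x y = q * r x y + z x y" by (simp add: \<kappa>_def q_def)
    have D\<kappa>: "DG \<kappa> x y = q * (D0 r x y + 2 * \<kappa> x y * r x y) + D0 z x y + \<kappa> x y * z x y"
      unfolding DG_\<kappa>[OF xy] by (simp add: q_def)
    have w: "weighted_ricci a c D Fm \<rho> x y =
       Ric0 x y - (N - 2) * ((\<kappa> x y)\<^sup>2 / 4 - DG \<kappa> x y / 2)
       + a * (N * (D0 f0 x y + \<kappa> x y * f0 x y - DG \<kappa> x y / 2)) - c * (N * (f0 x y - \<kappa> x y / 2))\<^sup>2"
      unfolding weighted_ricci_def S_dot_eq[OF xy] S_curvature_eq[OF xy] DG_S[OF xy] ricci_eq[OF xy] by (simp add: S_def)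
    have "weighted_ricci a c D Fm \<rho> x y = \<nu> / 4 * (q * r x y)\<^sup>2 + q * s1 x y + s0 x y"
      unfolding w D\<kappa> \<kappa> s1_def s0_def \<nu>_def
      by (simp add: power2_eq_square field_simps)
    thus ?thesis by (simp add: q_def)
  qed
  ultimately show thesis using that by blast
qed

text \<open>The right-hand side of the Einstein condition has no pole, so \<open>A\<close> divides \<open>r\<^sup>2\<close>. On the lines
\<open>W + t v\<close> with \<open>v\<close> orthogonal to \<open>W\<close> the 1-form \<open>B\<close> is constantly \<open>1\<close> and \<open>A = 1 + m t\<^sup>2\<close>,
so divisibility is one of polynomials in \<open>t\<close>.\<close>

lemma weakly_einstein_imp_\<kappa>_zero:
  fixes a c :: real and \<theta> :: "real^'n \<Rightarrow> real^'n" and \<sigma> :: "real^'n \<Rightarrow> real"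
  assumes \<nu>: "3 * (N - 2) - 4 * a * N - c * N\<^sup>2 \<noteq> 0"
    and \<sigma>: "smooth_on U \<sigma>" and \<theta>: "\<And>i. smooth_on U (\<lambda>x. \<theta> x $ i)"
    and einstein: "\<And>x y. (x, y) \<in> D \<Longrightarrow> weighted_ricci a c D Fm \<rho> x y =
      (N - 2) * (3 * (\<Sum>i\<in>UNIV. \<theta> x $ i * y $ i) / F x y + \<sigma> x) * (F x y)\<^sup>2"
    and x: "x \<in> V"
  shows "\<kappa> x y = 0"
proof -
  define \<nu> where "\<nu> = 3 * (N - 2) - 4 * a * N - c * N\<^sup>2"
  obtain s0 s1 where s: "pf s0" "pf s1"
    "\<And>x y. (x, y) \<in> D \<Longrightarrow> weighted_ricci a c D Fm \<rho> x y = \<nu> / 4 * (r x y / F x y)\<^sup>2 + s1 x y / F x y + s0 x y"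
    using weighted_ricci_pole unfolding \<nu>_def by blast
  \<comment> \<open>the pole-free quotient of \<open>\<nu> r\<^sup>2\<close> by \<open>A\<close>\<close>
  define T where "T = (\<lambda>x y. 2 * inverse (B x y) * (F x y * ((N - 2) * (3 * (\<Sum>i\<in>UNIV. \<theta> x $ i * y $ i) * F x y + \<sigma> x * (F x y)\<^sup>2) - s0 x y) - s1 x y))"
  have "pf T" unfolding T_def
    by (intro fibre_rational.mult rat_diff fibre_rational.add rat_const rat_sum rat_power pf_F s pf_invB
        fibre_rational.base[OF \<theta>] fibre_rational.base[OF \<sigma>] fibre_rational.coord)
  have T: "\<nu> * (r x y)\<^sup>2 = A x y * T x y" if xy: "(x, y) \<in> D" for x y
  proof -
    note p = pos[OF xy]
    let ?R = "(N - 2) * (3 * (\<Sum>i\<in>UNIV. \<theta> x $ i * y $ i) * F x y + \<sigma> x * (F x y)\<^sup>2)"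
    have "\<nu> / 4 * (r x y / F x y)\<^sup>2 + s1 x y / F x y + s0 x y = weighted_ricci a c D Fm \<rho> x y"
      by (rule s(3)[OF xy, symmetric])
    also have "\<dots> = (N - 2) * (3 * (\<Sum>i\<in>UNIV. \<theta> x $ i * y $ i) / F x y + \<sigma> x) * (F x y)\<^sup>2"
      by (rule einstein[OF xy])
    also have "\<dots> = ?R" using p by (simp add: field_simps power2_eq_square)
    finally have e: "\<nu> / 4 * (r x y / F x y)\<^sup>2 = ?R - s0 x y - s1 x y / F x y" by simp
    have "\<nu> * (r x y)\<^sup>2 = 4 * (F x y)\<^sup>2 * (\<nu> / 4 * (r x y / F x y)\<^sup>2)"
      using p by (simp add: power_divide)
    also have "\<dots> = 4 * (F x y)\<^sup>2 * (?R - s0 x y - s1 x y / F x y)"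
      unfolding e ..
    also have "\<dots> = (2 * F x y * B x y) * (2 * inverse (B x y) * (F x y * (?R - s0 x y) - s1 x y))"
      using p by (simp add: field_simps power2_eq_square)
    finally show ?thesis unfolding A_eq[OF xy] T_def .
  qed
  note bil = r_polar_bilinear(1-4)[OF x] r_polar_W_W[OF x] and sym = r_polar_bilinear(5)[OF x]
  have orth: "r_polar x (W x) v = 0 \<and> r_polar x v v = 0" if v: "w x \<bullet> v = 0" for v
  proof (cases "v = 0")
    case True
    thus ?thesis using bil(4)[of _ 0 0] by simp
  next
    case False
    define m where "m = form (h x) v v"
    have m: "m > 0" using h_pos[OF x False] by (simp add: m_def)
    have B1: "w x \<bullet> (W x + t *\<^sub>R v) = 1" for t by (simp add: inner_simps w_W[OF x] v)
    hence line: "(x, W x + t *\<^sub>R v) \<in> D" for t by (simp add: D_iff x)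
    have "\<exists>p. \<forall>t. T x (W x + t *\<^sub>R v) = poly p t"
    proof (rule rat_polynomial_on_line[OF \<open>pf T\<close> line])
      fix H assume "pole_free w H"
      thus "\<exists>c. \<forall>t. H x (W x + t *\<^sub>R v) = c" unfolding pole_free_def using B1 by auto
    qed
    then obtain p where p: "\<And>t. T x (W x + t *\<^sub>R v) = poly p t" by blast
    have A1: "A x (W x + t *\<^sub>R v) = 1 + m * t\<^sup>2" for t
    proof -
      have "form (h x) (W x) (W x) = 1" "form (h x) v (W x) = 0" "form (h x) (W x) v = 0"
        using w_W[OF x] v h_form[OF x, of "W x" v] by (simp_all add: form_def h_W[OF x] inner_commute)
      thus ?thesis by (simp add: A_def form_simps m_def power2_eq_square)
    qed
    have r1: "r x (W x + t *\<^sub>R v) = 2 * r_polar x (W x) v * t + r_polar x v v * t\<^sup>2" for t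
      unfolding r_eq_polar by (simp add: bil sym[of v "W x"] power2_eq_square algebra_simps)
    have "\<nu> * (2 * r_polar x (W x) v * t + r_polar x v v * t\<^sup>2)\<^sup>2 = (1 + m * t\<^sup>2) * poly p t" for t
      using T[OF line[of t]] unfolding A1 r1 p .
    moreover have "\<nu> \<noteq> 0" using \<nu> by (simp add: \<nu>_def)
    ultimately show ?thesis by (rule square_divisible_by_definite_quadratic[OF m])
  qed
  define v where "v = y - (w x \<bullet> y) *\<^sub>R W x"
  have v: "w x \<bullet> v = 0" by (simp add: v_def inner_simps w_W[OF x])
  have y: "y = (w x \<bullet> y) *\<^sub>R W x + v" by (simp add: v_def)
  have "r x y = 0"
    unfolding r_eq_polar by (subst (1 2) y) (simp add: bil sym[of v "W x"] orth[OF v])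
  moreover have "r_polar x (W x) y = 0"
    by (subst y) (simp add: bil orth[OF v])
  hence "z x y = 0" using r_polar_W[OF x, of y] by simp
  ultimately show ?thesis by (simp add: \<kappa>_def)
qed

end

section \<open>Passage to the charts\<close>

context kropina_navigation begin

lemma unit_ball_navigation:
  assumes "x \<in> V"
  shows "{y. (x, y) \<in> D \<and> Fm x y < 1} = {y. form (h x) (y - W x) (y - W x) < 1}"
proof (intro Collect_cong)
  fix y
  have "form (h x) (y - W x) (y - W x) = A x y - 2 * B x y + 1"
    using w_W[OF assms] h_form[OF assms, of "W x" y]
    by (simp add: form_simps) (simp add: form_def A_def B_def h_W[OF assms] inner_commute)
  hence 1: "form (h x) (y - W x) (y - W x) < 1 \<longleftrightarrow> A x y < 2 * B x y" by simp
  have A: "A x y \<ge> 0" using h_pos[OF assms, of y] by (cases "y = 0") (auto simp: A_def form_simps)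
  have D: "(x, y) \<in> D \<longleftrightarrow> B x y > 0" using assms by (simp add: D_iff B_def)
  show "(x, y) \<in> D \<and> Fm x y < 1 \<longleftrightarrow> form (h x) (y - W x) (y - W x) < 1"
  proof (cases "B x y > 0")
    case True
    hence "Fm x y < 1 \<longleftrightarrow> A x y < 2 * B x y" using Fm[of x y] D by (simp add: F_def)
    thus ?thesis using True 1 D by simp
  next
    case False
    thus ?thesis using A 1 D by simp
  qed
qed

lemma bh_density_eq:
  assumes "x \<in> V"
  shows "bh_density D Fm x = sqrt (det (h x))"
proof -
  have "measure lborel (ball (0 :: real^'n) 1) > 0" by (rule content_ball_pos) simp
  thus ?thesis
    using measure_ellipsoid(2)[of "h x" "W x", OF h_sym[OF assms] h_pos[OF assms]]
    unfolding bh_density_def unit_ball_navigation[OF assms] by simp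
qed

end

text \<open>The navigation data of \<open>g(y, y) / b(y)\<close>: rescaling \<open>g\<close> by \<open>4 / s\<close>, with \<open>s\<close> the squared length
of \<open>b\<close>, makes half of the vector dual to \<open>b\<close> a unit vector. Zeros of \<open>b\<close> have to be left out; the
conic domain is empty over them.\<close>

lemma kropina_navigation_data:
  fixes g :: "real^'n::finite \<Rightarrow> real^'n^'n" and b :: "real^'n \<Rightarrow> real^'n"
  assumes U: "open U" and g: "\<And>i j. smooth_on U (\<lambda>x. g x $ i $ j)" and b: "\<And>i. smooth_on U (\<lambda>x. b x $ i)"
    and sym: "\<And>x. x \<in> U \<Longrightarrow> transpose (g x) = g x"
    and pos: "\<And>x v. x \<in> U \<Longrightarrow> v \<noteq> 0 \<Longrightarrow> form (g x) v v > 0"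
  defines "D \<equiv> {(x, y). x \<in> U \<and> b x \<bullet> y > 0}"
  defines "s \<equiv> \<lambda>x. b x \<bullet> (matrix_inv (g x) *v b x)"
  shows "kropina_navigation U D {x \<in> U. b x \<noteq> 0} (\<lambda>x. (4 / s x) *\<^sub>R g x) (\<lambda>x. (s x / 4) *\<^sub>R matrix_inv (g x))
    (\<lambda>x. (2 / s x) *\<^sub>R b x) (\<lambda>x. (1 / 2) *\<^sub>R (matrix_inv (g x) *v b x)) (\<lambda>x y. form (g x) y y / (b x \<bullet> y))"
proof -
  let ?V = "{x \<in> U. b x \<noteq> 0}" and ?gi = "\<lambda>x. matrix_inv (g x)"
  let ?w = "\<lambda>x. (2 / s x) *\<^sub>R b x"
  have "continuous_on U (\<lambda>x. b x $ i)" for i using b[of i] unfolding smooth_on_def by (metis Ck_on.simps(1))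
  hence "continuous_on U (\<lambda>x. \<chi> i. b x $ i)" by (intro continuous_on_vec_lambda)
  hence "continuous_on U b" by simp
  hence "continuous_on (U \<times> UNIV) (\<lambda>z. b (fst z))"
    by (rule continuous_on_compose2[OF _ continuous_on_fst[OF continuous_on_id]]) auto
  hence "continuous_on (U \<times> UNIV) (\<lambda>z. b (fst z) \<bullet> snd z)"
    by (intro continuous_on_inner continuous_on_snd continuous_on_id)
  hence "open ((U \<times> UNIV) \<inter> (\<lambda>z. b (fst z) \<bullet> snd z) -` {0<..})"
    by (rule continuous_open_preimage) (auto intro: open_Times U)
  also have "(U \<times> UNIV) \<inter> (\<lambda>z. b (fst z) \<bullet> snd z) -` {0<..} = D" by (auto simp: D_def)
  finally have openD: "open D" .
  interpret fibre_domain U D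
    by standard (use U openD in \<open>auto simp: D_def\<close>)
  have DV: "x \<in> ?V" if "(x, y) \<in> D" for x y using that by (auto simp: D_def)
  have det: "det (g x) \<noteq> 0" if "x \<in> U" for x
    using measure_ellipsoid(1)[OF sym pos] that by force
  have inv: "g x ** ?gi x = mat 1" if "x \<in> U" for x
  proof -
    have "invertible (g x)" using det[OF that] by (simp add: invertible_det_nz)
    thus ?thesis unfolding invertible_def matrix_inv_def by (rule someI2_ex) simp
  qed
  have gv: "g x *v (?gi x *v v) = v" if "x \<in> U" for x v by (simp add: matrix_vector_mul_assoc inv[OF that])
  have s: "s x > 0" if "x \<in> ?V" for x
  proof -
    have "?gi x *v b x \<noteq> 0" using gv[of x "b x"] that by auto
    hence "form (g x) (?gi x *v b x) (?gi x *v b x) > 0" using pos that by blast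
    thus ?thesis using gv[of x "b x"] that by (simp add: form_def s_def inner_commute)
  qed
  let ?S = "pole_free ?w"
  have rg: "rat ?S (\<lambda>x y. g x $ i $ j)" for i j by (rule fibre_rational.base[OF g])
  have rb: "rat ?S (\<lambda>x y. b x $ i)" for i by (rule fibre_rational.base[OF b])
  have rdet: "rat ?S (\<lambda>x y. det (M x))" if "\<And>i j. rat ?S (\<lambda>x y. M x $ i $ j)" for M :: "real^'n \<Rightarrow> real^'n^'n"
    unfolding det_def by (intro rat_sum fibre_rational.mult rat_const rat_prod that)
  have rinv: "rat ?S (\<lambda>x y. inverse (\<phi> x))" if "rat ?S (\<lambda>x y. \<phi> x)" "\<And>x. x \<in> ?V \<Longrightarrow> \<phi> x \<noteq> 0" for \<phi>
    by (rule fibre_rational.inverse[OF that(1)]) (use that(2) DV in \<open>auto simp: pole_free_def\<close>)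
  \<comment> \<open>by Cramer's rule the entries of the inverse are quotients of determinants\<close>
  have rgi: "rat ?S (\<lambda>x y. ?gi x $ k $ l)" for k l
  proof -
    have "rat ?S (\<lambda>x y. det (\<chi> i j. if j = k then axis l 1 $ i else g x $ i $ j) * inverse (det (g x)))"
    proof (intro fibre_rational.mult rdet rinv rg)
      fix i j show "rat ?S (\<lambda>x y. (\<chi> i j. if j = k then axis l 1 $ i else g x $ i $ j) $ i $ j)"
        by (cases "j = k") (simp_all add: rg)
    qed (use det in auto)
    thus ?thesis
    proof (rule fibre_rational.cong)
      fix x y assume "(x, y) \<in> D"
      hence x: "x \<in> U" using DV by auto
      have "?gi x *v axis l 1 = (\<chi> k. det (\<chi> i j. if j = k then axis l 1 $ i else g x $ i $ j) / det (g x))"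
        using cramer[OF det[OF x]] gv[OF x] by blast
      hence "(?gi x *v axis l 1) $ k = det (\<chi> i j. if j = k then axis l 1 $ i else g x $ i $ j) / det (g x)" by simp
      thus "?gi x $ k $ l = det (\<chi> i j. if j = k then axis l 1 $ i else g x $ i $ j) * inverse (det (g x))"
        by (simp add: matrix_vector_mult_basis column_def divide_inverse)
    qed
  qed
  have rgib: "rat ?S (\<lambda>x y. (?gi x *v b x) $ i)" for i
    unfolding matrix_vector_mult_def vec_lambda_beta by (intro rat_sum fibre_rational.mult rgi rb)
  have "rat ?S (\<lambda>x y. \<Sum>i\<in>UNIV. b x $ i * (?gi x *v b x) $ i)"
    by (intro rat_sum fibre_rational.mult rgib rb)
  moreover have "s x = (\<Sum>i\<in>UNIV. b x $ i * (?gi x *v b x) $ i)" for x by (simp add: s_def inner_vec_def)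
  ultimately have rs: "rat ?S (\<lambda>x y. s x)" by (rule fibre_rational.cong)
  have rsi: "rat ?S (\<lambda>x y. inverse (s x))" by (rule rinv[OF rs]) (use s in force)
  let ?h = "\<lambda>x. (4 / s x) *\<^sub>R g x" and ?W = "\<lambda>x. (1 / 2) *\<^sub>R (?gi x *v b x)"
  have nav: "navigation U D ?V ?h (\<lambda>x. (s x / 4) *\<^sub>R ?gi x) ?w ?W"
  proof unfold_locales
    fix x y
    show "(x, y) \<in> D \<longleftrightarrow> x \<in> ?V \<and> ?w x \<bullet> y > 0"
      using s[of x] by (cases "b x = 0") (auto simp: D_def zero_less_divide_iff zero_less_mult_iff)
  next
    fix x assume x: "x \<in> ?V"
    note sx = s[OF x]
    show "transpose ((4 / s x) *\<^sub>R g x) = (4 / s x) *\<^sub>R g x"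
      using sym[of x] x by (simp add: transpose_def vec_eq_iff)
    show "form ((4 / s x) *\<^sub>R g x) v v > 0" if "v \<noteq> 0" for v
      using pos[of x v] x sx that by (simp add: form_def scaleR_matrix_vector_assoc[symmetric])
    show "((4 / s x) *\<^sub>R g x) ** ((s x / 4) *\<^sub>R ?gi x) = mat 1"
      using inv[of x] x sx by (simp add: matrix_scalar_ac scalar_matrix_assoc)
    show "((4 / s x) *\<^sub>R g x) *v ((1 / 2) *\<^sub>R (?gi x *v b x)) = ?w x"
      using gv[of x] x by (simp add: scaleR_matrix_vector_assoc[symmetric] matrix_vector_mult_scaleR)
    show "?w x \<bullet> ((1 / 2) *\<^sub>R (?gi x *v b x)) = 1"
      using sx by (simp add: s_def)
  next
    fix i j
    have "rat ?S (\<lambda>x y. 4 * inverse (s x) * g x $ i $ j)" by (intro fibre_rational.mult rat_const rsi rg)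
    moreover have "((4 / s x) *\<^sub>R g x) $ i $ j = 4 * inverse (s x) * g x $ i $ j" for x by (simp add: divide_inverse)
    ultimately show "rat ?S (\<lambda>x y. ((4 / s x) *\<^sub>R g x) $ i $ j)" by (rule fibre_rational.cong)
    have "rat ?S (\<lambda>x y. 1 / 4 * s x * ?gi x $ i $ j)" by (intro fibre_rational.mult rat_const rs rgi)
    moreover have "((s x / 4) *\<^sub>R ?gi x) $ i $ j = 1 / 4 * s x * ?gi x $ i $ j" for x by simp
    ultimately show "rat ?S (\<lambda>x y. ((s x / 4) *\<^sub>R ?gi x) $ i $ j)" by (rule fibre_rational.cong)
    have "rat ?S (\<lambda>x y. 2 * inverse (s x) * b x $ i)" by (intro fibre_rational.mult rat_const rsi rb)
    moreover have "?w x $ i = 2 * inverse (s x) * b x $ i" for x by (simp add: divide_inverse)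
    ultimately show "rat ?S (\<lambda>x y. ?w x $ i)" by (rule fibre_rational.cong)
    have "rat ?S (\<lambda>x y. 1 / 2 * (?gi x *v b x) $ i)" by (intro fibre_rational.mult rat_const rgib)
    moreover have "?W x $ i = 1 / 2 * (?gi x *v b x) $ i" for x by simp
    ultimately show "rat ?S (\<lambda>x y. ?W x $ i)" by (rule fibre_rational.cong)
  qed
  then interpret N: navigation U D ?V ?h "\<lambda>x. (s x / 4) *\<^sub>R ?gi x" ?w ?W .
  show ?thesis
  proof unfold_locales
    fix x y assume "(x, y) \<in> D"
    hence "s x > 0" "b x \<bullet> y > 0" using s DV by (auto simp: D_def)
    thus "form (g x) y y / (b x \<bullet> y) = N.F x y"
      by (simp add: N.F_def N.A_def N.B_def form_def scaleR_matrix_vector_assoc[symmetric])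
  qed
qed

theorem theorem3p6:
  fixes A :: "('m::{t2_space, second_countable_topology}, 'n::finite) chart set"
    and g :: "('m, 'n) chart \<Rightarrow> real ^ 'n \<Rightarrow> real ^ 'n ^ 'n"
    and b :: "('m, 'n) chart \<Rightarrow> real ^ 'n \<Rightarrow> real ^ 'n"
    and D :: "('m, 'n) chart \<Rightarrow> ((real ^ 'n) \<times> (real ^ 'n)) set"
    and F :: "('m, 'n) chart \<Rightarrow> real ^ 'n \<Rightarrow> real ^ 'n \<Rightarrow> real"
    and BH dV :: "('m, 'n) chart \<Rightarrow> real ^ 'n \<Rightarrow> real"
    and f :: "'m \<Rightarrow> real"
    and a c n :: real
  assumes "smooth_atlas A"
    and "riemannian_metric A g"
    and "one_form A b"
    and "smooth_function A f"
    and "n = real CARD('n)"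
    and "D = kropina_domain b"
    and "F = kropina g b"
    and "BH = (\<lambda>p. bh_density (D p) (F p))"
    and "dV = (\<lambda>p x. exp (- (n + 1) * f (chart_point p x)) * BH p x)"
    and "weakly_weighted_einstein A D F dV a c"
    and "3 * (n - 1) - 4 * a * (n + 1) - c * (n + 1)\<^sup>2 \<noteq> 0"
  shows "isotropic_S_curvature A D F BH"
proof -
  obtain \<sigma> \<theta> where \<sigma>: "smooth_function A \<sigma>" and \<theta>: "one_form A \<theta>"
    and einstein: "\<And>p x y. p \<in> A \<Longrightarrow> (x, y) \<in> D p \<Longrightarrow> weighted_ricci a c (D p) (F p) (dV p) x y =
          (n - 1) * (3 * (\<Sum>i\<in>UNIV. \<theta> p x $ i * y $ i) / F p x y + \<sigma> (chart_point p x)) * (F p x y)\<^sup>2"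
    using assms(10) unfolding weakly_weighted_einstein_def assms(5) by blast
  have "S_curvature (D p) (F p) (BH p) x y = 0" if p: "p \<in> A" and xy: "(x, y) \<in> D p" for p x y
  proof -
    let ?U = "chart_image p"
    have D: "D p = {(x, y). x \<in> ?U \<and> b p x \<bullet> y > 0}"
      by (simp add: assms(6) kropina_domain_def beta_def inner_vec_def)
    have pos: "form (g p x) v v > 0" if "x \<in> ?U" "v \<noteq> 0" for x v
      using assms(2) p that unfolding riemannian_metric_def form_def by blast
    have F: "F p x y = form (g p x) y y / (b p x \<bullet> y)" if "x \<in> ?U" for x y
    proof -
      have "(\<Sum>i\<in>UNIV. \<Sum>j\<in>UNIV. g p x $ i $ j * y $ i * y $ j) = form (g p x) y y"
        by (simp add: form_def inner_vec_def matrix_vector_mult_def sum_distrib_left mult_ac)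
      moreover have "form (g p x) y y \<ge> 0" using pos[OF that, of y] by (cases "y = 0") (auto simp: form_simps)
      ultimately show ?thesis by (simp add: assms(7) kropina_def alpha_def beta_def inner_vec_def)
    qed
    define s where "s = (\<lambda>x. b p x \<bullet> (matrix_inv (g p x) *v b p x))"
    let ?V = "{x \<in> ?U. b p x \<noteq> 0}"
    let ?h = "\<lambda>x. (4 / s x) *\<^sub>R g p x" and ?hi = "\<lambda>x. (s x / 4) *\<^sub>R matrix_inv (g p x)"
      and ?w = "\<lambda>x. (2 / s x) *\<^sub>R b p x" and ?W = "\<lambda>x. (1 / 2) *\<^sub>R (matrix_inv (g p x) *v b p x)"
    have nav: "kropina_navigation ?U (D p) ?V ?h ?hi ?w ?W (\<lambda>x y. form (g p x) y y / (b p x \<bullet> y))"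
      unfolding D s_def
    proof (rule kropina_navigation_data)
      show "open ?U" using assms(1) p unfolding smooth_atlas_def by blast
    qed (use assms(2,3) p pos in \<open>auto simp: riemannian_metric_def one_form_def\<close>)
    then interpret K0: kropina_navigation ?U "D p" ?V ?h ?hi ?w ?W "\<lambda>x y. form (g p x) y y / (b p x \<bullet> y)" .
    have "F p x y = K0.F x y" if "(x, y) \<in> D p" for x y
    proof -
      have "x \<in> ?U" using that by (simp add: D)
      thus ?thesis using F K0.Fm[OF that] by simp
    qed
    then interpret K: kropina_navigation ?U "D p" ?V ?h ?hi ?w ?W "F p"
      by unfold_locales
    have BH: "BH p x = sqrt (det (?h x))" if "x \<in> ?V" for x
      using K.bh_density_eq[OF that] by (simp add: assms(8))
    interpret Kf: weighted_kropina ?U "D p" ?V ?h ?hi ?w ?W "F p" "\<lambda>x. f (chart_point p x)" "dV p" "n + 1"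
      by unfold_locales (use assms(4,5,9) p BH in \<open>auto simp: smooth_function_def\<close>)
    interpret K1: weighted_kropina ?U "D p" ?V ?h ?hi ?w ?W "F p" "\<lambda>x. 0" "BH p" "n + 1"
      by unfold_locales (use assms(5) BH in \<open>auto simp: smooth_on_const\<close>)
    have "K0.\<kappa> x y = 0"
    proof (rule Kf.weakly_einstein_imp_\<kappa>_zero)
      show "3 * (n + 1 - 2) - 4 * a * (n + 1) - c * (n + 1)\<^sup>2 \<noteq> 0" using assms(11) by simp
      show "smooth_on ?U (\<lambda>x. \<sigma> (chart_point p x))" using \<sigma> p by (simp add: smooth_function_def)
      show "smooth_on ?U (\<lambda>x. \<theta> p x $ i)" for i using \<theta> p by (simp add: one_form_def)
      show "x \<in> ?V" using K0.pos(4)[OF xy] .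
      fix x y assume xy: "(x, y) \<in> D p"
      show "weighted_ricci a c (D p) (F p) (dV p) x y =
        (n + 1 - 2) * (3 * (\<Sum>i\<in>UNIV. \<theta> p x $ i * y $ i) / K0.F x y + \<sigma> (chart_point p x)) * (K0.F x y)\<^sup>2"
        using einstein[OF p xy] K.Fm[OF xy] by simp
    qed
    moreover have "K1.f0 x y = 0" by (simp add: K1.f0_def)
    ultimately show ?thesis using K1.S_curvature_eq[OF xy] by (simp add: K1.S_def)
  qed
  hence "\<forall>p\<in>A. \<forall>(x, y)\<in>D p. S_curvature (D p) (F p) (BH p) x y = (real CARD('n) + 1) * 0 * F p x y" by auto
  moreover have "smooth_function A (\<lambda>_. 0)" by (simp add: smooth_function_def smooth_on_const)
  \<comment> \<open>the factor is \<open>0\<close> everywhere, so it is smooth across the zeros of the 1-form too\<close>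
  ultimately show ?thesis unfolding isotropic_S_curvature_def by (intro exI[of _ "\<lambda>_. 0"]) blast
qed

end
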